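(* Let $t\ge 4$ be an integer, $g=2t-2$, and $\mathbf{x}=(x_1,\dots,x_t)$ be independent variables. Then $$\sum_{\lambda\in\mathcal{DD}_{g}^{'2}} (-1)^{d_{\lambda}+|H_{<g,+}|}\,T^{|\lambda|/2}\,\mathrm{o}^{\mathrm{even}}_{\mu}(\mathbf{x})=(T;T)_\infty^{t}\, K_T(t,\mathbf{x}),$$ where $d_\lambda$ is the length of the main diagonal of $\lambda$, $H_{<g,+}=\{s\in\lambda\mid h_s<g,\ \varepsilon'_s=1\}$, and $\mu=\mu(\lambda)$ is the partition given by $\mu_i=v_i+i-g$ for $1\le i\le t$, with $\mathbf{v}$ the $V_{g,t}$-coding of $\lambda$.
   Context: $(a;T)_\infty=\prod_{j\ge0}(1-aT^j)$, and $K_T(t,\mathbf{x})=\prod_{1\le i<j\le t}(Tx_ix_j;T)_\infty(Tx_ix_j^{-1};T)_\infty(Tx_i^{-1}x_j;T)_\infty(Tx_i^{-1}x_j^{-1};T)_\infty$. The identity is between formal power series in $T$ with Laurent polynomial coefficients in the $x_i$. For a partition $\lambda$, $h_s$ is the hook length of a box $s$, $d_\lambda=\max\{s:\lambda_s\ge s\}$ is the number of boxes on the main diagonal, and $\varepsilon'_s=1$ if $s$ is strictly above the main diagonal of the Ferrers diagram (English convention), $\varepsilon'_s=-1$ otherwise. $\mathcal{DD}$ is the set of partitions with $\lambda_i=\lambda'_i+1$ for $1\le i\le d_\lambda$ ($\lambda'$ the conjugate; the empty partition included), and $\mathcal{DD}'=\{\lambda'\mid\lambda\in\mathcal{DD}\}$.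 Word of a partition: $\psi(\lambda)=(c_k)_{k\in\mathbb{Z}}\in\{0,1\}^{\mathbb{Z}}$ encodes the border of the Ferrers diagram read from South-West to North-East ($0$ vertical step, $1$ horizontal step), indexed so that $\#\{k\le -1: c_k=1\}=\#\{k\ge 0: c_k=0\}$; equivalently $c_k=0$ iff $k=\lambda_i-i$ for some $i\ge1$ (with $\lambda_i=0$ beyond the length). The $g$-quotient of $\lambda$ is $(\nu^{(0)},\dots,\nu^{(g-1)})$, where $\nu^{(k)}$ is the partition whose word is, up to a shift of indices, the subword $(c_{gi+k})_{i\in\mathbb{Z}}$. $\mathcal{DD}_{2t-2}^{'2}$ is the set of $\lambda\in\mathcal{DD}'$ whose $(2t-2)$-quotient satisfies: $\nu^{(k)}=\emptyset$ for all $k\notin\{t-2,2t-3\}$; $\nu^{(2t-3)}$ is, for some integer $m_1\ge1$, the rectangular partition with $m_1$ parts all equal to $m_1-1$ (empty if $m_1=1$); and $\nu^{(t-2)}$ is, for some integer $m_t\ge0$, the $m_t\times m_t$ square partition. $V_{g,t}$-coding: for $i\in\{0,\dots,g-1\}$ let $\beta_i=\max\{(k+1)g+i\mid k\in\mathbb{Z},\ c_{kg+i}=0\}$; the $V_{g,t}$-coding is $\mathbf{v}=(v_1>\dots>v_t)$, the $t$ largest of the distinct integers $\beta_0,\dots,\beta_{g-1}$ in decreasing order. Even orthogonal character: $\mathrm{o}^{\mathrm{even}}_\mu(\mathbf{x})=\dfrac{2\det_{1\le i,j\le t}\big(x_i^{\mu_j+t-j}+x_i^{-(\mu_j+t-j)}\big)}{(1+\delta_{\mu_t,0})\det_{1\le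 i,j\le t}\big(x_i^{t-j}+x_i^{-(t-j)}\big)}$, with $\delta$ the Kronecker delta. *)

theory Defs
  imports
    "HOL-Library.Poly_Mapping"
    "HOL-Analysis.Infinite_Sum"
    "HOL-Analysis.Infinite_Products"
    "HOL-Computational_Algebra.Formal_Power_Series"
    "HOL-Computational_Algebra.Fraction_Field"
    "Jordan_Normal_Form.Determinant"
begin

section \<open>Partitions\<close>

text \<open>A partition is the list of its positive parts in weakly decreasing order. Indices of parts
  and coordinates of boxes start at 1; \<open>part l i\<close> is \<open>0\<close> beyond the length (and, as a junk value,
  at \<open>i = 0\<close>).\<close>

definition is_partition :: "nat list \<Rightarrow> bool" where
  "is_partition l \<longleftrightarrow> sorted_wrt (\<ge>) l \<and> 0 \<notin> set l"

definition part :: "nat list \<Rightarrow> nat \<Rightarrow> nat" where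
  "part l i = (if 1 \<le> i \<and> i \<le> length l then l ! (i - 1) else 0)"

definition conj_partition :: "nat list \<Rightarrow> nat list" where
  "conj_partition l = map (\<lambda>j. card {i. 1 \<le> i \<and> j \<le> part l i}) [1..<part l 1 + 1]"

text \<open>The rectangle with \<open>a\<close> parts equal to \<open>b\<close>; it is the empty partition if \<open>b = 0\<close>.\<close>

definition rectangle :: "nat \<Rightarrow> nat \<Rightarrow> nat list" where
  "rectangle a b = (if b = 0 then [] else replicate a b)"

text \<open>Boxes are pairs (row, column), rows being numbered from top to bottom.\<close>

definition boxes :: "nat list \<Rightarrow> (nat \<times> nat) set" where
  "boxes l = {(i, j). 1 \<le> i \<and> 1 \<le> j \<and> j \<le> part l i}"

text \<open>Arm plus leg plus one; the truncated subtractions are exact for boxes of \<open>l\<close>.\<close>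

definition hook :: "nat list \<Rightarrow> nat \<times> nat \<Rightarrow> nat" where
  "hook l = (\<lambda>(i, j). (part l i - j) + (part (conj_partition l) j - i) + 1)"

text \<open>Since \<open>part l 0 = 0\<close>, the set below always contains \<open>0\<close>, so the diagonal of the empty
  partition has length \<open>0\<close>.\<close>

definition diag_length :: "nat list \<Rightarrow> nat" where
  "diag_length l = Max {s. part l s \<ge> s}"

definition eps' :: "nat \<times> nat \<Rightarrow> int" where
  "eps' = (\<lambda>(i, j). if i < j then 1 else - 1)"

definition H_lt_plus :: "nat \<Rightarrow> nat list \<Rightarrow> (nat \<times> nat) set" where
  "H_lt_plus g l = {s \<in> boxes l. hook l s < g \<and> eps' s = 1}"

definition DD :: "nat list set" where
  "DD = {l. is_partition l \<and>
      (\<forall>i. 1 \<le> i \<and> i \<le> diag_length l \<longrightarrow> part l i = part (conj_partition l) i + 1)}"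

definition DD' :: "nat list set" where
  "DD' = conj_partition ` DD"


section \<open>Words, quotients and codings\<close>

definition word :: "nat list \<Rightarrow> int \<Rightarrow> nat" where
  "word l k = (if \<exists>i\<ge>1. k = int (part l i) - int i then 0 else 1)"

text \<open>The subword determines \<open>\<nu>\<close> uniquely: only one shift \<open>s\<close> of it satisfies the
  normalisation of indices that words of partitions obey.\<close>

definition quotient :: "nat \<Rightarrow> nat list \<Rightarrow> nat \<Rightarrow> nat list" where
  "quotient g l k =
    (THE \<nu>. is_partition \<nu> \<and> (\<exists>s. \<forall>i. word \<nu> i = word l (int g * (i + s) + int k)))"

definition DD2' :: "nat \<Rightarrow> nat list set" where
  "DD2' t = {l \<in> DD'.
      (\<forall>k < 2 * t - 2. k \<notin> {t - 2, 2 * t - 3} \<longrightarrow> quotient (2 * t - 2) l k = []) \<and>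
      (\<exists>m\<ge>1. quotient (2 * t - 2) l (2 * t - 3) = rectangle m (m - 1)) \<and>
      (\<exists>m\<ge>0. quotient (2 * t - 2) l (t - 2) = rectangle m m)}"

definition beta :: "nat \<Rightarrow> nat list \<Rightarrow> nat \<Rightarrow> int" where
  "beta g l i =
    (GREATEST b. \<exists>k::int. b = (k + 1) * int g + int i \<and> word l (k * int g + int i) = 0)"

text \<open>\<open>V_coding g l j\<close> is the \<open>j\<close>-th largest of the \<open>g\<close> integers \<open>\<beta>\<^sub>i\<close>; the \<open>V\<^sub>g\<^sub>,\<^sub>t\<close>-coding is
  \<open>V_coding g l 1 > \<dots> > V_coding g l t\<close>.\<close>

definition V_coding :: "nat \<Rightarrow> nat list \<Rightarrow> nat \<Rightarrow> int" where
  "V_coding g l j = rev (sorted_list_of_set (beta g l ` {0..<g})) ! (j - 1)"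

definition mu :: "nat \<Rightarrow> nat list \<Rightarrow> nat \<Rightarrow> int" where
  "mu g l i = V_coding g l i + int i - int g"


section \<open>Laurent polynomials, characters and products\<close>

text \<open>Laurent polynomials with integer coefficients in the variables \<open>x\<^sub>i\<close> (\<open>i\<close> a natural number):
  the group ring of the free abelian group of exponent vectors \<open>nat \<Rightarrow>\<^sub>0 int\<close>. They embed into
  their field of fractions, where the quotient of determinants defining the character is formed.\<close>

type_synonym laurent = "(nat \<Rightarrow>\<^sub>0 int) \<Rightarrow>\<^sub>0 int"

definition xvar :: "nat \<Rightarrow> laurent fract" where
  "xvar i = to_fract (Poly_Mapping.single (Poly_Mapping.single i 1) 1)"

text \<open>Matrix indices of \<^const>\<open>mat\<close> start at 0, hence the shift by 1.\<close>

definition orth_det :: "nat \<Rightarrow> (nat \<Rightarrow> int) \<Rightarrow> laurent fract" where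
  "orth_det t e = Determinant.det (mat t t (\<lambda>(i, j).
      xvar (i + 1) powi e (j + 1) + xvar (i + 1) powi (- e (j + 1))))"

definition o_even :: "nat \<Rightarrow> (nat \<Rightarrow> int) \<Rightarrow> laurent fract" where
  "o_even t m =
    2 * orth_det t (\<lambda>j. m j + int t - int j) /
    ((1 + (if m t = 0 then 1 else 0)) * orth_det t (\<lambda>j. int t - int j))"

text \<open>\<open>(a; T)\<^sub>\<infinity>\<close> with \<open>T = fps_X\<close>; infinite products and sums of formal power series are taken
  with respect to the \<open>T\<close>-adic topology.\<close>

definition qpoch_inf :: "laurent fract fps \<Rightarrow> laurent fract fps" where
  "qpoch_inf a = prodinf (\<lambda>j. 1 - a * fps_X ^ j)"

definition K_T :: "nat \<Rightarrow> laurent fract fps" where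
  "K_T t = (\<Prod>(i, j) \<in> {(i, j). 1 \<le> i \<and> i < j \<and> j \<le> t}.
      qpoch_inf (fps_X * fps_const (xvar i * xvar j)) *
      qpoch_inf (fps_X * fps_const (xvar i * inverse (xvar j))) *
      qpoch_inf (fps_X * fps_const (inverse (xvar i) * xvar j)) *
      qpoch_inf (fps_X * fps_const (inverse (xvar i) * inverse (xvar j))))"

end

theory Submission
  imports Defs
begin

text \<open>Put \<open>h = t - 1\<close> and \<open>\<theta>\<^sub>j(x) = \<Sum> T\<^bsup>(k\<^sup>2 - j\<^sup>2)/4h\<^esup> x\<^sup>k\<close>, summed over the \<open>k\<close> congruent to \<open>j\<close> or \<open>-j\<close>
  modulo \<open>2h\<close>. The Jacobi triple product writes each factor of \<open>K\<^sub>T\<close>, up to an explicit multiple, as a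
  \<open>2 \<times> 2\<close> determinant of even theta functions of level 1. Hence the product over all pairs is a
  Vandermonde determinant, whose columns have level \<open>h\<close> and lie in the \<open>t\<close>-dimensional span of
  \<open>\<theta>\<^sub>0, \<dots>, \<theta>\<^sub>h\<close>; so it is a constant multiple of \<open>det (\<theta>\<^sub>j(x\<^sub>i))\<close>. Evaluating at \<open>2h\<close>-th roots of unity gives the
  constant. Expanding the determinant yields a sum over tuples of exponents \<open>e\<^sub>j\<close> congruent to \<open>j\<close> or \<open>-j\<close>
  modulo \<open>2h\<close>. These tuples correspond to the partitions in question through their bead sets: the
  sorted tuple is the shifted \<open>V\<close>-coding, and the sign of the sorting permutation and the exponent of
  \<open>T\<close> are matched with the diagonal, the short hooks and the size by repeatedly reflecting the largest
  exponent.\<close>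

text \<open>The variables \<open>xvar i\<close> cannot be specialised to roots of unity inside their
  own field. The constant is therefore built as a determinant of integer power series that does not
  mention the points: it is computed once over the complex numbers and carried to any field of
  characteristic zero by \<open>ofi\<close>. At a \<open>2h\<close>-th root of unity
  \<open>x^k\<close> depends only on \<open>k\<close> modulo \<open>2h\<close>, so each
  \<open>\<theta>\<^sub>j\<close> becomes a number times a series independent of the point, and the
  determinant factors. The product over pairs is accessible there only through its square; the
  constant coefficient then picks the sign. Theta functions are kept as coefficient arrays
  \<open>\<phi> a k\<close>, because a value at one point no longer remembers the substitution of
  \<open>X x\<close> for \<open>x\<close> that defines the level. On the combinatorial side no
  sorting permutation is followed. One reflection removes one positive bead; the short hooks above
  the diagonal lost with it, plus the one lost diagonal box, have the parity of the number of
  exponents that the reflected one jumps over.\<close>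

unbundle no vec_syntax
no_notation vec_index (infixl "$" 100)
unbundle fps_syntax

section \<open>X-adic limits of formal power series\<close>

definition agree :: "nat \<Rightarrow> 'a::comm_ring_1 fps \<Rightarrow> 'a fps \<Rightarrow> bool" where
  "agree m a b \<longleftrightarrow> (\<forall>i\<le>m. a $ i = b $ i)"

lemma agree_refl [simp]: "agree m a a"
  by (simp add: agree_def)

lemma agree_sym: "agree m a b \<Longrightarrow> agree m b a"
  by (simp add: agree_def)

lemma agree_trans [trans]: "agree m a b \<Longrightarrow> agree m b c \<Longrightarrow> agree m a c"
  by (simp add: agree_def)

lemma agree_mult: "agree m a b \<Longrightarrow> agree m c d \<Longrightarrow> agree m (a * c) (b * d)"
  by (auto simp: agree_def fps_mult_nth intro!: sum.cong)

lemma agree_cancel: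
  fixes q :: "'a::field fps"
  assumes "q $ 0 \<noteq> 0" "agree m (q * a) (q * b)"
  shows "agree m a b"
proof -
  have "agree m (inverse q * (q * a)) (inverse q * (q * b))"
    by (intro agree_mult assms agree_refl)
  moreover have "inverse q * (q * x) = x" for x
    using inverse_mult_eq_1[OF assms(1)] by (simp flip: mult.assoc)
  ultimately show ?thesis by simp
qed

text \<open>Convergence means that each coefficient is eventually constant; congruence modulo
  \<open>X^(m+1)\<close> involves only finitely many coefficients, so these conditions can be met
  simultaneously. Being compatible with products, congruences are easier to handle than single
  coefficients.\<close>

lemma tendsto_fps_iff_agree:
  "(f \<longlongrightarrow> (L :: 'a::comm_ring_1 fps)) F \<longleftrightarrow> (\<forall>m. eventually (\<lambda>n. agree m (f n) L) F)"
proof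
  assume "(f \<longlongrightarrow> L) F"
  then have *: "\<forall>i. eventually (\<lambda>n. f n $ i = L $ i) F"
    by (simp add: tendsto_fps_iff)
  show "\<forall>m. eventually (\<lambda>n. agree m (f n) L) F"
  proof
    fix m
    have "eventually (\<lambda>n. \<forall>i\<in>{..m}. f n $ i = L $ i) F"
      by (subst eventually_ball_finite_distrib) (use * in auto)
    then show "eventually (\<lambda>n. agree m (f n) L) F"
      by eventually_elim (auto simp: agree_def)
  qed
next
  assume *: "\<forall>m. eventually (\<lambda>n. agree m (f n) L) F"
  show "(f \<longlongrightarrow> L) F"
  proof (rule tendsto_fpsI)
    fix m
    from * have "eventually (\<lambda>n. agree m (f n) L) F" by blast
    then show "eventually (\<lambda>n. f n $ m = L $ m) F"
      by eventually_elim (auto simp: agree_def)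
  qed
qed

lemma tendsto_fps_mult:
  fixes a b :: "'a::comm_ring_1 fps"
  assumes "(f \<longlongrightarrow> a) F" "(g \<longlongrightarrow> b) F"
  shows "((\<lambda>n. f n * g n) \<longlongrightarrow> a * b) F"
  unfolding tendsto_fps_iff_agree
proof
  fix m
  from assms have "eventually (\<lambda>n. agree m (f n) a) F" "eventually (\<lambda>n. agree m (g n) b) F"
    by (simp_all add: tendsto_fps_iff_agree)
  then show "eventually (\<lambda>n. agree m (f n * g n) (a * b)) F"
    by eventually_elim (rule agree_mult)
qed

lemma tendsto_fps_prod:
  fixes a :: "'i \<Rightarrow> 'a::comm_ring_1 fps"
  assumes "\<And>i. i \<in> I \<Longrightarrow> (f i \<longlongrightarrow> a i) F"
  shows "((\<lambda>n. \<Prod>i\<in>I. f i n) \<longlongrightarrow> (\<Prod>i\<in>I. a i)) F"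
  using assms by (induction I rule: infinite_finite_induct) (auto intro!: tendsto_fps_mult)

section \<open>q-Pochhammer products with first exponent \<open>s\<close> and step
  \<open>d\<close>\<close>

definition fprod :: "'a::comm_ring_1 \<Rightarrow> nat \<Rightarrow> nat \<Rightarrow> nat \<Rightarrow> 'a fps" where
  "fprod c s d n = (\<Prod>j<n. 1 - fps_const c * fps_X ^ (s + d * j))"

text \<open>The diagonal coefficients below are those of the \<open>X\<close>-adic limit of \<open>fprod c s d\<close> only if
  \<open>d > 0\<close>.\<close>

definition iprod :: "'a::comm_ring_1 \<Rightarrow> nat \<Rightarrow> nat \<Rightarrow> 'a fps" where
  "iprod c s d = Abs_fps (\<lambda>m. fprod c s d (Suc m) $ m)"

lemma agree_one_minus: "m < k \<Longrightarrow> agree m (1 - fps_const c * fps_X ^ k) 1"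
  by (auto simp: agree_def)

text \<open>For \<open>d > 0\<close> the factor with index \<open>k\<close> is 1 up to degree
  \<open>k - 1\<close>, so the factors from \<open>n > m\<close> on do not touch the degrees up to
  \<open>m\<close>.\<close>

lemma agree_fprod:
  assumes "d > 0" "m < n" "n \<le> n'"
  shows "agree m (fprod c s d n') (fprod c s d n)"
  using assms(3)
proof (induction n' rule: dec_induct)
  case (step k)
  have "m < s + d * k"
  proof -
    have "m < k" using step assms by simp
    also have "k \<le> s + d * k" using assms(1) by (cases d) auto
    finally show ?thesis .
  qed
  then have "agree m (fprod c s d k * (1 - fps_const c * fps_X ^ (s + d * k))) (fprod c s d n * 1)"
    by (intro agree_mult step.IH agree_one_minus)
  then show ?case by (simp add: fprod_def)
qed simp

lemma agree_iprod:
  assumes "d > 0" "m < n"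
  shows "agree m (fprod c s d n) (iprod c s d)"
  unfolding agree_def iprod_def
proof safe
  fix i assume "i \<le> m"
  then have "agree i (fprod c s d n) (fprod c s d (Suc i))"
    by (intro agree_fprod) (use assms in auto)
  then show "fprod c s d n $ i = Abs_fps (\<lambda>m. fprod c s d (Suc m) $ m) $ i"
    by (simp add: agree_def)
qed

lemma fprod_tendsto:
  assumes "d > 0"
  shows "fprod c s d \<longlonglongrightarrow> iprod c s d"
  unfolding tendsto_fps_iff_agree
proof
  fix m
  have "\<forall>n\<ge>Suc m. agree m (fprod c s d n) (iprod c s d)"
    using agree_iprod[OF assms] Suc_le_lessD by blast
  then show "eventually (\<lambda>n. agree m (fprod c s d n) (iprod c s d)) sequentially"
    unfolding eventually_sequentially by blast
qed

lemma fprod_nth_0: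
  assumes "s > 0"
  shows "fprod c s d n $ 0 = 1"
  using assms by (induction n) (auto simp: fprod_def)

lemma iprod_nth_0:
  assumes "s > 0"
  shows "iprod c s d $ 0 = 1"
  using fprod_nth_0[OF assms, of c d "Suc 0"] by (simp add: iprod_def)

lemma iprod_nonzero: "s > 0 \<Longrightarrow> iprod c s d \<noteq> 0"
  using iprod_nth_0[of s c d] by auto

lemma qpoch_inf_eq_iprod: "qpoch_inf (fps_X * fps_const c) = iprod c 1 1"
proof -
  have "(\<lambda>n. \<Prod>i\<le>n. 1 - fps_X * fps_const c * fps_X ^ i) = (\<lambda>n. fprod c 1 1 (Suc n))"
    by (simp add: fprod_def fun_eq_iff lessThan_Suc_atMost mult_ac)
  moreover have "(\<lambda>n. fprod c 1 1 (Suc n)) \<longlonglongrightarrow> iprod c 1 1"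
    using fprod_tendsto[of 1 c 1] by (rule LIMSEQ_Suc[rotated]) simp
  \<comment> \<open>A convergent infinite product must have a nonzero limit; here the constant
    coefficient of the limit is 1.\<close>
  ultimately have "raw_has_prod (\<lambda>i. 1 - fps_X * fps_const c * fps_X ^ i) 0 (iprod c 1 1)"
    using iprod_nonzero[of 1 c 1] by (simp add: raw_has_prod_def)
  then have "(\<lambda>i. 1 - fps_X * fps_const c * fps_X ^ i) has_prod iprod c 1 1"
    by (simp add: has_prod_def)
  then show ?thesis
    unfolding qpoch_inf_def by (rule has_prod_unique[symmetric])
qed

section \<open>Weighted generating functions\<close>

definition gf :: "'i set \<Rightarrow> ('i \<Rightarrow> nat) \<Rightarrow> ('i \<Rightarrow> 'a::comm_ring_1) \<Rightarrow> 'a fps" where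
  "gf A w c = Abs_fps (\<lambda>m. \<Sum>a\<in>{a\<in>A. w a = m}. c a)"

text \<open>Finite fibres keep the coefficient sums of \<open>gf\<close> away from the default value
  0 of a sum over an infinite set.\<close>

definition finfib :: "'i set \<Rightarrow> ('i \<Rightarrow> nat) \<Rightarrow> bool" where
  "finfib A w \<longleftrightarrow> (\<forall>m. finite {a\<in>A. w a = m})"

lemma finfib_le:
  assumes "finfib A w"
  shows "finite {a\<in>A. w a \<le> m}"
proof -
  have "{a\<in>A. w a \<le> m} = (\<Union>i\<le>m. {a\<in>A. w a = i})" by auto
  then show ?thesis using assms by (auto simp: finfib_def)
qed

text \<open>This is the passage from the coefficientwise \<open>gf\<close>, used in all
  computations, to the topological sum in which the final identity is stated. Only one fibre
  contributes to each coefficient.\<close>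

lemma gf_has_sum:
  assumes "finfib A w"
  shows "((\<lambda>a. fps_const (c a) * fps_X ^ w a) has_sum gf A w c) A"
proof (rule has_sum_fpsI)
  fix n
  have sub: "{x\<in>A. (fps_const (c x) * fps_X ^ w x) $ n \<noteq> 0} \<subseteq> {a\<in>A. w a = n}"
    by (auto split: if_splits)
  moreover have fin: "finite {a\<in>A. w a = n}" using assms by (simp add: finfib_def)
  ultimately show "finite {x\<in>A. (fps_const (c x) * fps_X ^ w x) $ n \<noteq> 0}"
    by (rule finite_subset)
  have "(\<Sum>a\<in>{a\<in>A. w a = n}. c a) = (\<Sum>a\<in>{a\<in>A. w a = n}. (fps_const (c a) * fps_X ^ w a) $ n)"
    by (intro sum.cong) auto
  also have "\<dots> = (\<Sum>x\<in>{x\<in>A. (fps_const (c x) * fps_X ^ w x) $ n \<noteq> 0}. (fps_const (c x) * fps_X ^ w x) $ n)"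
    by (rule sum.mono_neutral_right[OF fin sub]) auto
  finally show "gf A w c $ n =
      (\<Sum>x\<in>{x\<in>A. (fps_const (c x) * fps_X ^ w x) $ n \<noteq> 0}. (fps_const (c x) * fps_X ^ w x) $ n)"
    by (simp add: gf_def)
qed

lemma gf_cong:
  assumes "\<And>a. a \<in> A \<Longrightarrow> w a = v a" "\<And>a. a \<in> A \<Longrightarrow> c a = d a"
  shows "gf A w c = gf A v d"
  unfolding gf_def using assms by (intro arg_cong[of _ _ Abs_fps] ext sum.cong) auto

lemma gf_reindex:
  assumes "bij_betw f A B"
  shows "gf B w c = gf A (\<lambda>a. w (f a)) (\<lambda>a. c (f a))"
proof -
  have "bij_betw f {a\<in>A. w (f a) = m} {b\<in>B. w b = m}" for m
    using assms by (auto simp: bij_betw_def inj_on_def)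
  then have "(\<Sum>a\<in>{b\<in>B. w b = m}. c a) = (\<Sum>a\<in>{a\<in>A. w (f a) = m}. c (f a))" for m
    by (rule sum.reindex_bij_betw[symmetric])
  then show ?thesis by (simp add: gf_def)
qed

lemma finfib_reindex:
  assumes "bij_betw f A B"
  shows "finfib B w \<longleftrightarrow> finfib A (\<lambda>a. w (f a))"
proof -
  have "bij_betw f {a\<in>A. w (f a) = m} {b\<in>B. w b = m}" for m
    using assms by (auto simp: bij_betw_def inj_on_def)
  then have "finite {a\<in>A. w (f a) = m} \<longleftrightarrow> finite {b\<in>B. w b = m}" for m
    by (rule bij_betw_finite)
  then show ?thesis by (simp add: finfib_def)
qed

lemma gf_cmult: "gf A w (\<lambda>a. k * c a) = fps_const k * gf A w c"
  by (simp add: gf_def fps_eq_iff sum_distrib_left)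

lemma gf_sum: "gf A w (\<lambda>a. \<Sum>p\<in>S. c p a) = (\<Sum>p\<in>S. gf A w (c p))"
  unfolding gf_def fps_eq_iff by (auto simp: fps_sum_nth intro: sum.swap)

lemma gf_mult:
  assumes "finfib A w" "finfib B v"
  shows "gf A w c * gf B v d = gf (A \<times> B) (\<lambda>(a, b). w a + v b) (\<lambda>(a, b). c a * d b)"
proof (rule fps_ext)
  fix m
  have fA: "finite {a\<in>A. w a = i}" and fB: "finite {b\<in>B. v b = i}" for i
    using assms by (auto simp: finfib_def)
  have "(gf A w c * gf B v d) $ m =
      (\<Sum>i\<le>m. \<Sum>p\<in>{a\<in>A. w a = i} \<times> {b\<in>B. v b = m - i}. case p of (a, b) \<Rightarrow> c a * d b)"
    by (simp add: fps_mult_nth gf_def sum_product sum.cartesian_product atLeast0AtMost)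
  also have "\<dots> = (\<Sum>p\<in>(\<Union>i\<le>m. {a\<in>A. w a = i} \<times> {b\<in>B. v b = m - i}). case p of (a, b) \<Rightarrow> c a * d b)"
    by (rule sum.UNION_disjoint[symmetric]) (use fA fB in auto)
  also have "(\<Union>i\<le>m. {a\<in>A. w a = i} \<times> {b\<in>B. v b = m - i}) =
      {p\<in>A \<times> B. (case p of (a, b) \<Rightarrow> w a + v b) = m}"
    by auto
  finally show "(gf A w c * gf B v d) $ m = gf (A \<times> B) (\<lambda>(a, b). w a + v b) (\<lambda>(a, b). c a * d b) $ m"
    by (simp add: gf_def)
qed

lemma finfib_Times:
  assumes "finfib A w" "finfib B v"
  shows "finfib (A \<times> B) (\<lambda>(a, b). w a + v b)"
  unfolding finfib_def
proof
  fix m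
  have "{p\<in>A \<times> B. (case p of (a, b) \<Rightarrow> w a + v b) = m} \<subseteq> {a\<in>A. w a \<le> m} \<times> {b\<in>B. v b \<le> m}"
    by auto
  then show "finite {p\<in>A \<times> B. (case p of (a, b) \<Rightarrow> w a + v b) = m}"
    using finfib_le[OF assms(1)] finfib_le[OF assms(2)] by (meson finite_SigmaI finite_subset)
qed

lemma bij_betw_PiE_insert:
  assumes "i \<notin> I"
  shows "bij_betw (\<lambda>(y, g). g(i := y)) (A i \<times> PiE I A) (PiE (insert i I) A)"
  unfolding bij_betw_def PiE_insert_eq
proof
  show "inj_on (\<lambda>(y, g). g(i := y)) (A i \<times> PiE I A)"
    by (rule inj_combinator[OF assms])
qed auto

text \<open>The distributive law for infinite sums: a product of series is a series over choice
  functions. It expands each term of a determinant into a sum over exponent tuples.\<close>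

lemma gf_prod_PiE:
  assumes "finite I" "\<And>i. i \<in> I \<Longrightarrow> finfib (A i) (w i)"
  shows "(\<Prod>i\<in>I. gf (A i) (w i) (c i)) =
           gf (PiE I A) (\<lambda>e. \<Sum>i\<in>I. w i (e i)) (\<lambda>e. \<Prod>i\<in>I. c i (e i))"
    and "finfib (PiE I A) (\<lambda>e. \<Sum>i\<in>I. w i (e i))"
  using assms
proof (induction I rule: finite_induct)
  case empty
  {
    case 1
    show ?case by (simp add: gf_def fps_eq_iff)
  next
    case 2
    show ?case by (simp add: finfib_def)
  }
next
  case (insert i I)
  note bij = bij_betw_PiE_insert[OF insert.hyps(2), of A]
  have upd: "(\<Sum>j\<in>I. w j ((g(i := y)) j)) = (\<Sum>j\<in>I. w j (g j))"
            "(\<Prod>j\<in>I. c j ((g(i := y)) j)) = (\<Prod>j\<in>I. c j (g j))" for g y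
    using insert.hyps(2) by (auto intro!: sum.cong prod.cong)
  {
    case 1
    have "(\<Prod>i\<in>insert i I. gf (A i) (w i) (c i)) =
        gf (A i) (w i) (c i) * gf (PiE I A) (\<lambda>e. \<Sum>i\<in>I. w i (e i)) (\<lambda>e. \<Prod>i\<in>I. c i (e i))"
      using insert 1 by simp
    also have "\<dots> = gf (A i \<times> PiE I A) (\<lambda>(a, e). w i a + (\<Sum>i\<in>I. w i (e i)))
                        (\<lambda>(a, e). c i a * (\<Prod>i\<in>I. c i (e i)))"
      by (rule gf_mult) (use insert 1 in auto)
    also have "\<dots> = gf (PiE (insert i I) A) (\<lambda>e. \<Sum>i\<in>insert i I. w i (e i)) (\<lambda>e. \<Prod>i\<in>insert i I. c i (e i))"
      unfolding gf_reindex[OF bij] using insert.hyps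
      by (intro gf_cong) (simp_all add: case_prod_beta upd sum.insert prod.insert del: fun_upd_apply, simp_all)
    finally show ?case .
  next
    case 2
    have "finfib (A i \<times> PiE I A) (\<lambda>(a, e). w i a + (\<Sum>i\<in>I. w i (e i)))"
      by (rule finfib_Times) (use insert 2 in auto)
    also have "(\<lambda>(a, e). w i a + (\<Sum>i\<in>I. w i (e i))) =
        (\<lambda>p. (\<Sum>j\<in>insert i I. w j ((case p of (y, g) \<Rightarrow> g(i := y)) j)))"
      using insert.hyps by (intro ext) (simp add: case_prod_beta upd sum.insert del: fun_upd_apply, simp)
    finally show ?case
      unfolding finfib_reindex[OF bij] .
  }
qed

section \<open>The Jacobi triple product\<close>

text \<open>Gaussian binomial coefficients through the q-Pascal rule. No division occurs, so
  \<open>q\<close> may later be a root of unity as well as a power of \<open>X\<close>.\<close>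

fun qbin :: "'a::comm_ring_1 \<Rightarrow> nat \<Rightarrow> nat \<Rightarrow> 'a" where
  "qbin q n 0 = 1"
| "qbin q 0 (Suc k) = 0"
| "qbin q (Suc n) (Suc k) = qbin q n k + q ^ Suc k * qbin q n (Suc k)"

lemma qbin_eq_0: "n < k \<Longrightarrow> qbin q n k = 0"
  by (induction q n k rule: qbin.induct) auto

definition qfact :: "'a::comm_ring_1 \<Rightarrow> nat \<Rightarrow> 'a" where
  "qfact q n = (\<Prod>k<n. 1 - q ^ Suc k)"

lemma qfact_Suc: "qfact q (Suc n) = qfact q n * (1 - q ^ Suc n)"
  by (simp add: qfact_def)

lemma qfact_0 [simp]: "qfact q 0 = 1"
  by (simp add: qfact_def)

lemma qbin_self: "qbin q n n = 1"
  by (induction n) (auto simp: qbin_eq_0)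

lemma qbin_qfact:
  "qbin q (m + k) k * qfact q k * qfact q m = qfact q (m + k)"
proof (induction "m + k" arbitrary: m k)
  case 0
  then show ?case by simp
next
  case (Suc n)
  show ?case
  proof (cases k)
    case 0
    then show ?thesis by simp
  next
    case k: (Suc k')
    show ?thesis
    proof (cases m)
      case 0
      then show ?thesis by (simp add: qbin_self)
    next
      case m: (Suc m')
      have n: "n = m + k'" "n = m' + k" using Suc k m by auto
      have 1: "qbin q n k' * qfact q k' * qfact q m = qfact q n"
        using Suc(1)[OF n(1)] n(1) by simp
      have 2: "qbin q n k * qfact q k * qfact q m' = qfact q n"
        using Suc(1)[OF n(2)] n(2) by simp
      have "m + k = Suc n" using Suc by simp
      then have "qbin q (m + k) k * qfact q k * qfact q m =
          (qbin q n k' + q ^ k * qbin q n k) * qfact q k * qfact q m"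
        by (simp add: k)
      also have "\<dots> = (qbin q n k' * qfact q k' * qfact q m) * (1 - q ^ k)
                     + q ^ k * (qbin q n k * qfact q k * qfact q m') * (1 - q ^ m)"
        by (simp add: k m qfact_Suc algebra_simps)
      also have "\<dots> = qfact q n * (1 - q ^ (m + k))"
        unfolding 1 2 by (simp add: algebra_simps power_add)
      finally show ?thesis
        using \<open>m + k = Suc n\<close> by (simp add: qfact_Suc)
    qed
  qed
qed

text \<open>The induction splits off the first factor and replaces \<open>z\<close> by
  \<open>z * q\<close>. The homogenising \<open>a\<close> will be a power of \<open>q\<close> in the
  triple product, which avoids negative exponents there.\<close>

lemma qbinomial_theorem:
  "(\<Prod>k<n. a + z * q ^ k) = (\<Sum>k\<le>n. q ^ (k choose 2) * qbin q n k * z ^ k * a ^ (n - k))"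
proof (induction n arbitrary: z)
  case (Suc n)
  define f where "f k = q ^ (k choose 2) * qbin q n k * (z * q) ^ k * a ^ (Suc n - k)" for k
  define f' where "f' k = q ^ (k choose 2) * qbin q n k * (z * q) ^ k * a ^ (n - k)" for k
  have "(\<Prod>k<Suc n. a + z * q ^ k) = (a + z) * (\<Prod>k<n. a + (z * q) * q ^ k)"
    by (subst prod.lessThan_Suc_shift) (simp add: mult_ac)
  also have "(\<Prod>k<n. a + (z * q) * q ^ k) = (\<Sum>k\<le>n. f' k)"
    by (simp only: Suc.IH f'_def)
  also have "(a + z) * (\<Sum>k\<le>n. f' k) = (\<Sum>k\<le>n. a * f' k) + (\<Sum>k\<le>n. z * f' k)"
    by (simp only: distrib_right sum_distrib_left sum.distrib)
  also have "(\<Sum>k\<le>n. a * f' k) = (\<Sum>k\<le>n. f k)"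
    by (intro sum.cong refl) (simp add: f_def f'_def Suc_diff_le mult_ac)
  also have "(\<Sum>k\<le>n. f k) = (\<Sum>k\<le>Suc n. f k)"
    by (simp add: f_def qbin_eq_0)
  also have "\<dots> = a ^ Suc n + (\<Sum>k\<le>n. f (Suc k))"
    by (subst sum.atMost_Suc_shift) (simp add: numeral_2_eq_2 f_def)
  also have "a ^ Suc n + (\<Sum>k\<le>n. f (Suc k)) + (\<Sum>k\<le>n. z * f' k) =
      a ^ Suc n + (\<Sum>k\<le>n. f (Suc k) + z * f' k)"
    by (simp add: sum.distrib)
  also have "(\<Sum>k\<le>n. f (Suc k) + z * f' k) =
      (\<Sum>k\<le>n. q ^ (Suc k choose 2) * qbin q (Suc n) (Suc k) * z ^ Suc k * a ^ (Suc n - Suc k))"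
    by (intro sum.cong refl)
       (simp add: f_def f'_def numeral_2_eq_2 power_add power_mult_distrib algebra_simps)
  also have "a ^ Suc n + \<dots> = (\<Sum>k\<le>Suc n. q ^ (k choose 2) * qbin q (Suc n) k * z ^ k * a ^ (Suc n - k))"
    by (subst sum.atMost_Suc_shift) (simp add: numeral_2_eq_2)
  finally show ?case .
qed (simp add: numeral_2_eq_2)

definition tri :: "int \<Rightarrow> int" where
  "tri m = m * (m - 1) div 2"

lemma two_tri: "2 * tri m = m * (m - 1)"
proof -
  have "even (m * (m - 1))" by simp
  then show ?thesis unfolding tri_def by (rule dvd_mult_div_cancel)
qed

lemma two_choose_two: "2 * (int (k choose 2)) = int k * (int k - 1)"
proof (induction k)
  case (Suc k)
  have "Suc k choose 2 = k + (k choose 2)" by (simp add: numeral_2_eq_2)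
  then show ?case using Suc by (simp add: algebra_simps)
qed (simp add: numeral_2_eq_2)

lemma prod_power_lessThan: "(\<Prod>k<n. q ^ k) = (q :: 'a::comm_monoid_mult) ^ (n choose 2)"
  by (induction n) (simp_all add: numeral_2_eq_2 power_add mult_ac)

text \<open>Exponent of \<open>X\<close> in the \<open>m\<close>-th term of the triple product with
  base \<open>X^N\<close> and argument \<open>c * X^r\<close>.\<close>

definition jexp :: "nat \<Rightarrow> nat \<Rightarrow> int \<Rightarrow> int" where
  "jexp N r m = int N * tri m + int r * m"

lemma two_jexp: "2 * jexp N r m = int N * (m * (m - 1)) + 2 * int r * m"
proof -
  have "2 * jexp N r m = int N * (2 * tri m) + 2 * int r * m" by (simp add: jexp_def)
  then show ?thesis by (simp only: two_tri)
qed

text \<open>For negative \<open>m = - j\<close> the bound \<open>r \<le> N\<close> gives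
  \<open>2 * jexp N r m \<ge> N * j * (j - 1)\<close>, so both signs of \<open>m\<close> lead to the
  same quadratic lower bound. The resulting linear bound on \<open>m\<close> makes the fibres
  finite.\<close>

lemma jexp_ge:
  assumes "N > 0" "r \<le> N"
  shows "\<bar>m\<bar> \<le> jexp N r m + 1" "jexp N r m \<ge> 0"
proof -
  have *: "(\<bar>m\<bar> - 1) * \<bar>m\<bar> \<le> 2 * jexp N r m"
  proof (cases "m \<ge> 0")
    case True
    have "(m - 1) * m \<ge> 0" using True by (cases "m = 0") auto
    then have "1 * ((m - 1) * m) \<le> int N * ((m - 1) * m)"
      using assms by (intro mult_right_mono) auto
    moreover have "2 * int r * m \<ge> 0" using True by simp
    ultimately have "(m - 1) * m \<le> int N * ((m - 1) * m) + 2 * int r * m" by linarith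
    then show ?thesis using True unfolding two_jexp by (simp add: algebra_simps)
  next
    case False
    define j where "j = - m"
    have j: "j > 0" "m = - j" using False by (auto simp: j_def)
    have "int r * j \<le> int N * j" using assms j by (intro mult_right_mono) auto
    moreover have "1 * ((j - 1) * j) \<le> int N * ((j - 1) * j)"
      using assms j by (intro mult_right_mono) auto
    ultimately have "(j - 1) * j \<le> int N * (j * (j + 1)) - 2 * (int r * j)"
      by (simp add: algebra_simps)
    then show ?thesis using j unfolding two_jexp by (simp add: algebra_simps)
  qed
  have "0 \<le> (\<bar>m\<bar> - 1) * \<bar>m\<bar>" by (cases "m = 0") auto
  with * show "jexp N r m \<ge> 0" by simp
  \<comment> \<open>A product of two consecutive integers is never negative; this turns the
    quadratic bound into a linear one.\<close>
  have "0 \<le> (\<bar>m\<bar> - 1) * (\<bar>m\<bar> - 2)"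
    by (cases "\<bar>m\<bar> \<ge> 2") (auto intro: mult_nonpos_nonpos simp: zero_le_mult_iff)
  then have "2 * (\<bar>m\<bar> - 1) \<le> (\<bar>m\<bar> - 1) * \<bar>m\<bar>"
    by (simp add: algebra_simps)
  with * show "\<bar>m\<bar> \<le> jexp N r m + 1" by simp
qed

lemma finfib_jexp:
  assumes "N > 0" "r \<le> N"
  shows "finfib UNIV (\<lambda>m. nat (jexp N r m))"
  unfolding finfib_def
proof
  fix i
  have "{a \<in> UNIV. nat (jexp N r a) = i} \<subseteq> {- (int i + 1)..int i + 1}"
  proof
    fix a assume "a \<in> {a \<in> UNIV. nat (jexp N r a) = i}"
    then have "jexp N r a = int i" using jexp_ge(2)[OF assms, of a] by auto
    then show "a \<in> {- (int i + 1)..int i + 1}" using jexp_ge(1)[OF assms, of a] by auto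
  qed
  then show "finite {a \<in> UNIV. nat (jexp N r a) = i}" by (rule finite_subset) simp
qed

lemma eq_add_natI: "2 * int a = 2 * (int b + j) \<Longrightarrow> 0 \<le> j \<Longrightarrow> a = b + nat j"
  by presburger

lemma prod_lessThan_add:
  fixes m n :: nat
  shows "(\<Prod>k<m + n. f k) = (\<Prod>k<m. f k) * (\<Prod>k<n. f (m + k) :: 'a::comm_monoid_mult)"
  by (induction n) (simp_all add: mult_ac)

text \<open>The q-binomial theorem with \<open>2n\<close> factors and \<open>a = q^n\<close>. In the
  upper half of the factors \<open>q^n\<close> is pulled out, which leaves the product in
  \<open>c\<close>; in the lower half, read backwards, the other summand is pulled out, which leaves
  the product in \<open>inverse c\<close>. The monomial on the left collects what was pulled
  out.\<close>

lemma jacobi_finite_scaled: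
  fixes c :: "'a::field"
  assumes "c \<noteq> 0" "r \<le> N"
  defines "q \<equiv> (fps_X :: 'a fps) ^ N" and "b \<equiv> fps_const c * fps_X ^ r"
  shows "q ^ (n * n + (n choose 2)) * b ^ n * (fprod (- c) r N n * fprod (- inverse c) (N - r) N n) =
         (\<Sum>k\<le>2 * n. q ^ ((k choose 2) + n * (2 * n - k)) * qbin q (2 * n) k * b ^ k)"
proof -
  have "(\<Prod>k<n. q ^ n + b * q ^ (n + k)) = (\<Prod>k<n. q ^ n * (1 - fps_const (- c) * fps_X ^ (r + N * k)))"
    by (intro prod.cong refl)
       (simp add: q_def b_def power_add algebra_simps flip: fps_const_neg power_mult)
  also have "\<dots> = q ^ (n * n) * fprod (- c) r N n"
    by (simp add: fprod_def prod.distrib power_mult)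
  finally have 1: "(\<Prod>k<n. q ^ n + b * q ^ (n + k)) = q ^ (n * n) * fprod (- c) r N n" .
  have "(\<Prod>k<n. q ^ n + b * q ^ k) = (\<Prod>k<n. q ^ n + b * q ^ (n - Suc k))"
    by (rule prod.nat_diff_reindex[symmetric])
  also have "\<dots> = (\<Prod>k<n. b * q ^ (n - Suc k) * (1 - fps_const (- inverse c) * fps_X ^ (N - r + N * k)))"
  proof (intro prod.cong refl)
    fix k assume "k \<in> {..<n}"
    then have k: "n = (n - Suc k) + Suc k" by simp
    have "q ^ n = q ^ (n - Suc k) * q ^ Suc k"
      by (subst k) (simp only: power_add)
    also have "q ^ Suc k = b * (fps_const (inverse c) * fps_X ^ (N - r + N * k))"
    proof -
      have "q ^ Suc k = fps_X ^ (r + (N - r + N * k))"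
        using assms(2) by (simp add: q_def power_add power_mult flip: power_mult)
      also have "\<dots> = (fps_const c * fps_const (inverse c)) * fps_X ^ (r + (N - r + N * k))"
        using assms(1) by simp
      finally show ?thesis unfolding b_def power_add by (simp only: mult_ac)
    qed
    finally show "q ^ n + b * q ^ (n - Suc k) =
        b * q ^ (n - Suc k) * (1 - fps_const (- inverse c) * fps_X ^ (N - r + N * k))"
      by (simp add: algebra_simps flip: fps_const_neg)
  qed
  also have "\<dots> = b ^ n * (\<Prod>k<n. q ^ (n - Suc k)) * fprod (- inverse c) (N - r) N n"
    by (simp add: prod.distrib fprod_def)
  also have "(\<Prod>k<n. q ^ (n - Suc k)) = (\<Prod>k<n. q ^ k)"
    by (rule prod.nat_diff_reindex)
  finally have 2: "(\<Prod>k<n. q ^ n + b * q ^ k) = b ^ n * q ^ (n choose 2) * fprod (- inverse c) (N - r) N n"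
    by (simp only: prod_power_lessThan)
  have "(\<Prod>k<n + n. q ^ n + b * q ^ k) =
      (\<Prod>k<n. q ^ n + b * q ^ k) * (\<Prod>k<n. q ^ n + b * q ^ (n + k))"
    by (rule prod_lessThan_add)
  then have "(\<Sum>k\<le>2 * n. q ^ (k choose 2) * qbin q (2 * n) k * b ^ k * (q ^ n) ^ (2 * n - k)) =
      q ^ (n * n) * fprod (- c) r N n * (b ^ n * q ^ (n choose 2) * fprod (- inverse c) (N - r) N n)"
    unfolding mult_2 1 2 qbinomial_theorem[symmetric] by (simp only: mult_ac)
  then show ?thesis
    by (simp add: power_add power_mult mult_ac)
qed

lemma jacobi_finite:
  fixes c :: "'a::field"
  assumes "c \<noteq> 0" "r \<le> N" "N > 0"
  shows "fprod (- c) r N n * fprod (- inverse c) (N - r) N n =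
         (\<Sum>m = - int n..int n. fps_const (c powi m) * fps_X ^ nat (jexp N r m) *
            qbin (fps_X ^ N) (2 * n) (nat (int n + m)))"
proof -
  define q where "q = (fps_X :: 'a fps) ^ N"
  define b where "b = fps_const c * (fps_X :: 'a fps) ^ r"
  define K where "K = q ^ (n * n + (n choose 2)) * b ^ n"
  have "K \<noteq> 0" using assms(1) by (simp add: K_def q_def b_def)
  have "K * (\<Sum>m = - int n..int n. fps_const (c powi m) * fps_X ^ nat (jexp N r m) *
            qbin q (2 * n) (nat (int n + m))) =
        (\<Sum>m = - int n..int n. K * (fps_const (c powi m) * fps_X ^ nat (jexp N r m) *
            qbin q (2 * n) (nat (int n + m))))"
    by (simp add: sum_distrib_left)
  also have "\<dots> = (\<Sum>k\<le>2 * n. q ^ ((k choose 2) + n * (2 * n - k)) * qbin q (2 * n) k * b ^ k)"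
  proof (rule sum.reindex_bij_witness[of _ "\<lambda>k. int k - int n" "\<lambda>m. nat (int n + m)"])
    fix m assume "m \<in> {- int n..int n}"
    then have m: "- int n \<le> m" "m \<le> int n" by auto
    define k where "k = nat (int n + m)"
    have k: "int k = int n + m" "k \<le> 2 * n" using m by (auto simp: k_def)
    \<comment> \<open>The exponents are compared after doubling, which removes the divisions by 2 in
      the binomial coefficients and triangular numbers.\<close>
    have "2 * int (N * ((k choose 2) + n * (2 * n - k)) + r * k) =
        2 * (int (N * (n * n + (n choose 2)) + r * n) + jexp N r m)"
    proof -
      have "2 * int (N * ((k choose 2) + n * (2 * n - k)) + r * k) =
          int N * (2 * int (k choose 2) + 2 * (int n * (2 * int n - int k))) + 2 * int r * int k"
        using k(2) by (simp only: of_nat_diff of_nat_add of_nat_mult) (simp add: algebra_simps)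
      also have "\<dots> = int N * (int k * (int k - 1) + 2 * (int n * (2 * int n - int k))) + 2 * int r * int k"
        by (simp only: two_choose_two)
      also have "\<dots> = int N * (2 * (int n * int n) + int n * (int n - 1)) + 2 * int r * n
                     + (int N * (m * (m - 1)) + 2 * int r * m)"
        unfolding k(1) by (simp add: algebra_simps)
      also have "\<dots> = int N * (2 * (int n * int n) + 2 * int (n choose 2)) + 2 * int r * n + 2 * jexp N r m"
        by (simp only: two_choose_two two_jexp)
      finally show ?thesis by (simp add: algebra_simps)
    qed
    then have e: "N * ((k choose 2) + n * (2 * n - k)) + r * k =
        N * (n * n + (n choose 2)) + r * n + nat (jexp N r m)"
      using jexp_ge(2)[OF assms(3,2), of m] by (intro eq_add_natI)
    have c: "c ^ k = c ^ n * c powi m"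
    proof -
      have "c ^ k = c powi (int k)" by simp
      also have "\<dots> = c powi (int n) * c powi m"
        unfolding k(1) using assms(1) by (simp add: power_int_add)
      finally show ?thesis by simp
    qed
    have "q ^ ((k choose 2) + n * (2 * n - k)) * b ^ k =
        fps_const (c ^ k) * fps_X ^ (N * ((k choose 2) + n * (2 * n - k)) + r * k)"
      by (simp add: q_def b_def power_mult_distrib power_add power_mult fps_const_power)
    also have "\<dots> = K * (fps_const (c powi m) * fps_X ^ nat (jexp N r m))"
      unfolding e c K_def q_def b_def
      by (simp add: power_mult_distrib power_add power_mult flip: fps_const_power fps_const_mult)
    finally show "q ^ ((nat (int n + m) choose 2) + n * (2 * n - nat (int n + m))) *
        qbin q (2 * n) (nat (int n + m)) * b ^ nat (int n + m) =
        K * (fps_const (c powi m) * fps_X ^ nat (jexp N r m) * qbin q (2 * n) (nat (int n + m)))"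
      unfolding k_def by (simp add: mult_ac)
  qed auto
  also have "\<dots> = K * (fprod (- c) r N n * fprod (- inverse c) (N - r) N n)"
    unfolding K_def q_def b_def by (rule jacobi_finite_scaled[symmetric]) (use assms in auto)
  finally show ?thesis using \<open>K \<noteq> 0\<close> by (simp add: q_def)
qed

lemma qfact_eq_fprod: "qfact (fps_X ^ N) n = fprod (1 :: 'a::field) N N n"
  by (simp add: qfact_def fprod_def power_add power_mult)

text \<open>The coefficient is \<open>Q (k + l) / (Q k * Q l)\<close> for
  \<open>Q = fprod 1 N N\<close>, and the three products agree up to degree \<open>m\<close>; so it
  is congruent to the inverse of any one of them.\<close>

lemma agree_qbin:
  fixes Q :: "'a::field fps"
  assumes "N > 0" "m < k" "m < l"
  shows "agree m (fprod 1 N N (k + l) * qbin (fps_X ^ N) (l + k) k) (1 :: 'a fps)"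
proof -
  let ?Q = "\<lambda>n. fprod (1 :: 'a) N N n"
  have Q: "agree m (?Q n) (?Q k)" if "m < n" for n
    using agree_fprod[OF assms(1), of m n "max n k" 1 N] agree_fprod[OF assms(1), of m k "max n k" 1 N] that assms
    by (auto intro: agree_trans agree_sym)
  have "qbin (fps_X ^ N) (l + k) k * ?Q k * ?Q l = ?Q (l + k)"
    using qbin_qfact[of "fps_X ^ N :: 'a fps" l k] by (simp add: qfact_eq_fprod)
  then have *: "?Q k * qbin (fps_X ^ N) (l + k) k * ?Q l = ?Q (l + k)"
    by (simp add: mult_ac)
  have "agree m (?Q k * qbin (fps_X ^ N) (l + k) k * ?Q k) (?Q k * qbin (fps_X ^ N) (l + k) k * ?Q l)"
    by (intro agree_mult agree_refl agree_sym[OF Q] assms)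
  also have "agree m (?Q k * qbin (fps_X ^ N) (l + k) k * ?Q l) (?Q k)"
    unfolding * by (rule Q) (use assms in simp)
  finally have "agree m (?Q k * (?Q k * qbin (fps_X ^ N) (l + k) k)) (?Q k * 1)"
    by (simp add: mult_ac)
  then have 1: "agree m (?Q k * qbin (fps_X ^ N) (l + k) k) 1"
    by (rule agree_cancel[rotated]) (use assms fprod_nth_0[of N "1 :: 'a" N k] in simp)
  have "agree m (?Q (k + l) * qbin (fps_X ^ N) (l + k) k) (?Q k * qbin (fps_X ^ N) (l + k) k)"
    by (intro agree_mult Q agree_refl) (use assms in auto)
  then show ?thesis using 1 by (rule agree_trans)
qed

text \<open>Both sides are limits of the finite identity multiplied by
  \<open>fprod 1 N N (n + n)\<close>, a factor that turns the q-binomial coefficients of the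
  relevant terms into 1.\<close>

theorem jacobi_triple_product:
  fixes c :: "'a::field"
  assumes "c \<noteq> 0" "r \<le> N" "N > 0"
  shows "gf UNIV (\<lambda>m. nat (jexp N r m)) (\<lambda>m. c powi m) =
           iprod 1 N N * (iprod (- c) r N * iprod (- inverse c) (N - r) N)"
proof -
  let ?G = "gf UNIV (\<lambda>m. nat (jexp N r m)) (\<lambda>m. c powi m)"
  have "(\<lambda>n. fprod 1 N N (n + n) * (fprod (- c) r N n * fprod (- inverse c) (N - r) N n)) \<longlonglongrightarrow>
      iprod 1 N N * (iprod (- c) r N * iprod (- inverse c) (N - r) N)"
  proof (intro tendsto_fps_mult fprod_tendsto assms)
    have "filterlim (\<lambda>n::nat. n + n) at_top sequentially"
      by (rule filterlim_at_top_mono[OF filterlim_ident]) auto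
    then show "(\<lambda>n. fprod 1 N N (n + n)) \<longlonglongrightarrow> iprod (1 :: 'a) N N"
      by (rule filterlim_compose[OF fprod_tendsto[OF assms(3)]])
  qed
  moreover have "(\<lambda>n. fprod 1 N N (n + n) * (fprod (- c) r N n * fprod (- inverse c) (N - r) N n)) \<longlonglongrightarrow> ?G"
  proof (rule tendsto_fpsI)
    fix i
    \<comment> \<open>Only terms with \<open>\<bar>m\<bar> \<le> i + 1\<close> reach degree
      \<open>i\<close>. The bound on \<open>n\<close> makes both \<open>n + m\<close> and
      \<open>n - m\<close> larger than \<open>i\<close> for them, as \<open>agree_qbin\<close>
      demands.\<close>
    have "(fprod 1 N N (n + n) * (fprod (- c) r N n * fprod (- inverse c) (N - r) N n)) $ i = ?G $ i"
      if n: "n \<ge> 2 * i + 3" for n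
    proof -
      have fin: "finite {m. nat (jexp N r m) = i}"
        using finfib_jexp[OF assms(3,2)] by (auto simp: finfib_def)
      let ?t = "\<lambda>m. fprod 1 N N (n + n) * (fps_const (c powi m) * fps_X ^ nat (jexp N r m) *
            qbin (fps_X ^ N) (2 * n) (nat (int n + m)))"
      have t: "?t m $ i = (if nat (jexp N r m) = i then c powi m else 0)"
        if m: "m \<in> {- int n..int n}" for m
      proof (cases "nat (jexp N r m) > i")
        case True
        have "?t m = fps_X ^ nat (jexp N r m) * (fprod 1 N N (n + n) * fps_const (c powi m) *
            qbin (fps_X ^ N) (2 * n) (nat (int n + m)))"
          by (simp only: mult_ac)
        then have "?t m $ i = 0" using True by (simp only: fps_X_power_mult_nth if_True)
        then show ?thesis using True by simp
      next
        case False
        then have "\<bar>m\<bar> \<le> int i + 1" using jexp_ge[OF assms(3,2), of m] by linarith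
        define k l where "k = nat (int n + m)" and "l = nat (int n - m)"
        have kl: "l + k = 2 * n" "k + l = n + n" "i < k" "i < l"
          using m n \<open>\<bar>m\<bar> \<le> int i + 1\<close> by (auto simp: k_def l_def)
        have "agree i (fprod 1 N N (n + n) * qbin (fps_X ^ N) (2 * n) k) (1 :: 'a fps)"
          using agree_qbin[OF assms(3) kl(3,4)] unfolding kl .
        then have "agree i (fps_const (c powi m) * fps_X ^ nat (jexp N r m) *
             (fprod 1 N N (n + n) * qbin (fps_X ^ N) (2 * n) k)) (fps_const (c powi m) * fps_X ^ nat (jexp N r m) * 1)"
          by (intro agree_mult agree_refl)
        then have "agree i (?t m) (fps_const (c powi m) * fps_X ^ nat (jexp N r m))"
          by (simp add: k_def mult_ac)
        then show ?thesis by (auto simp: agree_def)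
      qed
      have "{m. nat (jexp N r m) = i} \<subseteq> {- int n..int n}"
      proof
        fix m assume "m \<in> {m. nat (jexp N r m) = i}"
        then show "m \<in> {- int n..int n}"
          using jexp_ge[OF assms(3,2), of m] n by auto
      qed
      then have "(\<Sum>m = - int n..int n. if nat (jexp N r m) = i then c powi m else 0) =
          (\<Sum>m\<in>{m. nat (jexp N r m) = i}. if nat (jexp N r m) = i then c powi m else 0)"
        by (intro sum.mono_neutral_right) auto
      then have "(\<Sum>m = - int n..int n. ?t m) $ i = ?G $ i"
        using t by (simp add: fps_sum_nth gf_def)
      moreover have "fprod 1 N N (n + n) * (fprod (- c) r N n * fprod (- inverse c) (N - r) N n) =
          (\<Sum>m = - int n..int n. ?t m)"
        by (subst jacobi_finite[OF assms]) (simp only: sum_distrib_left)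
      ultimately show ?thesis by simp
    qed
    then show "eventually (\<lambda>n. (fprod 1 N N (n + n) * (fprod (- c) r N n * fprod (- inverse c) (N - r) N n)) $ i = ?G $ i) sequentially"
      unfolding eventually_sequentially by blast
  qed
  ultimately show ?thesis
    by (rule LIMSEQ_unique[symmetric])
qed

section \<open>Theta functions of a given level\<close>

text \<open>Base change of integer power series. An identity between integer series established over
  one field of characteristic zero becomes available over every field along this map.\<close>

definition ofi :: "int fps \<Rightarrow> 'a::comm_ring_1 fps" where
  "ofi c = Abs_fps (\<lambda>n. of_int (c $ n))"

lemma ofi_hom: "comm_ring_hom (ofi :: int fps \<Rightarrow> 'a::comm_ring_1 fps)"
proof
qed (auto simp: ofi_def fps_eq_iff fps_mult_nth fps_one_nth)

lemma ofi_nth [simp]: "ofi c $ n = of_int (c $ n)"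
  by (simp add: ofi_def)

text \<open>A function \<open>\<phi>\<close> stands for the formal double series \<open>\<Sum> \<phi> a k X\<^sup>a x\<^sup>k\<close>.\<close>

definition tadm :: "(int \<Rightarrow> int \<Rightarrow> int) \<Rightarrow> bool" where
  "tadm \<phi> \<longleftrightarrow> (\<exists>C. \<forall>a k. \<phi> a k \<noteq> 0 \<longrightarrow> 0 \<le> a \<and> \<bar>k\<bar> \<le> a + C)"

definition ev :: "(int \<Rightarrow> int \<Rightarrow> int) \<Rightarrow> 'a::field \<Rightarrow> 'a fps" where
  "ev \<phi> x = gf {(a, k). \<phi> a k \<noteq> 0} (\<lambda>(a, k). nat a) (\<lambda>(a, k). of_int (\<phi> a k) * x powi k)"

text \<open>The coefficient array of the product of two double series. The index set is cut down to
  nonzero products, which makes it finite for arrays satisfying \<open>tadm\<close>.\<close>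

definition tconv :: "(int \<Rightarrow> int \<Rightarrow> int) \<Rightarrow> (int \<Rightarrow> int \<Rightarrow> int) \<Rightarrow> int \<Rightarrow> int \<Rightarrow> int" where
  "tconv \<phi> \<psi> a k = (\<Sum>(b, l)\<in>{(b, l). \<phi> b l \<noteq> 0 \<and> \<psi> (a - b) (k - l) \<noteq> 0}. \<phi> b l * \<psi> (a - b) (k - l))"

text \<open>Under \<open>x \<mapsto> X x\<close> such a series picks up the factor \<open>X\<^sup>-\<^sup>h x\<^sup>-\<^sup>2\<^sup>h\<close>.\<close>

definition level :: "int \<Rightarrow> (int \<Rightarrow> int \<Rightarrow> int) \<Rightarrow> bool" where
  "level h \<phi> \<longleftrightarrow> (\<forall>a k. \<phi> (a + k + h) (k + 2 * h) = \<phi> a k) \<and> (\<forall>a k. \<phi> a (- k) = \<phi> a k)"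

lemma tadm_nonneg: "tadm \<phi> \<Longrightarrow> \<phi> a k \<noteq> 0 \<Longrightarrow> 0 \<le> a"
  by (auto simp: tadm_def)

lemma tadm_finfib:
  assumes "tadm \<phi>"
  shows "finfib {(a, k). \<phi> a k \<noteq> 0} (\<lambda>(a, k). nat a)"
  unfolding finfib_def
proof
  fix m
  obtain C where C: "\<And>a k. \<phi> a k \<noteq> 0 \<Longrightarrow> 0 \<le> a \<and> \<bar>k\<bar> \<le> a + C"
    using assms by (auto simp: tadm_def)
  have "{p \<in> {(a, k). \<phi> a k \<noteq> 0}. (case p of (a, k) \<Rightarrow> nat a) = m} \<subseteq> {int m} \<times> {- (int m + C)..int m + C}"
    using C by force
  then show "finite {p \<in> {(a, k). \<phi> a k \<noteq> 0}. (case p of (a, k) \<Rightarrow> nat a) = m}"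
    by (rule finite_subset) simp
qed

lemma ev_nth:
  assumes "tadm \<phi>"
  shows "ev \<phi> x $ m = (\<Sum>k\<in>{k. \<phi> (int m) k \<noteq> 0}. of_int (\<phi> (int m) k) * x powi k)"
proof -
  obtain C where C: "\<And>a k. \<phi> a k \<noteq> 0 \<Longrightarrow> 0 \<le> a \<and> \<bar>k\<bar> \<le> a + C"
    using assms by (auto simp: tadm_def)
  show ?thesis
    unfolding ev_def gf_def fps_nth_Abs_fps
    by (rule sum.reindex_bij_witness[of _ "\<lambda>k. (int m, k)" snd]) (use C in auto)
qed

lemma finite_tadm_row: "tadm \<phi> \<Longrightarrow> finite {k. \<phi> a k \<noteq> 0}"
proof -
  assume "tadm \<phi>"
  then obtain C where "\<And>k. \<phi> a k \<noteq> 0 \<Longrightarrow> \<bar>k\<bar> \<le> a + C"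
    by (auto simp: tadm_def)
  then have "{k. \<phi> a k \<noteq> 0} \<subseteq> {- (a + C)..a + C}" by force
  then show ?thesis by (rule finite_subset) simp
qed

lemma tconv_nonzeroE:
  assumes "tconv \<phi> \<psi> a k \<noteq> 0"
  obtains b l where "\<phi> b l \<noteq> 0" "\<psi> (a - b) (k - l) \<noteq> 0"
proof -
  have "{(b, l). \<phi> b l \<noteq> 0 \<and> \<psi> (a - b) (k - l) \<noteq> 0} \<noteq> {}"
    using assms unfolding tconv_def by (metis (no_types, lifting) sum.empty)
  then show ?thesis using that by auto
qed

lemma tadm_tconv:
  assumes "tadm \<phi>" "tadm \<psi>"
  shows "tadm (tconv \<phi> \<psi>)"
proof -
  obtain C where C: "\<And>a k. \<phi> a k \<noteq> 0 \<Longrightarrow> 0 \<le> a \<and> \<bar>k\<bar> \<le> a + C"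
    using assms by (auto simp: tadm_def)
  obtain D where D: "\<And>a k. \<psi> a k \<noteq> 0 \<Longrightarrow> 0 \<le> a \<and> \<bar>k\<bar> \<le> a + D"
    using assms by (auto simp: tadm_def)
  show ?thesis unfolding tadm_def
  proof (intro exI allI impI)
    fix a k assume "tconv \<phi> \<psi> a k \<noteq> 0"
    then obtain b l where "\<phi> b l \<noteq> 0" "\<psi> (a - b) (k - l) \<noteq> 0"
      by (rule tconv_nonzeroE)
    then show "0 \<le> a \<and> \<bar>k\<bar> \<le> a + (C + D)"
      using C[of b l] D[of "a - b" "k - l"] by linarith
  qed
qed

text \<open>Pairs of terms are collected by the total exponent of \<open>x\<close>. For
  \<open>x \<noteq> 0\<close> the exponents add, also when they have opposite signs.\<close>

lemma ev_tconv:
  fixes x :: "'a::field"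
  assumes "tadm \<phi>" "tadm \<psi>" "x \<noteq> 0"
  shows "ev (tconv \<phi> \<psi>) x = ev \<phi> x * ev \<psi> x"
proof (rule fps_ext)
  fix m
  let ?A = "{(a, k). \<phi> a k \<noteq> 0}" and ?B = "{(a, k). \<psi> a k \<noteq> 0}"
  let ?w = "\<lambda>(a :: int, k :: int). nat a"
  let ?f = "\<lambda>((a, k), (b, l)). of_int (\<phi> a k * \<psi> b l) * x powi (k + l)"
  let ?g = "\<lambda>((a :: int, k :: int), (b :: int, l :: int)). k + l"
  define S where "S = {p \<in> ?A \<times> ?B. (case p of (a, b) \<Rightarrow> ?w a + ?w b) = m}"
  have finS: "finite S"
    using finfib_Times[OF tadm_finfib[OF assms(1)] tadm_finfib[OF assms(2)]]
    unfolding finfib_def S_def by blast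
  have nn: "0 \<le> a" if "\<phi> a k \<noteq> 0" for a k using assms(1) that by (auto simp: tadm_def)
  have nn': "0 \<le> a" if "\<psi> a k \<noteq> 0" for a k using assms(2) that by (auto simp: tadm_def)
  have fib: "tconv \<phi> \<psi> (int m) s = (\<Sum>p\<in>{p\<in>S. ?g p = s}. case p of ((a, k), (b, l)) \<Rightarrow> \<phi> a k * \<psi> b l)" for s
    unfolding tconv_def
    by (rule sum.reindex_bij_witness[of _ fst "\<lambda>(a, k). ((a, k), (int m - a, s - k))"])
       (use nn nn' in \<open>force simp: S_def\<close>)+
  have "(ev \<phi> x * ev \<psi> x) $ m =
      (\<Sum>p\<in>S. case p of (a, b) \<Rightarrow> (case a of (a, k) \<Rightarrow> of_int (\<phi> a k) * x powi k) *
                                   (case b of (a, k) \<Rightarrow> of_int (\<psi> a k) * x powi k))"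
    unfolding ev_def gf_mult[OF tadm_finfib[OF assms(1)] tadm_finfib[OF assms(2)]]
    by (simp add: gf_def S_def)
  also have "\<dots> = (\<Sum>p\<in>S. ?f p)"
    using assms(3) by (intro sum.cong) (auto simp: power_int_add)
  also have "\<dots> = (\<Sum>s\<in>?g ` S. \<Sum>p\<in>{p\<in>S. ?g p = s}. ?f p)"
    by (rule sum.group[symmetric]) (use finS in auto)
  also have "\<dots> = (\<Sum>s\<in>?g ` S. of_int (tconv \<phi> \<psi> (int m) s) * x powi s)"
    unfolding fib of_int_sum sum_distrib_right by (intro sum.cong refl) auto
  also have "\<dots> = (\<Sum>s\<in>{s. tconv \<phi> \<psi> (int m) s \<noteq> 0}. of_int (tconv \<phi> \<psi> (int m) s) * x powi s)"
  proof (rule sum.mono_neutral_right)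
    show "{s. tconv \<phi> \<psi> (int m) s \<noteq> 0} \<subseteq> ?g ` S"
    proof
      fix s assume "s \<in> {s. tconv \<phi> \<psi> (int m) s \<noteq> 0}"
      then have "{p\<in>S. ?g p = s} \<noteq> {}"
        unfolding fib mem_Collect_eq by (metis (no_types, lifting) sum.empty)
      then show "s \<in> ?g ` S" by blast
    qed
  qed (use finS in auto)
  finally show "ev (tconv \<phi> \<psi>) x $ m = (ev \<phi> x * ev \<psi> x) $ m"
    by (simp add: ev_nth[OF tadm_tconv[OF assms(1,2)]])
qed

text \<open>Automorphy factors multiply, so levels add. In terms of arrays, the index of the first
  factor is moved by its own quasi-period, and the complementary index is then moved by exactly the
  quasi-period of the second factor.\<close>

lemma level_tconv:
  assumes "level h \<phi>" "level h' \<psi>"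
  shows "level (h + h') (tconv \<phi> \<psi>)"
  unfolding level_def
proof (intro conjI allI)
  fix a k
  have s1: "\<phi> (b + l + h) (l + 2 * h) = \<phi> b l" for b l using assms(1) by (simp add: level_def)
  have s2: "\<psi> (b + l + h') (l + 2 * h') = \<psi> b l" for b l using assms(2) by (simp add: level_def)
  have s3: "\<psi> (a + k + (h + h') - (b + l + h)) (k + 2 * (h + h') - (l + 2 * h)) = \<psi> (a - b) (k - l)" for b l
    using s2[of "a - b" "k - l"] by (simp add: algebra_simps)
  have s4: "\<phi> (b - (l - 2 * h) - h) (l - 2 * h) = \<phi> b l" for b l
    using s1[of "b - (l - 2 * h) - h" "l - 2 * h"] by simp
  have s5: "\<psi> (a - (b - (l - 2 * h) - h)) (k - (l - 2 * h)) = \<psi> (a + k + (h + h') - b) (k + 2 * (h + h') - l)" for b l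
    using s3[of "b - (l - 2 * h) - h" "l - 2 * h"] by (simp add: algebra_simps)
  show "tconv \<phi> \<psi> (a + k + (h + h')) (k + 2 * (h + h')) = tconv \<phi> \<psi> a k"
    unfolding tconv_def
  proof (rule sum.reindex_bij_witness[of _ "\<lambda>(b, l). (b + l + h, l + 2 * h)" "\<lambda>(b, l). (b - (l - 2 * h) - h, l - 2 * h)"], goal_cases)
    case (2 p)
    then show ?case by (cases p) (simp only: mem_Collect_eq prod.case s4 s5 not_False_eq_True)
  next
    case (4 p)
    then show ?case by (cases p) (simp only: mem_Collect_eq prod.case s1 s3 not_False_eq_True)
  next
    case (5 p)
    show ?case by (cases p) (simp only: prod.case s4 s5)
  qed auto
next
  fix a k
  have r1: "\<phi> b (- l) = \<phi> b l" and r2: "\<psi> b (- l) = \<psi> b l" for b l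
    using assms by (auto simp: level_def)
  have r3: "\<psi> b (- k - l) = \<psi> b (k + l)" for b l
    using r2[of b "k + l"] by (simp add: algebra_simps)
  have r4: "\<psi> b (l - k) = \<psi> b (k - l)" for b l
    using r2[of b "k - l"] by (simp add: algebra_simps)
  show "tconv \<phi> \<psi> a (- k) = tconv \<phi> \<psi> a k"
    unfolding tconv_def
    by (rule sum.reindex_bij_witness[of _ "\<lambda>(b, l). (b, - l)" "\<lambda>(b, l). (b, - l)"])
       (auto simp: r1 r3 r4)
qed

section \<open>Residue classes modulo \<open>2h\<close> up to sign\<close>

definition cls :: "int \<Rightarrow> int \<Rightarrow> int" where
  "cls h k = (if k mod (2 * h) \<le> h then k mod (2 * h) else 2 * h - k mod (2 * h))"

lemma cls_range:
  assumes "h > 0"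
  shows "0 \<le> cls h k" "cls h k \<le> h"
proof -
  have "k mod (2 * h) < 2 * h" "0 \<le> k mod (2 * h)" using assms by auto
  then show "0 \<le> cls h k" "cls h k \<le> h" by (auto simp: cls_def)
qed

lemma cls_add [simp]: "cls h (k + 2 * h * n) = cls h k"
  by (simp add: cls_def)

lemma cls_add' [simp]: "cls h (k + 2 * h) = cls h k"
  using cls_add[of h k 1] by simp

lemma cls_id: "0 \<le> k \<Longrightarrow> k \<le> h \<Longrightarrow> h > 0 \<Longrightarrow> cls h k = k"
  by (simp add: cls_def)

lemma cls_uminus [simp]:
  assumes "h > 0"
  shows "cls h (- k) = cls h k"
  using assms pos_mod_bound[of "2 * h" k] by (auto simp: cls_def zmod_zminus1_eq_if)

lemma cls_cases:
  assumes "h > 0"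
  obtains n where "k = cls h k + 2 * h * n" | n where "k = - cls h k + 2 * h * n"
proof (cases "k mod (2 * h) \<le> h")
  case True
  then show ?thesis using that(1)[of "k div (2 * h)"] by (simp add: cls_def)
next
  case False
  have "k = - (2 * h - k mod (2 * h)) + 2 * h * (k div (2 * h) + 1)"
    by (simp add: distrib_left)
  then show ?thesis using that(2)[of "k div (2 * h) + 1"] False by (simp add: cls_def)
qed

text \<open>Writing \<open>k\<close> as \<open>j + 2hn\<close> or \<open>- j + 2hn\<close> shows
  divisibility by \<open>4h\<close>. The quotient is nonnegative because the representative
  \<open>j\<close> has the least absolute value in its class, and the linear bound supplies finite
  fibres.\<close>

lemma cls_sq:
  assumes "h > 0"
  obtains n where "k\<^sup>2 - (cls h k)\<^sup>2 = 4 * h * n" "n \<ge> 0" "\<bar>k\<bar> \<le> n + 2 * h"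
proof -
  let ?j = "cls h k"
  have "\<exists>n. k\<^sup>2 - ?j\<^sup>2 = 4 * h * n"
  proof (cases rule: cls_cases[OF assms, of k])
    case (1 n)
    have "k\<^sup>2 - ?j\<^sup>2 = (?j + 2 * h * n)\<^sup>2 - ?j\<^sup>2" by (subst (1) 1) (rule refl)
    also have "\<dots> = 4 * h * (?j * n + h * n\<^sup>2)" by (simp add: power2_eq_square algebra_simps)
    finally show ?thesis by blast
  next
    case (2 n)
    have "k\<^sup>2 - ?j\<^sup>2 = (- ?j + 2 * h * n)\<^sup>2 - ?j\<^sup>2" by (subst (1) 2) (rule refl)
    also have "\<dots> = 4 * h * (- ?j * n + h * n\<^sup>2)" by (simp add: power2_eq_square algebra_simps)
    finally show ?thesis by blast
  qed
  then obtain n where n: "k\<^sup>2 - ?j\<^sup>2 = 4 * h * n" by blast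
  have r: "0 \<le> ?j" "?j \<le> h" using cls_range[OF assms] by auto
  have "?j \<le> \<bar>k\<bar>"
  proof (rule ccontr)
    assume *: "\<not> ?j \<le> \<bar>k\<bar>"
    then have "cls h \<bar>k\<bar> = \<bar>k\<bar>" using r assms by (intro cls_id) auto
    moreover have "cls h \<bar>k\<bar> = cls h k" using assms by (auto simp: abs_if)
    ultimately show False using * by simp
  qed
  then have "?j\<^sup>2 \<le> k\<^sup>2" using r by (simp add: abs_le_square_iff[symmetric])
  then have "0 \<le> 4 * h * n" using n by simp
  then have n0: "n \<ge> 0" using assms by (simp add: zero_le_mult_iff)
  have "\<bar>k\<bar> \<le> n + 2 * h"
  proof (rule ccontr)
    assume "\<not> \<bar>k\<bar> \<le> n + 2 * h"
    then have "(n + 2 * h)\<^sup>2 < \<bar>k\<bar>\<^sup>2" using n0 assms by (intro power_strict_mono) auto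
    then have "(n + 2 * h)\<^sup>2 < k\<^sup>2" by simp
    moreover have "?j\<^sup>2 \<le> h\<^sup>2" using r by (intro power_mono) auto
    moreover have "k\<^sup>2 = ?j\<^sup>2 + 4 * h * n" using n by simp
    moreover have "(n + 2 * h)\<^sup>2 = n\<^sup>2 + 4 * h * n + 4 * h\<^sup>2" by (simp add: power2_eq_square algebra_simps)
    moreover have "h\<^sup>2 \<ge> 0" "n\<^sup>2 \<ge> 0" by auto
    ultimately show False by linarith
  qed
  with n n0 that show ?thesis by blast
qed

text \<open>\<open>texp h k\<close> is the exact quotient of \<open>k\<^sup>2 - j\<^sup>2\<close> by \<open>4h\<close>, where \<open>j\<close> is the class of \<open>k\<close>.\<close>

definition texp :: "int \<Rightarrow> int \<Rightarrow> int" where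
  "texp h k = (k\<^sup>2 - (cls h k)\<^sup>2) div (4 * h)"

lemma texp:
  assumes "h > 0"
  shows "k\<^sup>2 - (cls h k)\<^sup>2 = 4 * h * texp h k" "texp h k \<ge> 0" "\<bar>k\<bar> \<le> texp h k + 2 * h"
proof -
  obtain n where n: "k\<^sup>2 - (cls h k)\<^sup>2 = 4 * h * n" "n \<ge> 0" "\<bar>k\<bar> \<le> n + 2 * h"
    by (rule cls_sq[OF assms])
  then have "texp h k = n" using assms by (simp add: texp_def)
  with n show "k\<^sup>2 - (cls h k)\<^sup>2 = 4 * h * texp h k" "texp h k \<ge> 0" "\<bar>k\<bar> \<le> texp h k + 2 * h" by auto
qed

text \<open>The coefficient array of \<open>\<theta>\<^sub>j\<close> of the overview.\<close>

definition tb :: "int \<Rightarrow> int \<Rightarrow> int \<Rightarrow> int \<Rightarrow> int" where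
  "tb h j a k = (if cls h k = j \<and> texp h k = a then 1 else 0)"

lemma tadm_tb: "h > 0 \<Longrightarrow> tadm (tb h j)"
  unfolding tadm_def tb_def using texp(2,3) by (intro exI[of _ "2 * h"]) auto

lemma texp_uminus [simp]: "h > 0 \<Longrightarrow> texp h (- k) = texp h k"
  by (simp add: texp_def)

lemma texp_add: "h > 0 \<Longrightarrow> texp h (k + 2 * h) = texp h k + k + h"
proof -
  assume h: "h > 0"
  have "4 * h * texp h (k + 2 * h) = 4 * h * (texp h k + k + h)"
    using texp(1)[OF h, of k] texp(1)[OF h, of "k + 2 * h", unfolded cls_add']
    by (simp add: power2_eq_square algebra_simps)
  then show ?thesis using h by simp
qed

lemma level_tb:
  assumes "h > 0"
  shows "level h (tb h j)"
  using assms by (auto simp: level_def tb_def texp_add)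

text \<open>The linear terms \<open>k\<close> of the single steps form an arithmetic progression and
  add up to the quadratic term. Negative \<open>n\<close> is needed too, hence the two-sided
  induction.\<close>

lemma level_iterate:
  assumes "level h \<phi>"
  shows "\<phi> (a + n * k + h * n\<^sup>2) (k + 2 * h * n) = \<phi> a k"
proof -
  have s: "\<phi> (b + l + h) (l + 2 * h) = \<phi> b l" for b l
    using assms by (simp add: level_def)
  show ?thesis
  proof (induction n rule: int_induct[of _ 0])
    case base
    then show ?case by simp
  next
    case (step1 i)
    then show ?case using s[of "a + i * k + h * i\<^sup>2" "k + 2 * h * i"]
      by (simp add: power2_eq_square algebra_simps)
  next
    case (step2 i)
    then show ?case using s[of "a + (i - 1) * k + h * (i - 1)\<^sup>2" "k + 2 * h * (i - 1)"]
      by (simp add: power2_eq_square algebra_simps)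
  qed
qed

text \<open>The dimension count: reflection and quasi-periodicity carry \<open>k\<close> to its
  class in \<open>0..h\<close>, at the price of \<open>texp h k\<close> in the exponent of
  \<open>X\<close>. So the \<open>h + 1\<close> columns \<open>0..h\<close> determine the whole
  array.\<close>

lemma level_reduce:
  assumes "level h \<phi>" "h > 0"
  shows "\<phi> a k = \<phi> (a - texp h k) (cls h k)"
proof -
  let ?j = "cls h k"
  have r: "\<phi> b (- l) = \<phi> b l" for b l using assms(1) by (simp add: level_def)
  show ?thesis
  proof (cases rule: cls_cases[OF assms(2), of k])
    case (1 n)
    have "4 * h * texp h k = (?j + 2 * h * n)\<^sup>2 - ?j\<^sup>2"
      unfolding texp(1)[OF assms(2), of k, symmetric] by (subst (1) 1) (rule refl)
    also have "\<dots> = 4 * h * (n * ?j + h * n\<^sup>2)" by (simp add: power2_eq_square algebra_simps)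
    finally have "texp h k = n * ?j + h * n\<^sup>2" using assms(2) by simp
    then show ?thesis
      using level_iterate[OF assms(1), of "a - texp h k" n ?j] by (simp flip: 1)
  next
    case (2 n)
    have "4 * h * texp h k = (- ?j + 2 * h * n)\<^sup>2 - ?j\<^sup>2"
      unfolding texp(1)[OF assms(2), of k, symmetric] by (subst (1) 2) (rule refl)
    also have "\<dots> = 4 * h * (n * (- ?j) + h * n\<^sup>2)" by (simp add: power2_eq_square algebra_simps)
    finally have "texp h k = n * (- ?j) + h * n\<^sup>2" using assms(2) by simp
    then have "\<phi> a (- ?j + 2 * h * n) = \<phi> (a - texp h k) (- ?j)"
      using level_iterate[OF assms(1), of "a - texp h k" n "- ?j"] by (simp add: algebra_simps)
    then show ?thesis unfolding r 2[symmetric] .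
  qed
qed

text \<open>The coefficients in this expansion depend on the array only and not on \<open>x\<close>.
  Hence the same change of basis serves all rows of a determinant and can be pulled out of
  it.\<close>

lemma ev_level:
  fixes x :: "'a::field"
  assumes "level (int h) \<phi>" "tadm \<phi>" "h > 0"
  shows "ev \<phi> x = (\<Sum>j\<le>h. ofi (Abs_fps (\<lambda>a. \<phi> (int a) (int j))) * ev (tb (int h) (int j)) x)"
proof (rule fps_ext)
  fix m
  have h: "int h > 0" using assms(3) by simp
  define T where "T j a = {k. tb (int h) (int j) (int a) k \<noteq> 0}" for j a
  have finT: "finite (T j a)" for j a
    unfolding T_def by (rule finite_tadm_row[OF tadm_tb[OF h]])
  have "(\<Sum>j\<le>h. ofi (Abs_fps (\<lambda>a. \<phi> (int a) (int j))) * ev (tb (int h) (int j)) x) $ m =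
      (\<Sum>j\<le>h. \<Sum>a\<le>m. \<Sum>k\<in>T j (m - a). of_int (\<phi> (int a) (int j)) * x powi k)"
    unfolding fps_sum_nth fps_mult_nth ev_nth[OF tadm_tb[OF h]] atLeast0AtMost T_def
    by (intro sum.cong refl) (auto simp: sum_distrib_left tb_def intro!: sum.cong)
  also have "\<dots> = (\<Sum>(j, a, k)\<in>(SIGMA j:{..h}. SIGMA a:{..m}. T j (m - a)). of_int (\<phi> (int a) (int j)) * x powi k)"
    by (simp add: sum.Sigma finT)
  also have "\<dots> = (\<Sum>(j, a, k)\<in>{(j, a, k)\<in>(SIGMA j:{..h}. SIGMA a:{..m}. T j (m - a)). \<phi> (int a) (int j) \<noteq> 0}.
      of_int (\<phi> (int a) (int j)) * x powi k)"
    by (intro sum.mono_neutral_right finite_SigmaI finT) auto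
  also have "\<dots> = (\<Sum>k\<in>{k. \<phi> (int m) k \<noteq> 0}. of_int (\<phi> (int m) k) * x powi k)"
  \<comment> \<open>A contributing triple is determined by its last entry \<open>k\<close>: its
    class gives \<open>j\<close>, and the degree left over after \<open>texp\<close> gives
    \<open>a\<close>.\<close>
  proof (rule sum.reindex_bij_witness[of _ "\<lambda>k. (nat (cls h k), nat (int m - texp h k), k)" "\<lambda>(j, a, k). k"], goal_cases)
    case (1 p)
    then show ?case by (auto simp: tb_def T_def split: if_splits)
  next
    case (2 p)
    then obtain j a k where p: "p = (j, a, k)" "j \<le> h" "a \<le> m" "cls h k = j" "texp h k = int (m - a)"
        "\<phi> (int a) (int j) \<noteq> 0"
      by (auto simp: tb_def T_def split: if_splits)
    then show ?case using level_reduce[OF assms(1) h, of "int m" k] by (simp add: of_nat_diff)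
  next
    case (3 k)
    then show ?case by simp
  next
    case (4 k)
    then have *: "\<phi> (int m - texp h k) (cls h k) \<noteq> 0" using level_reduce[OF assms(1) h, of "int m" k] by simp
    then have "texp h k \<le> int m" using tadm_nonneg[OF assms(2) *] by simp
    then show ?case using * cls_range[OF h, of k] texp(2)[OF h, of k] by (auto simp: tb_def T_def)
  next
    case (5 p)
    then obtain j a k where p: "p = (j, a, k)" "j \<le> h" "a \<le> m" "cls h k = j" "texp h k = int (m - a)"
      by (auto simp: tb_def T_def split: if_splits)
    then show ?case using level_reduce[OF assms(1) h, of "int m" k] by (simp add: of_nat_diff)
  qed
  finally show "ev \<phi> x $ m = (\<Sum>j\<le>h. ofi (Abs_fps (\<lambda>a. \<phi> (int a) (int j))) * ev (tb (int h) (int j)) x) $ m"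
    by (simp add: ev_nth[OF assms(2)])
qed

section \<open>Vandermonde determinants\<close>

lemma det_scale_rows:
  fixes c :: "nat \<Rightarrow> 'a::comm_ring_1"
  shows "Determinant.det (mat n n (\<lambda>(i, j). c i * A i j)) = (\<Prod>i<n. c i) * Determinant.det (mat n n (\<lambda>(i, j). A i j))"
proof -
  have "(\<Prod>i = 0..<n. mat n n (\<lambda>(i, j). c i * A i j) $$ (i, p i)) =
      (\<Prod>i<n. c i) * (\<Prod>i = 0..<n. mat n n (\<lambda>(i, j). A i j) $$ (i, p i))"
    if "p permutes {0..<n}" for p
  proof -
    have "p i < n" if "i < n" for i using \<open>p permutes {0..<n}\<close> that by (metis permutes_in_image atLeastLessThan_iff zero_le)
    then show ?thesis by (simp add: prod.distrib lessThan_atLeast0)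
  qed
  then show ?thesis
    by (simp add: det_def' [of _ n] sum_distrib_left mult_ac)
qed

lemma det_scale_cols:
  fixes c :: "nat \<Rightarrow> 'a::comm_ring_1"
  shows "Determinant.det (mat n n (\<lambda>(i, j). c j * A i j)) = (\<Prod>j<n. c j) * Determinant.det (mat n n (\<lambda>(i, j). A i j))"
proof -
  have t: "mat n n (\<lambda>(i, j). f i j) = (mat n n (\<lambda>(i, j). f j i))\<^sup>T" for f :: "nat \<Rightarrow> nat \<Rightarrow> 'a"
    by (intro eq_matI) auto
  have "Determinant.det (mat n n (\<lambda>(i, j). c j * A i j)) = Determinant.det (mat n n (\<lambda>(i, j). c i * A j i))"
    by (subst t) (rule det_transpose[of _ n], simp)
  also have "\<dots> = (\<Prod>j<n. c j) * Determinant.det (mat n n (\<lambda>(i, j). A j i))"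
    by (rule det_scale_rows)
  also have "Determinant.det (mat n n (\<lambda>(i, j). A j i)) = Determinant.det (mat n n (\<lambda>(i, j). A i j))"
    by (subst t) (rule det_transpose[of _ n], simp)
  finally show ?thesis .
qed

text \<open>Subtracting \<open>w 0\<close> times the preceding column from every later column is
  multiplication by the unipotent bidiagonal matrix \<open>U\<close>. It clears the first row apart
  from its first entry and leaves a rescaled Vandermonde matrix of size \<open>n\<close>.\<close>

lemma det_vandermonde:
  fixes w :: "nat \<Rightarrow> 'a::comm_ring_1"
  shows "Determinant.det (mat n n (\<lambda>(i, j). w i ^ j)) = (\<Prod>j<n. \<Prod>i<j. w j - w i)"
proof (induction n arbitrary: w)
  case 0
  then show ?case by simp
next
  case (Suc n)
  let ?N = "Suc n"
  define V where "V = mat ?N ?N (\<lambda>(i, j). w i ^ j)"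
  define U where "U = mat ?N ?N (\<lambda>(i, j). if i = j then 1 else if Suc i = j then - w 0 else 0)"
  define M where "M = mat ?N ?N (\<lambda>(i, j). if j = 0 then 1 else w i ^ (j - 1) * (w i - w 0))"
  have V: "V \<in> carrier_mat ?N ?N" and U: "U \<in> carrier_mat ?N ?N" and M: "M \<in> carrier_mat ?N ?N"
    by (auto simp: V_def U_def M_def)
  have "V * U = M"
  proof (intro eq_matI)
    fix i j assume "i < dim_row M" "j < dim_col M"
    then have i: "i < ?N" and j: "j < ?N" by (auto simp: M_def)
    have "(V * U) $$ (i, j) = (\<Sum>k<?N. w i ^ k * (if k = j then 1 else if Suc k = j then - w 0 else 0))"
      using i j by (simp add: V_def U_def scalar_prod_def lessThan_atLeast0)
    also have "\<dots> = (\<Sum>k<?N. if k = j then w i ^ k else 0) + (\<Sum>k<?N. if Suc k = j then - w 0 * w i ^ k else 0)"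
      unfolding sum.distrib[symmetric] by (intro sum.cong) auto
    also have "\<dots> = M $$ (i, j)"
    proof (cases j)
      case 0
      then show ?thesis using i by (simp add: M_def)
    next
      case (Suc j')
      then have "(\<Sum>k<?N. if Suc k = j then - w 0 * w i ^ k else 0) = - w 0 * w i ^ j'"
        using j by (simp add: sum.delta)
      moreover have "(\<Sum>k<?N. if k = j then w i ^ k else 0) = w i ^ j"
        using j by (simp add: sum.delta)
      ultimately show ?thesis using i j Suc by (simp add: M_def algebra_simps)
    qed
    finally show "(V * U) $$ (i, j) = M $$ (i, j)" .
  qed (auto simp: V_def U_def M_def)
  moreover have "Determinant.det U = 1"
  proof -
    have "upper_triangular U" by (auto simp: U_def)
    then have "Determinant.det U = prod_list (diag_mat U)" by (rule det_upper_triangular[OF _ U])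
    also have "diag_mat U = map (\<lambda>_. 1) [0..<?N]"
      unfolding diag_mat_def by (intro map_cong) (auto simp: U_def)
    finally show ?thesis by (simp add: map_replicate_const)
  qed
  ultimately have "Determinant.det V = Determinant.det M"
    using det_mult[OF V U] by simp
  also have "Determinant.det M = (\<Sum>j<?N. M $$ (0, j) * cofactor M 0 j)"
    by (rule laplace_expansion_row[OF M]) simp
  also have "\<dots> = M $$ (0, 0) * cofactor M 0 0"
    by (rule sum.remove[where x = 0, THEN trans]) (auto simp: M_def intro!: sum.neutral)
  also have "\<dots> = Determinant.det (mat_delete M 0 0)"
    by (simp add: M_def cofactor_def)
  also have "mat_delete M 0 0 = mat n n (\<lambda>(i, j). (w (Suc i) - w 0) * w (Suc i) ^ j)"
    by (intro eq_matI) (auto simp: mat_delete_def M_def)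
  also have "Determinant.det \<dots> = (\<Prod>i<n. w (Suc i) - w 0) * Determinant.det (mat n n (\<lambda>(i, j). w (Suc i) ^ j))"
    by (rule det_scale_rows)
  also have "\<dots> = (\<Prod>i<n. w (Suc i) - w 0) * (\<Prod>j<n. \<Prod>i<j. w (Suc j) - w (Suc i))"
    by (simp add: Suc.IH[of "\<lambda>i. w (Suc i)"])
  also have "\<dots> = (\<Prod>j<?N. \<Prod>i<j. w j - w i)"
    by (simp add: prod.lessThan_Suc_shift prod.distrib del: prod.lessThan_Suc)
  finally show ?case by (simp add: V_def)
qed

lemma prod_pairs_eq_power:
  fixes e :: "nat \<Rightarrow> 'a::comm_ring_1"
  shows "(\<Prod>j<n. \<Prod>i<j. e i * e j) = (\<Prod>i<n. e i ^ (n - 1))"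
proof (induction n)
  case (Suc n)
  have "(\<Prod>i<n. e i ^ n) = (\<Prod>i<n. e i ^ (n - 1)) * (\<Prod>i<n. e i)"
    unfolding prod.distrib[symmetric] by (intro prod.cong) (auto simp flip: power_Suc2)
  moreover have "(\<Prod>i<n. e i * e n) = (\<Prod>i<n. e i) * e n ^ n"
    by (simp only: prod.distrib prod_constant card_lessThan)
  ultimately have "(\<Prod>j<Suc n. \<Prod>i<j. e i * e j) = (\<Prod>i<n. e i ^ n) * e n ^ n"
    unfolding prod.lessThan_Suc Suc.IH by (simp only: mult_ac)
  then show ?case by simp
qed simp

text \<open>A nonzero constant coefficient makes each \<open>e i\<close> a unit, so the ordinary
  Vandermonde determinant can be applied to the quotients of \<open>p i\<close> by
  \<open>e i\<close>. Each index lies in \<open>n - 1\<close> pairs, which matches the power of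
  \<open>e i\<close> taken out of its row.\<close>

lemma det_vandermonde_homogeneous:
  fixes p e :: "nat \<Rightarrow> 'a::field fps"
  assumes "\<And>i. e i $ 0 \<noteq> 0"
  shows "(\<Prod>j<n. \<Prod>i<j. p j * e i - e j * p i) =
           Determinant.det (mat n n (\<lambda>(i, j). p i ^ j * e i ^ (n - 1 - j)))"
proof -
  define w where "w i = p i * inverse (e i)" for i
  have p: "p i = e i * w i" for i
    using inverse_mult_eq_1'[OF assms] by (simp add: w_def mult.left_commute)
  have "mat n n (\<lambda>(i, j). p i ^ j * e i ^ (n - 1 - j)) = mat n n (\<lambda>(i, j). e i ^ (n - 1) * w i ^ j)"
  proof (intro eq_matI)
    fix i j assume "i < dim_row (mat n n (\<lambda>(i, j). e i ^ (n - 1) * w i ^ j))"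
      "j < dim_col (mat n n (\<lambda>(i, j). e i ^ (n - 1) * w i ^ j))"
    then have ij: "i < n" "j < n" by auto
    then have "n - 1 = j + (n - 1 - j)" by simp
    then have "e i ^ (n - 1) = e i ^ j * e i ^ (n - 1 - j)" by (metis power_add)
    then show "mat n n (\<lambda>(i, j). p i ^ j * e i ^ (n - 1 - j)) $$ (i, j) = mat n n (\<lambda>(i, j). e i ^ (n - 1) * w i ^ j) $$ (i, j)"
      using ij by (simp add: p power_mult_distrib mult_ac)
  qed auto
  then have "Determinant.det (mat n n (\<lambda>(i, j). p i ^ j * e i ^ (n - 1 - j))) =
      (\<Prod>i<n. e i ^ (n - 1)) * (\<Prod>j<n. \<Prod>i<j. w j - w i)"
    by (simp add: det_scale_rows det_vandermonde)
  also have "\<dots> = (\<Prod>j<n. \<Prod>i<j. (e i * e j) * (w j - w i))"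
    by (simp only: prod.distrib[symmetric] prod_pairs_eq_power[symmetric])
  also have "\<dots> = (\<Prod>j<n. \<Prod>i<j. p j * e i - e j * p i)"
    by (intro prod.cong refl) (simp add: p algebra_simps)
  finally show ?thesis by simp
qed

text \<open>The product of \<open>a\<close> copies of the odd and \<open>b\<close> copies of the
  even theta function of level 1, built from the array of the constant 1.\<close>

definition thp :: "nat \<Rightarrow> nat \<Rightarrow> int \<Rightarrow> int \<Rightarrow> int" where
  "thp a b = ((tconv (tb 1 1)) ^^ a) (((tconv (tb 1 0)) ^^ b) (\<lambda>m k. if m = 0 \<and> k = 0 then 1 else 0))"

lemma thp_props:
  "tadm (thp a b)" "level (int (a + b)) (thp a b)"
  "x \<noteq> 0 \<Longrightarrow> ev (thp a b) x = ev (tb 1 1) x ^ a * ev (tb 1 0) (x :: 'a::field) ^ b"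
proof -
  let ?u = "\<lambda>(m :: int) (k :: int). if m = 0 \<and> k = 0 then 1 else (0 :: int)"
  let ?e = "((tconv (tb 1 0)) ^^ b) ?u"
  note t = tadm_tb[of 1, simplified] and l = level_tb[of 1, simplified]
  have u: "tadm ?u" "level 0 ?u"
    by (auto simp: tadm_def level_def split: if_splits)
  have eu: "ev ?u x = 1"
  proof (rule fps_ext)
    fix m
    have "{k. ?u (int m) k \<noteq> 0} = (if m = 0 then {0} else {})" by auto
    then show "ev ?u x $ m = 1 $ m"
      by (simp add: ev_nth[OF u(1)] fps_one_nth)
  qed
  have e: "tadm ?e" "level (int b) ?e" "x \<noteq> 0 \<Longrightarrow> ev ?e x = ev (tb 1 0) x ^ b"
  proof (induction b)
    case 0
    {
      case 1
      then show ?case using u by simp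
    next
      case 2
      then show ?case using u by simp
    next
      case 3
      then show ?case by (simp only: funpow.simps id_apply eu power_0)
    }
  next
    case (Suc b)
    {
      case 1
      then show ?case using Suc t by (simp add: tadm_tconv)
    next
      case 2
      then show ?case using level_tconv[OF l Suc(2)] by (simp add: algebra_simps)
    next
      case 3
      then show ?case using Suc t by (simp add: ev_tconv)
    }
  qed
  have "tadm (thp a b) \<and> level (int (a + b)) (thp a b) \<and>
      (x \<noteq> 0 \<longrightarrow> ev (thp a b) x = ev (tb 1 1) x ^ a * ev (tb 1 0) x ^ b)"
  proof (induction a)
    case 0
    then show ?case using e by (simp add: thp_def)
  next
    case (Suc a)
    have s: "thp (Suc a) b = tconv (tb 1 1) (thp a b)" by (simp add: thp_def)
    show ?case unfolding s using Suc t tadm_tconv[OF t[of 1], of "thp a b"] level_tconv[OF l[of 1], of "int (a + b)" "thp a b"]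
      by (auto simp: ev_tconv algebra_simps)
  qed
  then show "tadm (thp a b)" "level (int (a + b)) (thp a b)"
    "x \<noteq> 0 \<Longrightarrow> ev (thp a b) x = ev (tb 1 1) x ^ a * ev (tb 1 0) x ^ b" by auto
qed

text \<open>Degree 0 in \<open>X\<close> forces \<open>k\<^sup>2 = j\<^sup>2\<close>. For
  \<open>j = 0\<close> the two solutions coincide, so the term is counted once.\<close>

lemma ev_tb_nth_0:
  assumes "h > 0" "0 \<le> j" "j \<le> h"
  shows "ev (tb h j) x $ 0 = (if j = 0 then 1 else x powi j + x powi (- j))"
proof -
  have "cls h k = j \<and> texp h k = 0 \<longleftrightarrow> k = j \<or> k = - j" for k
  proof
    assume "cls h k = j \<and> texp h k = 0"
    then have "k\<^sup>2 = j\<^sup>2" using texp(1)[OF assms(1), of k] by simp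
    then show "k = j \<or> k = - j" by (simp add: power2_eq_iff)
  next
    assume *: "k = j \<or> k = - j"
    then have "cls h k = j" using assms by (auto simp: cls_id)
    moreover from * have "k\<^sup>2 = j\<^sup>2" by auto
    ultimately show "cls h k = j \<and> texp h k = 0" by (simp add: texp_def)
  qed
  then have "{k. tb h j 0 k \<noteq> 0} = {j, - j}"
    by (auto simp: tb_def)
  moreover have "tb h j 0 k = 1" if "k \<in> {j, - j}" for k
    using that \<open>{k. tb h j 0 k \<noteq> 0} = {j, - j}\<close> by (auto simp: tb_def split: if_splits)
  ultimately show ?thesis using assms by (auto simp: ev_nth[OF tadm_tb[OF assms(1)]])
qed

text \<open>The determinant of the matrix expressing the level \<open>n - 1\<close> products of
  level 1 functions through the basis \<open>\<theta>\<^sub>0, \<theta>\<^sub>1, \<dots>\<close> of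
  that level. Neither the points nor the field enter.\<close>

definition mac_const :: "nat \<Rightarrow> int fps" where
  "mac_const n = Determinant.det (mat n n (\<lambda>(l, j). Abs_fps (\<lambda>a. thp j (n - 1 - j) (int a) (int l))))"

text \<open>Both sides are alternating in the \<open>x i\<close> and, in each of them, theta functions of level
  \<open>n - 1\<close> that are invariant under \<open>x \<mapsto> 1/x\<close>. These form a space of dimension \<open>n\<close>.\<close>

theorem theta_vandermonde:
  fixes x :: "nat \<Rightarrow> 'a::field"
  assumes "n \<ge> 2" "\<And>i. x i \<noteq> 0"
  shows "(\<Prod>j<n. \<Prod>i<j. ev (tb 1 1) (x j) * ev (tb 1 0) (x i) - ev (tb 1 0) (x j) * ev (tb 1 1) (x i)) =
           ofi (mac_const n) * Determinant.det (mat n n (\<lambda>(i, j). ev (tb (int n - 1) (int j)) (x i)))"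
proof -
  interpret ofi: comm_ring_hom "ofi :: int fps \<Rightarrow> 'a fps" by (rule ofi_hom)
  define B where "B = mat n n (\<lambda>(l, j). Abs_fps (\<lambda>a. thp j (n - 1 - j) (int a) (int l)))"
  define D where "D = mat n n (\<lambda>(i, j). ev (tb (int n - 1) (int j)) (x i))"
  have D: "D \<in> carrier_mat n n" and B: "map_mat ofi B \<in> carrier_mat n n"
    by (auto simp: D_def B_def)
  have "mat n n (\<lambda>(i, j). ev (tb 1 1) (x i) ^ j * ev (tb 1 0) (x i) ^ (n - 1 - j)) = D * map_mat ofi B"
  proof (intro eq_matI)
    fix i j assume "i < dim_row (D * map_mat ofi B)" "j < dim_col (D * map_mat ofi B)"
    then have ij: "i < n" "j < n" by (auto simp: D_def B_def)
    have "j + (n - 1 - j) = n - 1" using ij by auto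
    then have lev: "level (int (n - 1)) (thp j (n - 1 - j))" using thp_props(2)[of j "n - 1 - j"] by (simp only:)
    have h: "int n - 1 = int (n - 1)" using ij by auto
    have "ev (tb 1 1) (x i) ^ j * ev (tb 1 0) (x i) ^ (n - 1 - j) = ev (thp j (n - 1 - j)) (x i)"
      using thp_props(3)[of "x i" j "n - 1 - j"] assms(2) by simp
    also have "\<dots> = (\<Sum>l\<le>n - 1. ofi (Abs_fps (\<lambda>a. thp j (n - 1 - j) (int a) (int l))) * ev (tb (int (n - 1)) (int l)) (x i))"
      by (rule ev_level[OF lev thp_props(1)]) (use assms in simp)
    also have "{..n - 1} = {0..<n}" using assms by auto
    finally show "mat n n (\<lambda>(i, j). ev (tb 1 1) (x i) ^ j * ev (tb 1 0) (x i) ^ (n - 1 - j)) $$ (i, j) = (D * map_mat ofi B) $$ (i, j)"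
      using ij by (simp add: D_def B_def scalar_prod_def h mult_ac del: of_nat_diff)
  qed (auto simp: D_def B_def)
  moreover have "(\<Prod>j<n. \<Prod>i<j. ev (tb 1 1) (x j) * ev (tb 1 0) (x i) - ev (tb 1 0) (x j) * ev (tb 1 1) (x i)) =
      Determinant.det (mat n n (\<lambda>(i, j). ev (tb 1 1) (x i) ^ j * ev (tb 1 0) (x i) ^ (n - 1 - j)))"
    by (rule det_vandermonde_homogeneous) (simp add: ev_tb_nth_0)
  ultimately show ?thesis
    using det_mult[OF D B] by (simp add: mac_const_def B_def D_def mult.commute)
qed

section \<open>The Macdonald identity of type \<open>D\<close>\<close>

lemma gf_union_disjoint:
  assumes "finfib A w" "finfib B w" "A \<inter> B = {}"
  shows "gf (A \<union> B) w c = gf A w c + gf B w c"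
proof (rule fps_ext)
  fix m
  have "{a \<in> A \<union> B. w a = m} = {a \<in> A. w a = m} \<union> {a \<in> B. w a = m}" by auto
  then show "gf (A \<union> B) w c $ m = (gf A w c + gf B w c) $ m"
    using assms by (simp add: gf_def finfib_def) (subst sum.union_disjoint, auto)
qed

lemma finfib_texp:
  assumes "h > 0"
  shows "finfib A (\<lambda>k. nat (texp h k))"
  unfolding finfib_def
proof
  fix m
  have "{a \<in> A. nat (texp h a) = m} \<subseteq> {- (int m + 2 * h)..int m + 2 * h}"
  proof
    fix k assume "k \<in> {a \<in> A. nat (texp h a) = m}"
    then show "k \<in> {- (int m + 2 * h)..int m + 2 * h}" using texp(2,3)[OF assms, of k] by auto
  qed
  then show "finite {a \<in> A. nat (texp h a) = m}" by (rule finite_subset) simp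
qed

lemma ev_tb_gf:
  assumes "h > 0"
  shows "ev (tb h j) x = gf {k. cls h k = j} (\<lambda>k. nat (texp h k)) (\<lambda>k. x powi k)"
proof -
  have "bij_betw (\<lambda>k. (texp h k, k)) {k. cls h k = j} {(a, k). tb h j a k \<noteq> 0}"
    by (rule bij_betw_byWitness[where f' = snd]) (auto simp: tb_def split: if_splits)
  then show ?thesis
    unfolding ev_def by (subst gf_reindex) (auto intro!: gf_cong simp: tb_def)
qed

text \<open>The factor with index 0 is the constant \<open>1 - c\<close>; the others are those of
  the product starting at \<open>d\<close>.\<close>

lemma iprod_0:
  assumes "d > 0"
  shows "iprod c 0 d = fps_const (1 - c) * iprod c d d"
proof (rule LIMSEQ_unique)
  show "(\<lambda>n. fprod c 0 d (Suc n)) \<longlonglongrightarrow> iprod c 0 d"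
    by (rule LIMSEQ_Suc[OF fprod_tendsto[OF assms]])
  have "fprod c 0 d (Suc n) = fps_const (1 - c) * fprod c d d n" for n
    unfolding fprod_def by (subst prod.lessThan_Suc_shift) (simp flip: fps_const_sub)
  then show "(\<lambda>n. fprod c 0 d (Suc n)) \<longlonglongrightarrow> fps_const (1 - c) * iprod c d d"
    using fprod_tendsto[OF assms, of c d] by (auto intro!: tendsto_fps_mult)
qed

abbreviation L :: "'a::field \<Rightarrow> 'a fps" where
  "L c \<equiv> iprod c 1 1"

lemma jacobi_L:
  fixes z :: "'a::field"
  assumes "z \<noteq> 0"
  shows "gf UNIV (\<lambda>m. nat (tri m)) (\<lambda>m. (- z) powi m) = fps_const (1 - z) * (L 1 * L z * L (inverse z))"
  using jacobi_triple_product[of "- z" 0 1] assms iprod_0[of 1 z]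
  by (simp add: jexp_def mult_ac)

lemma cls_1: "cls 1 k = k mod 2"
  using pos_mod_bound[of 2 k] by (auto simp: cls_def)

text \<open>This rotation of the lattice separates the variables of the quadratic form:
  \<open>(a + b - 1)\<^sup>2 + (a - b)\<^sup>2 - 1\<close> equals
  \<open>2 * a * (a - 1) + 2 * b * (b - 1)\<close>. A double sum over pairs of opposite parity
  thereby becomes a product of two simple sums.\<close>

lemma bij_odd_sum:
  "bij_betw (\<lambda>(a, b). (a + b - 1, a - b)) (UNIV \<times> UNIV)
     ({k::int. odd k} \<times> {k. even k} \<union> {k. even k} \<times> {k. odd k})"
proof -
  have *: "(k + l + 1) div 2 + (k - l + 1) div 2 - 1 = k" "(k + l + 1) div 2 - (k - l + 1) div 2 = l"
      "1 + ((k + l) div 2 + (k - l) div 2) = k"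
    if "odd (k + l)" for k l :: int using that by presburger+
  show ?thesis
    by (rule bij_betw_byWitness[where f' = "\<lambda>(k, l). ((k + l + 1) div 2, (k - l + 1) div 2)"])
       (auto simp: *)
qed

text \<open>The left side is a signed sum over pairs of opposite parity. After the rotation
  \<open>bij_odd_sum\<close> it splits into two triple products with arguments \<open>u * v\<close>
  and \<open>u / v\<close>, whose elementary factors combine to
  \<open>(1 - u * v) * (1 - u / v) / u\<close>.\<close>

lemma theta_factor:
  fixes u v :: "'a::field"
  assumes "u \<noteq> 0" "v \<noteq> 0"
  shows "ev (tb 1 1) u * ev (tb 1 0) v - ev (tb 1 0) u * ev (tb 1 1) v =
    fps_const ((u + inverse u) - (v + inverse v)) * (L 1 * L 1) *
    (L (u * v) * L (u * inverse v) * L (inverse u * v) * L (inverse u * inverse v))"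
proof -
  let ?w = "\<lambda>(k, l). nat (texp 1 k) + nat (texp 1 l)"
  let ?c = "\<lambda>(k, l). (if odd k then 1 else - 1) * (u powi k * v powi l)"
  let ?O = "{k::int. odd k}" and ?E = "{k::int. even k}"
  have O: "{k. cls 1 k = 1} = ?O" and E: "{k. cls 1 k = 0} = ?E"
    by (auto simp: cls_1 odd_iff_mod_2_eq_one even_iff_mod_2_eq_zero)
  have ff: "finfib A (\<lambda>k. nat (texp 1 k))" for A by (rule finfib_texp) simp
  have "ev (tb 1 1) u * ev (tb 1 0) v - ev (tb 1 0) u * ev (tb 1 1) v =
      gf (?O \<times> ?E) ?w (\<lambda>(k, l). u powi k * v powi l) + fps_const (- 1) * gf (?E \<times> ?O) ?w (\<lambda>(k, l). u powi k * v powi l)"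
    by (simp add: ev_tb_gf O E gf_mult[OF ff ff] flip: fps_const_neg)
  also have "gf (?O \<times> ?E) ?w (\<lambda>(k, l). u powi k * v powi l) = gf (?O \<times> ?E) ?w ?c"
    by (rule gf_cong) auto
  also have "fps_const (- 1) * gf (?E \<times> ?O) ?w (\<lambda>(k, l). u powi k * v powi l) = gf (?E \<times> ?O) ?w ?c"
    unfolding gf_cmult[symmetric] by (rule gf_cong) auto
  also have "gf (?O \<times> ?E) ?w ?c + gf (?E \<times> ?O) ?w ?c = gf (?O \<times> ?E \<union> ?E \<times> ?O) ?w ?c"
    by (rule gf_union_disjoint[symmetric]) (auto intro: finfib_Times[OF ff ff])
  also have "\<dots> = gf (UNIV \<times> UNIV) (\<lambda>(a, b). nat (tri a) + nat (tri b))
      (\<lambda>(a, b). inverse u * ((- (u * v)) powi a * (- (u * inverse v)) powi b))"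
  proof -
    show ?thesis unfolding gf_reindex[OF bij_odd_sum]
      proof (rule gf_cong; clarify)
        fix a b :: int
        have "4 * (texp 1 (a + b - 1) + texp 1 (a - b)) = 4 * (tri a + tri b)"
        proof -
          \<comment> \<open>The classes of the two exponents are 0 and 1 in some order, so the
            squares subtracted in the two values of \<open>texp\<close> add up to 1.\<close>
          have "((a + b - 1) mod 2)\<^sup>2 + ((a - b) mod 2)\<^sup>2 = 1"
          proof -
            have "(a + b - 1) mod 2 = 0 \<and> (a - b) mod 2 = 1 \<or> (a + b - 1) mod 2 = 1 \<and> (a - b) mod 2 = 0"
              by presburger
            then show ?thesis by auto
          qed
          moreover have "(a + b - 1)\<^sup>2 + (a - b)\<^sup>2 - 1 = 2 * (a * (a - 1)) + 2 * (b * (b - 1))"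
            by (simp add: power2_eq_square algebra_simps)
          ultimately have "4 * (texp 1 (a + b - 1) + texp 1 (a - b)) = 2 * (2 * tri a) + 2 * (2 * tri b)"
            using texp(1)[of 1 "a + b - 1"] texp(1)[of 1 "a - b"] unfolding two_tri cls_1 by simp
          then show ?thesis by simp
        qed
        moreover have "texp 1 k \<ge> 0" for k by (rule texp(2)) simp
        moreover have "tri k \<ge> 0" for k using jexp_ge(2)[of 1 0 k] by (simp add: jexp_def)
        ultimately show "nat (texp 1 (a + b - 1)) + nat (texp 1 (a - b)) = nat (tri a) + nat (tri b)"
          by (simp flip: nat_add_distrib)
        have "(- (u * v)) powi a * (- (u * inverse v)) powi b = (- 1) powi (a + b) * u powi (a + b) * v powi (a - b)"
        proof -
          have "- (u * v) = (- 1) * (u * v)" by simp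
          then have 1: "(- (u * v)) powi a = (- 1) powi a * (u powi a * v powi a)"
            by (simp only: power_int_mult_distrib)
          have "- (u * inverse v) = (- 1) * (u * inverse v)" by simp
          then have 2: "(- (u * inverse v)) powi b = (- 1) powi b * (u powi b * v powi (- b))"
            by (simp only: power_int_mult_distrib power_int_inverse power_int_minus)
          have 3: "(- 1 :: 'a) powi (a + b) = (- 1) powi a * (- 1) powi b"
            "u powi (a + b) = u powi a * u powi b" "v powi (a - b) = v powi a * v powi (- b)"
            using assms by (simp_all add: power_int_add power_int_diff power_int_minus divide_inverse)
          show ?thesis unfolding 1 2 3 by (simp only: mult_ac)
        qed
        moreover have "(- 1 :: 'a) powi (a + b) = (if odd (a + b - 1) then 1 else - 1)"
          by (auto simp: power_int_minus_left)
        moreover have "u powi (a + b - 1) = inverse u * u powi (a + b)"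
          using assms by (simp add: power_int_diff divide_inverse mult.commute)
        ultimately show "(if odd (a + b - 1) then 1 else - 1) * (u powi (a + b - 1) * v powi (a - b)) =
            inverse u * ((- (u * v)) powi a * (- (u * inverse v)) powi b)"
          by simp
      qed
  qed
  also have "\<dots> = fps_const (inverse u) * (gf UNIV (\<lambda>m. nat (tri m)) (\<lambda>m. (- (u * v)) powi m) *
      gf UNIV (\<lambda>m. nat (tri m)) (\<lambda>m. (- (u * inverse v)) powi m))"
  proof -
    have "finfib UNIV (\<lambda>m. nat (tri m))" using finfib_jexp[of 1 0] by (simp add: jexp_def)
    note * = gf_mult[OF this this]
    show ?thesis unfolding * gf_cmult[symmetric] by (rule gf_cong) auto
  qed
  also have "\<dots> = fps_const (inverse u * (1 - u * v) * (1 - u * inverse v)) * (L 1 * L 1) *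
      (L (u * v) * L (u * inverse v) * L (inverse (u * v)) * L (inverse (u * inverse v)))"
    using assms by (simp add: jacobi_L mult_ac flip: fps_const_mult)
  also have "inverse u * (1 - u * v) * (1 - u * inverse v) = (u + inverse u) - (v + inverse v)"
    using assms by (simp add: field_simps)
  also have "inverse (u * v) = inverse u * inverse v" by (simp add: mult.commute)
  also have "inverse (u * inverse v) = inverse u * v" by (simp add: mult.commute)
  finally show ?thesis by (simp only: mult_ac)
qed

definition Kprod :: "nat \<Rightarrow> (nat \<Rightarrow> 'a::field) \<Rightarrow> 'a fps" where
  "Kprod n x = (\<Prod>j<n. \<Prod>i<j. L (x i * x j) * L (x i * inverse (x j)) * L (inverse (x i) * x j) *
                                 L (inverse (x i) * inverse (x j)))"

definition wdiff :: "nat \<Rightarrow> (nat \<Rightarrow> 'a::field) \<Rightarrow> 'a" where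
  "wdiff n x = (\<Prod>j<n. \<Prod>i<j. (x j + inverse (x j)) - (x i + inverse (x i)))"

definition Dmat :: "nat \<Rightarrow> (nat \<Rightarrow> 'a::field) \<Rightarrow> 'a fps mat" where
  "Dmat n x = mat n n (\<lambda>(i, j). ev (tb (int n - 1) (int j)) (x i))"

text \<open>The degree 0 part of the theta determinant. Up to the order of its columns and a factor
  2 for exponent 0 it is the denominator of the character.\<close>

definition D0 :: "nat \<Rightarrow> (nat \<Rightarrow> 'a::field) \<Rightarrow> 'a" where
  "D0 n x = Determinant.det (mat n n (\<lambda>(i, j). ev (tb (int n - 1) (int j)) (x i) $ 0))"

lemma fps_const_prod: "fps_const (\<Prod>i\<in>A. f i) = (\<Prod>i\<in>A. fps_const (f i))"
  by (induction A rule: infinite_finite_induct) (simp_all flip: fps_const_mult)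

lemma fps_nth_0_prod: "(\<Prod>i\<in>A. f i) $ 0 = (\<Prod>i\<in>A. f i $ 0)"
  by (induction A rule: infinite_finite_induct) simp_all

lemma Kprod_nth_0: "Kprod n x $ 0 = 1"
  by (simp add: Kprod_def fps_nth_0_prod iprod_nth_0)

lemma nth_0_hom: "comm_ring_hom (\<lambda>f. f $ 0 :: 'a::comm_ring_1)"
  by unfold_locales auto

lemma fps_const_hom: "comm_ring_hom (fps_const :: 'a::comm_ring_1 \<Rightarrow> _)"
  by unfold_locales (auto simp flip: fps_const_add fps_const_mult)

text \<open>The factorisation \<open>theta_factor\<close> is multiplied over all pairs and compared
  with \<open>theta_vandermonde\<close>. The second claim is the constant coefficient of the first,
  where all infinite products contribute 1.\<close>

lemma Kprod_Dmat:
  fixes x :: "nat \<Rightarrow> 'a::field"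
  assumes "n \<ge> 2" "\<And>i. x i \<noteq> 0"
  shows "fps_const (wdiff n x) * L 1 ^ (n * (n - 1)) * Kprod n x = ofi (mac_const n) * Determinant.det (Dmat n x)"
    and "wdiff n x = of_int (mac_const n $ 0) * D0 n x"
proof -
  have "ofi (mac_const n) * Determinant.det (Dmat n x) =
      (\<Prod>j<n. \<Prod>i<j. fps_const ((x j + inverse (x j)) - (x i + inverse (x i))) * (L 1 * L 1) *
        (L (x i * x j) * L (x i * inverse (x j)) * L (inverse (x i) * x j) * L (inverse (x i) * inverse (x j))))"
    unfolding Dmat_def theta_vandermonde[OF assms, symmetric] theta_factor[OF assms(2) assms(2)]
    by (intro prod.cong refl) (simp only: mult_ac)
  also have "\<dots> = fps_const (wdiff n x) * (\<Prod>j<n. \<Prod>i<j. L 1 * L 1) * Kprod n x"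
    by (simp only: prod.distrib Kprod_def wdiff_def fps_const_prod mult_ac)
  also have "(\<Prod>j<n. \<Prod>i<j. L 1 * L 1) = (L 1 :: 'a fps) ^ (n * (n - 1))"
    using prod_pairs_eq_power[of "\<lambda>_. L 1 :: 'a fps" n] by (simp flip: power_mult add: mult.commute)
  finally show *: "fps_const (wdiff n x) * L 1 ^ (n * (n - 1)) * Kprod n x = ofi (mac_const n) * Determinant.det (Dmat n x)" ..
  interpret nth0: comm_ring_hom "\<lambda>f. f $ 0 :: 'a" by (rule nth_0_hom)
  have "Determinant.det (Dmat n x) $ 0 = D0 n x"
    unfolding D0_def nth0.hom_det[symmetric] by (intro arg_cong[of _ _ Determinant.det] eq_matI) (auto simp: Dmat_def)
  moreover have "(L 1 ^ (n * (n - 1)) :: 'a fps) $ 0 = 1"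
    by (simp add: fps_power_zeroth iprod_nth_0)
  ultimately show "wdiff n x = of_int (mac_const n $ 0) * D0 n x"
    using arg_cong[OF *, of "\<lambda>f. f $ 0"] by (simp add: Kprod_nth_0)
qed

section \<open>Infinite products at roots of unity\<close>

lemma iprod_split:
  fixes c :: "'a::field"
  assumes "d > 0" "m > 0"
  shows "(\<Prod>i<m. iprod c (s + d * i) (d * m)) = iprod c s d"
proof (rule LIMSEQ_unique)
  have "(\<Prod>i<m. fprod c (s + d * i) (d * m) n) = fprod c s d (m * n)" for n
  proof (induction n)
    case 0
    then show ?case by (simp add: fprod_def)
  next
    case (Suc n)
    have "fprod c s d (m * Suc n) = fprod c s d (m * n + m)" by (simp add: add.commute)
    also have "\<dots> = fprod c s d (m * n) * (\<Prod>i<m. 1 - fps_const c * fps_X ^ (s + d * (m * n + i)))"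
      unfolding fprod_def by (rule prod_lessThan_add)
    also have "\<dots> = (\<Prod>i<m. fprod c (s + d * i) (d * m) n) * (\<Prod>i<m. 1 - fps_const c * fps_X ^ (s + d * i + d * m * n))"
      unfolding Suc.IH by (simp add: algebra_simps)
    also have "\<dots> = (\<Prod>i<m. fprod c (s + d * i) (d * m) (Suc n))"
      unfolding prod.distrib[symmetric] by (simp add: fprod_def)
    finally show ?case ..
  qed
  moreover have "(\<lambda>n. \<Prod>i<m. fprod c (s + d * i) (d * m) n) \<longlonglongrightarrow> (\<Prod>i<m. iprod c (s + d * i) (d * m))"
    by (intro tendsto_fps_prod fprod_tendsto) (use assms in simp)
  ultimately show "(\<lambda>n. fprod c s d (m * n)) \<longlonglongrightarrow> (\<Prod>i<m. iprod c (s + d * i) (d * m))"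
    by simp
  have "filterlim (\<lambda>n. m * n) at_top sequentially"
    by (rule filterlim_at_top_mono[OF filterlim_ident]) (use assms in auto)
  then show "(\<lambda>n. fprod c s d (m * n)) \<longlonglongrightarrow> iprod c s d"
    by (rule filterlim_compose[OF fprod_tendsto[OF assms(1)]])
qed

text \<open>For a primitive \<open>m\<close>-th root of unity the q-factorial of \<open>m\<close>
  vanishes while those of all smaller numbers do not.\<close>

lemma qbin_root_of_unity:
  fixes q :: "'a::idom"
  assumes "q ^ m = 1" "\<And>k. 0 < k \<Longrightarrow> k < m \<Longrightarrow> q ^ k \<noteq> 1" "0 < k" "k < m"
  shows "qbin q m k = 0"
proof -
  have nz: "qfact q i \<noteq> 0" if "i < m" for i
    unfolding qfact_def using assms(2)[of "Suc _"] that by (auto simp: prod_zero_iff dest: sym)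
  have "qfact q m = 0"
  proof -
    obtain m' where "m = Suc m'" using assms(4) by (cases m) auto
    then show ?thesis using assms(1) by (simp add: qfact_Suc del: power_Suc)
  qed
  then have "qbin q m k * qfact q k * qfact q (m - k) = 0"
    using qbin_qfact[of q "m - k" k] assms by simp
  then show ?thesis using nz[of k] nz[of "m - k"] assms by simp
qed

text \<open>Only the first and last terms of the q-binomial theorem survive. The coefficient of the
  last one follows from \<open>z = 1\<close>, where the product contains the factor 0.\<close>

lemma prod_root_of_unity:
  fixes q z :: "'a::idom"
  assumes "q ^ m = 1" "\<And>k. 0 < k \<Longrightarrow> k < m \<Longrightarrow> q ^ k \<noteq> 1" "m > 0"
  shows "(\<Prod>k<m. 1 - z * q ^ k) = 1 - z ^ m"
proof -
  have *: "(\<Prod>k<m. 1 - z * q ^ k) = 1 + q ^ (m choose 2) * (- z) ^ m" for z :: 'a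
  proof -
    have "(\<Prod>k<m. 1 - z * q ^ k) = (\<Sum>k\<le>m. q ^ (k choose 2) * qbin q m k * (- z) ^ k)"
      using qbinomial_theorem[of 1 "- z" q m] by simp
    also have "\<dots> = (\<Sum>k\<in>{0, m}. q ^ (k choose 2) * qbin q m k * (- z) ^ k)"
    proof (rule sum.mono_neutral_right)
      show "\<forall>k\<in>{..m} - {0, m}. q ^ (k choose 2) * qbin q m k * (- z) ^ k = 0"
      proof
        fix k assume "k \<in> {..m} - {0, m}"
        then have "0 < k" "k < m" by auto
        then have "qbin q m k = 0" using qbin_root_of_unity assms(1,2) by blast
        then show "q ^ (k choose 2) * qbin q m k * (- z) ^ k = 0" by simp
      qed
    qed auto
    also have "\<dots> = 1 + q ^ (m choose 2) * (- z) ^ m"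
      using assms(3) by (simp add: qbin_self numeral_2_eq_2)
    finally show ?thesis .
  qed
  have "(\<Prod>k<m. 1 - 1 * q ^ k) = 0"
    by (rule prod_zero) (use assms(3) in \<open>auto intro!: bexI[of _ 0]\<close>)
  then have "1 + q ^ (m choose 2) * (- 1) ^ m = 0"
    unfolding * .
  then have top: "q ^ (m choose 2) * (- 1) ^ m = - 1"
    by (metis add.commute eq_neg_iff_add_eq_0)
  have "q ^ (m choose 2) * (- z) ^ m = (q ^ (m choose 2) * (- 1) ^ m) * z ^ m"
    by (subst power_minus) (simp only: mult.assoc)
  then have "q ^ (m choose 2) * (- z) ^ m = - (z ^ m)"
    unfolding top by simp
  then show ?thesis by (simp add: *)
qed

lemma iprod_root_of_unity:
  fixes q c :: "'a::field"
  assumes "q ^ m = 1" "\<And>k. 0 < k \<Longrightarrow> k < m \<Longrightarrow> q ^ k \<noteq> 1" "m > 0"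
  shows "(\<Prod>k<m. L (c * q ^ k)) = iprod (c ^ m) m m"
proof (rule LIMSEQ_unique)
  show "(\<lambda>n. \<Prod>k<m. fprod (c * q ^ k) 1 1 n) \<longlonglongrightarrow> (\<Prod>k<m. L (c * q ^ k))"
    by (intro tendsto_fps_prod fprod_tendsto) simp
  have "(\<Prod>k<m. fprod (c * q ^ k) 1 1 n) = fprod (c ^ m) m m n" for n
  proof -
    have q: "fps_const q ^ m = 1" "\<And>k. 0 < k \<Longrightarrow> k < m \<Longrightarrow> fps_const q ^ k \<noteq> 1"
    proof -
      show "fps_const q ^ m = 1" using assms(1) by (simp add: fps_const_power)
      fix k assume "0 < k" "k < m"
      then show "fps_const q ^ k \<noteq> 1"
        using assms(2)[of k] arg_cong[of "fps_const q ^ k" 1 "\<lambda>f. f $ 0"] by (auto simp: fps_const_power)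
    qed
    have "(\<Prod>k<m. fprod (c * q ^ k) 1 1 n) = (\<Prod>j<n. \<Prod>k<m. 1 - fps_const (c * q ^ k) * fps_X ^ (1 + 1 * j))"
      unfolding fprod_def by (rule prod.swap)
    also have "\<dots> = (\<Prod>j<n. \<Prod>k<m. 1 - fps_const c * fps_X ^ Suc j * fps_const q ^ k)"
      by (intro prod.cong refl) (simp add: fps_const_power mult_ac flip: fps_const_mult)
    also have "\<dots> = (\<Prod>j<n. 1 - (fps_const c * fps_X ^ Suc j) ^ m)"
      by (intro prod.cong refl prod_root_of_unity q assms)
    also have "\<dots> = fprod (c ^ m) m m n"
      unfolding fprod_def
      by (intro prod.cong refl) (simp add: power_mult_distrib fps_const_power algebra_simps flip: power_mult power_Suc)
    finally show ?thesis .
  qed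
  then show "(\<lambda>n. \<Prod>k<m. fprod (c * q ^ k) 1 1 n) \<longlonglongrightarrow> iprod (c ^ m) m m"
    using fprod_tendsto[OF assms(3)] by simp
qed

lemma iprod_square:
  assumes "d > 0"
  shows "iprod 1 (2 * d) (2 * d) = iprod 1 d d * iprod (- 1 :: 'a::field) d d"
proof (rule LIMSEQ_unique)
  show "fprod 1 (2 * d) (2 * d) \<longlonglongrightarrow> (iprod 1 (2 * d) (2 * d) :: 'a fps)"
    using assms by (intro fprod_tendsto) simp
  have "fprod 1 (2 * d) (2 * d) n = fprod 1 d d n * fprod (- 1 :: 'a) d d n" for n
    unfolding fprod_def prod.distrib[symmetric]
    by (intro prod.cong refl)
       (simp add: algebra_simps power_add[symmetric] mult_2 flip: fps_const_neg)
  then have "fprod 1 (2 * d) (2 * d) = (\<lambda>n. fprod 1 d d n * fprod (- 1 :: 'a) d d n)" by auto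
  then show "fprod 1 (2 * d) (2 * d) \<longlonglongrightarrow> iprod 1 d d * iprod (- 1 :: 'a) d d"
    using assms by (auto intro!: tendsto_fps_mult fprod_tendsto)
qed

text \<open>Trades the product over pairs for a product over a full square, whose rows run through
  complete sets of roots of unity. The price is a square root.\<close>

lemma prod_square_symmetric:
  fixes F :: "nat \<Rightarrow> nat \<Rightarrow> 'a::comm_ring_1"
  assumes "\<And>i j. F i j = F j i"
  shows "(\<Prod>i<n. \<Prod>j<n. F i j) = (\<Prod>j<n. \<Prod>i<j. F i j)\<^sup>2 * (\<Prod>i<n. F i i)"
proof (induction n)
  case (Suc n)
  have "(\<Prod>j<n. F n j) = (\<Prod>j<n. F j n)" by (intro prod.cong refl assms)
  then show ?case using Suc by (simp add: prod.distrib power2_eq_square mult_ac)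
qed simp

text \<open>The numbers \<open>q^j\<close> and their inverses, for \<open>j \<le> h\<close>, run
  through all \<open>2h\<close>-th roots of unity once, except that \<open>q^0\<close> and
  \<open>q^h\<close> occur twice. These two give the extra factors on the right.\<close>

lemma prod_L_root:
  fixes q c :: "'a::field"
  assumes q: "q ^ (2 * h) = 1" "\<And>k. 0 < k \<Longrightarrow> k < 2 * h \<Longrightarrow> q ^ k \<noteq> 1" and h: "h > 0" and c: "c ^ (2 * h) = 1"
  shows "(\<Prod>j<Suc h. L (c * q ^ j) * L (c * inverse (q ^ j))) = iprod 1 (2 * h) (2 * h) * (L c * L (c * q ^ h))"
proof -
  have q0: "q \<noteq> 0" using q(1) h by (cases "q = 0") (auto simp: power_0_left)
  have inv: "inverse (q ^ j) = q ^ (2 * h - j)" if "j \<le> 2 * h" for j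
  proof -
    have "q ^ (2 * h - j) * q ^ j = 1" using q(1) that by (simp flip: power_add)
    then show ?thesis using q0 by (simp add: field_simps)
  qed
  have "(\<Prod>j<Suc h. L (c * inverse (q ^ j))) = L c * (\<Prod>j<h. L (c * inverse (q ^ Suc j)))"
    by (subst prod.lessThan_Suc_shift) simp
  also have "(\<Prod>j<h. L (c * inverse (q ^ Suc j))) = (\<Prod>j<h. L (c * q ^ (h + j)))"
  proof -
    have "(\<Prod>j<h. L (c * inverse (q ^ Suc j))) = (\<Prod>j<h. L (c * q ^ (h + (h - Suc j))))"
    proof (intro prod.cong refl)
      fix j assume "j \<in> {..<h}"
      then have "Suc j \<le> 2 * h" "2 * h - Suc j = h + (h - Suc j)" by auto
      then show "L (c * inverse (q ^ Suc j)) = L (c * q ^ (h + (h - Suc j)))"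
        using inv[of "Suc j"] by (simp only:)
    qed
    then show ?thesis by (simp only: prod.nat_diff_reindex[of "\<lambda>j. L (c * q ^ (h + j))"])
  qed
  finally have "(\<Prod>j<Suc h. L (c * q ^ j) * L (c * inverse (q ^ j))) =
      L (c * q ^ h) * L c * ((\<Prod>j<h. L (c * q ^ j)) * (\<Prod>j<h. L (c * q ^ (h + j))))"
    by (simp add: prod.distrib mult_ac)
  also have "(\<Prod>j<h. L (c * q ^ j)) * (\<Prod>j<h. L (c * q ^ (h + j))) = (\<Prod>j<2 * h. L (c * q ^ j))"
    unfolding mult_2 prod_lessThan_add ..
  also have "\<dots> = iprod 1 (2 * h) (2 * h)"
    using iprod_root_of_unity[of q "2 * h" c] q h c by simp
  finally show ?thesis by (simp only: mult_ac)
qed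

text \<open>The product over the full square is evaluated row by row with
  \<open>prod_L_root\<close>, once for \<open>x i\<close> and once for its inverse. Dividing by the
  diagonal leaves the square of the wanted product.\<close>

lemma Kprod_root:
  fixes q :: "'a::field_char_0"
  assumes q: "q ^ (2 * h) = 1" "\<And>k. 0 < k \<Longrightarrow> k < 2 * h \<Longrightarrow> q ^ k \<noteq> 1" and h: "h > 0"
  shows "Kprod (Suc h) (\<lambda>i. q ^ i) * L 1 ^ Suc h =
           iprod 1 (2 * h) (2 * h) ^ Suc h * (iprod (- 1) h h * L (- 1))"
proof -
  let ?n = "Suc h"
  define x where "x i = q ^ i" for i :: nat
  define W where "W = iprod (1 :: 'a) (2 * h) (2 * h)"
  define V where "V = iprod (1 :: 'a) h h"
  define V' where "V' = iprod (- 1 :: 'a) h h"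
  define F where "F i j = L (x i * x j) * L (x i * inverse (x j)) * L (inverse (x i) * x j) * L (inverse (x i) * inverse (x j))" for i j
  have q0: "q \<noteq> 0" using q(1) h by (cases "q = 0") (auto simp: power_0_left)
  have qh: "q ^ h = - 1"
  proof -
    have "(q ^ h)\<^sup>2 = 1" using q(1) by (simp add: power_mult[symmetric] mult.commute)
    moreover have "q ^ h \<noteq> 1" using q(2)[of h] h by simp
    ultimately show ?thesis by (simp add: power2_eq_1_iff)
  qed
  have xN: "x i ^ (2 * h) = 1" "inverse (x i) ^ (2 * h) = 1" for i
  proof -
    have "x i ^ (2 * h) = (q ^ (2 * h)) ^ i" unfolding x_def by (simp only: power_mult[symmetric] mult.commute)
    then show "x i ^ (2 * h) = 1" using q(1) by simp
    then show "inverse (x i) ^ (2 * h) = 1" by (simp add: power_inverse)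
  qed
  have K: "Kprod ?n (\<lambda>i. q ^ i) = (\<Prod>j<?n. \<Prod>i<j. F i j)"
    unfolding Kprod_def F_def x_def ..
  have pl: "(\<Prod>j<?n. L (c * x j) * L (c * inverse (x j))) = W * (L c * L (c * q ^ h))" if "c ^ (2 * h) = 1" for c
    unfolding x_def W_def by (rule prod_L_root[OF q h that])
  have "(\<Prod>i<?n. \<Prod>j<?n. F i j) =
      (\<Prod>i<?n. (\<Prod>j<?n. L (x i * x j) * L (x i * inverse (x j))) *
              (\<Prod>j<?n. L (inverse (x i) * x j) * L (inverse (x i) * inverse (x j))))"
    unfolding prod.distrib[symmetric] F_def by (intro prod.cong refl) (simp only: mult_ac)
  also have "\<dots> = (\<Prod>i<?n. (W * W) * ((L (1 * x i) * L (1 * inverse (x i))) * (L (q ^ h * x i) * L (q ^ h * inverse (x i)))))"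
    unfolding pl[OF xN(1)] pl[OF xN(2)] by (intro prod.cong refl) (simp add: mult_ac)
  also have "\<dots> = (\<Prod>i<?n. W * W) * ((\<Prod>i<?n. L (1 * x i) * L (1 * inverse (x i))) * (\<Prod>i<?n. L (q ^ h * x i) * L (q ^ h * inverse (x i))))"
    by (simp only: prod.distrib)
  also have "\<dots> = (W * W) ^ ?n * ((W * (L 1 * L (- 1))) * (W * (L (- 1) * L 1)))"
  proof -
    have 1: "(\<Prod>i<?n. L (1 * x i) * L (1 * inverse (x i))) = W * (L 1 * L (- 1))"
      using pl[of 1] by (simp only: qh power_one mult_1)
    have 2: "(\<Prod>i<?n. L (q ^ h * x i) * L (q ^ h * inverse (x i))) = W * (L (- 1) * L 1)"
      using pl[of "q ^ h"] xN(1)[of h] by (simp only: qh x_def) simp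
    show ?thesis unfolding 1 2 by (simp only: prod_constant card_lessThan)
  qed
  finally have A: "(\<Prod>i<?n. \<Prod>j<?n. F i j) = (W ^ Suc ?n * L (- 1) * L 1)\<^sup>2"
    by (simp add: power2_eq_square power_mult_distrib mult_ac)
  \<comment> \<open>The even powers \<open>r^(2i)\<close> for \<open>i \<le> h\<close> run through
    the \<open>h\<close>-th roots of unity once, and through 1 a second time.\<close>
  have half: "(\<Prod>i<?n. L (r ^ (2 * i))) = V * L 1"
    if "r ^ (2 * h) = 1" "\<And>k. 0 < k \<Longrightarrow> k < 2 * h \<Longrightarrow> r ^ k \<noteq> 1" for r :: 'a
  proof -
    have "(\<Prod>k<h. L (1 * (r\<^sup>2) ^ k)) = iprod (1 ^ h) h h"
      by (rule iprod_root_of_unity) (use that h in \<open>auto simp flip: power_mult\<close>)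
    then show ?thesis using that(1) by (simp add: V_def power_mult)
  qed
  have "(\<Prod>i<?n. F i i) = (\<Prod>i<?n. (L 1 * L 1) * (L (q ^ (2 * i)) * L (inverse q ^ (2 * i))))"
  proof (intro prod.cong refl)
    fix i
    have "x i * x i = q ^ (2 * i)" "inverse (x i) * inverse (x i) = inverse q ^ (2 * i)"
      "x i * inverse (x i) = 1" "inverse (x i) * x i = 1"
      using q0 by (simp_all add: x_def mult_2 power_add power_inverse)
    then show "F i i = (L 1 * L 1) * (L (q ^ (2 * i)) * L (inverse q ^ (2 * i)))"
      unfolding F_def by (simp only: mult_ac)
  qed
  also have "\<dots> = (L 1 * L 1) ^ ?n * ((V * L 1) * (V * L 1))"
  proof -
    have 1: "(\<Prod>i<?n. L (q ^ (2 * i))) = V * L 1" by (rule half[OF q])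
    have 2: "(\<Prod>i<?n. L (inverse q ^ (2 * i))) = V * L 1"
      by (rule half) (use q in \<open>simp_all add: power_inverse\<close>)
    show ?thesis unfolding prod.distrib 1 2 by (simp only: prod_constant card_lessThan power_mult_distrib)
  qed
  finally have B: "(\<Prod>i<?n. F i i) = (L 1 ^ ?n * V * L 1)\<^sup>2"
    by (simp add: power2_eq_square power_mult_distrib mult_ac)
  have "(\<Prod>i<?n. \<Prod>j<?n. F i j) = (\<Prod>j<?n. \<Prod>i<j. F i j)\<^sup>2 * (\<Prod>i<?n. F i i)"
    by (rule prod_square_symmetric) (simp add: F_def mult_ac)
  then have "(W ^ Suc ?n * L (- 1))\<^sup>2 * (L 1)\<^sup>2 = (Kprod ?n (\<lambda>i. q ^ i) * L 1 ^ ?n * V)\<^sup>2 * (L 1)\<^sup>2"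
    unfolding A B K by (simp add: power_mult_distrib mult_ac)
  then have "(W ^ Suc ?n * L (- 1))\<^sup>2 = (Kprod ?n (\<lambda>i. q ^ i) * L 1 ^ ?n * V)\<^sup>2"
    using iprod_nonzero[of 1 "1 :: 'a" 1] by simp
  then have "W ^ Suc ?n * L (- 1) = Kprod ?n (\<lambda>i. q ^ i) * L 1 ^ ?n * V \<or>
             W ^ Suc ?n * L (- 1) = - (Kprod ?n (\<lambda>i. q ^ i) * L 1 ^ ?n * V)"
    by (simp only: power2_eq_iff)
  \<comment> \<open>The constant coefficients are 1 and -1, which differ in characteristic zero;
    this excludes the negative square root.\<close>
  moreover have "(W ^ Suc ?n * L (- 1)) $ 0 \<noteq> (- (Kprod ?n (\<lambda>i. q ^ i) * L 1 ^ ?n * V)) $ 0"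
    using h by (simp add: fps_power_zeroth Kprod_nth_0 iprod_nth_0 W_def V_def)
  ultimately have "W ^ Suc ?n * L (- 1) = Kprod ?n (\<lambda>i. q ^ i) * L 1 ^ ?n * V"
    by metis
  then have "(W ^ ?n * (V' * L (- 1))) * V = Kprod ?n (\<lambda>i. q ^ i) * L 1 ^ ?n * V"
    using iprod_square[OF h, where ?'a = 'a] by (simp add: W_def V_def V'_def mult_ac)
  moreover have "V \<noteq> 0" unfolding V_def by (rule iprod_nonzero[OF h])
  ultimately show ?thesis by (simp add: W_def V'_def)
qed

text \<open>The factor \<open>1/2\<close> occurs because the exponents \<open>h\<close> and \<open>-h\<close> are congruent modulo \<open>2h\<close>.\<close>

definition gpart :: "nat \<Rightarrow> nat \<Rightarrow> 'a::field fps" where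
  "gpart h j = fps_const (if j = h then 1 / 2 else 1) * gf UNIV (\<lambda>m. nat (jexp (2 * h) (h + j) m)) (\<lambda>_. 1)"

text \<open>As \<open>x^k\<close> depends only on \<open>k\<close> modulo \<open>2h\<close>, the
  progressions through \<open>j\<close> and \<open>- j\<close> both contribute a constant multiple
  of one and the same series in \<open>X\<close>.\<close>

lemma ev_tb_root:
  fixes x :: "'a::field_char_0"
  assumes "h > 0" "j \<le> h" "x ^ (2 * h) = 1"
  shows "ev (tb (int h) (int j)) x = gpart h j * fps_const (ev (tb (int h) (int j)) x $ 0)"
proof -
  define H where "H = int h"
  have H: "H > 0" using assms by (simp add: H_def)
  have x0: "x \<noteq> 0" using assms by (cases "x = 0") (auto simp: power_0_left)
  let ?G = "gf UNIV (\<lambda>m. nat (jexp (2 * h) (h + j) m)) (\<lambda>_. 1) :: 'a fps"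
  let ?P = "\<lambda>s. range (\<lambda>m. s + 2 * H * m)"
  have clsj: "cls H (int j) = int j" using assms H by (intro cls_id) (auto simp: H_def)
  have xp: "x powi (s + 2 * H * m) = x powi s" for s m
  proof -
    have "x powi (2 * H) = x powi int (2 * h)" by (simp add: H_def)
    also have "\<dots> = 1" using assms(3) by (simp only: power_int_of_nat)
    finally have 1: "x powi (2 * H) = 1" .
    have "x powi (s + 2 * H * m) = x powi s * x powi (2 * H * m)"
      by (rule power_int_add) (use x0 in simp)
    also have "x powi (2 * H * m) = (x powi (2 * H)) powi m" by (rule power_int_mult)
    finally show ?thesis unfolding 1 by simp
  qed
  \<comment> \<open>Both sides equal \<open>h * m\<^sup>2 + j * m\<close>; this is the origin of the
    parameters \<open>2h\<close> and \<open>h + j\<close> in \<open>gpart\<close>.\<close>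
  have tx: "texp H (int j + 2 * H * m) = jexp (2 * h) (h + j) m" for m
  proof -
    have "2 * (4 * H * texp H (int j + 2 * H * m)) = 4 * H * (2 * jexp (2 * h) (h + j) m)"
      unfolding texp(1)[OF H, symmetric] cls_add clsj two_jexp
      by (simp add: H_def power2_eq_square algebra_simps)
    then show ?thesis using H by simp
  qed
  have gP: "gf (?P (int j)) (\<lambda>k. nat (texp H k)) (\<lambda>k. x powi k) = fps_const (x powi int j) * ?G"
  proof -
    have "bij_betw (\<lambda>m. int j + 2 * H * m) UNIV (?P (int j))"
      using H by (auto simp: bij_betw_def inj_on_def)
    note * = gf_reindex[OF this]
    show ?thesis unfolding * tx xp gf_cmult[symmetric] by simp
  qed
  have gM: "gf (?P (- int j)) (\<lambda>k. nat (texp H k)) (\<lambda>k. x powi k) = fps_const (x powi (- int j)) * ?G"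
  proof -
    have "bij_betw (\<lambda>m. - (int j + 2 * H * m)) UNIV (?P (- int j))"
    proof (rule bij_betwI')
      show "\<exists>m\<in>UNIV. k = - (int j + 2 * H * m)" if k: "k \<in> ?P (- int j)" for k
      proof -
        obtain m where "k = - int j + 2 * H * m" using k unfolding image_iff by blast
        then have "k = - (int j + 2 * H * (- m))" by simp
        then show ?thesis by blast
      qed
      show "- (int j + 2 * H * m) \<in> ?P (- int j)" for m
        by (rule image_eqI[of _ _ "- m"]) auto
    qed (use H in auto)
    note * = gf_reindex[OF this]
    have "x powi (- (int j + 2 * H * m)) = x powi (- int j)" for m
      using xp[of "- int j" "- m"] by simp
    then show ?thesis unfolding * texp_uminus[OF H] tx gf_cmult[symmetric] by simp
  qed
  have set: "{k. cls H k = int j} = ?P (int j) \<union> ?P (- int j)"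
  proof (intro equalityI subsetI)
    fix k assume "k \<in> {k. cls H k = int j}"
    then show "k \<in> ?P (int j) \<union> ?P (- int j)"
      by (cases rule: cls_cases[OF H, of k]) auto
  next
    fix k assume "k \<in> ?P (int j) \<union> ?P (- int j)"
    then obtain m where "k = int j + 2 * H * m \<or> k = - int j + 2 * H * m" by blast
    then have "cls H k = int j" by (elim disjE) (simp_all only: cls_add cls_uminus[OF H] clsj)
    then show "k \<in> {k. cls H k = int j}" by simp
  qed
  have ff: "finfib A (\<lambda>k. nat (texp H k))" for A by (rule finfib_texp[OF H])
  have z: "ev (tb H (int j)) x $ 0 = (if j = 0 then 1 else x powi int j + x powi (- int j))"
    using ev_tb_nth_0[OF H, of "int j" x] assms by (simp add: H_def)
  consider "j = 0" | "j = h" | "0 < j" "j < h" using assms by linarith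
  then have "ev (tb H (int j)) x = gpart h j * fps_const (ev (tb H (int j)) x $ 0)"
  proof cases
    case 1
    then have "{k. cls H k = int j} = ?P (int j)" unfolding set by auto
    then have "ev (tb H (int j)) x = fps_const (x powi int j) * ?G" by (simp add: ev_tb_gf[OF H] gP)
    then show ?thesis unfolding z using 1 assms(1) by (simp add: gpart_def)
  next
    case 2
    have "?P (- int j) \<subseteq> ?P (int j)"
    proof
      fix k assume "k \<in> ?P (- int j)"
      then obtain m where "k = - int j + 2 * H * m" by auto
      then have "k = int j + 2 * H * (m - 1)" using 2 by (simp add: H_def algebra_simps)
      then show "k \<in> ?P (int j)" by blast
    qed
    then have "{k. cls H k = int j} = ?P (int j)" unfolding set by blast
    then have *: "ev (tb H (int j)) x = fps_const (x powi int j) * ?G" by (simp add: ev_tb_gf[OF H] gP)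
    have "x powi (- int j) = x powi int j" using xp[of "- int j" 1] 2 by (simp add: H_def)
    then have "(1 / 2) * (x powi int j + x powi (- int j)) = x powi int j" by simp
    then have "fps_const (1 / 2) * fps_const (x powi int j + x powi (- int j)) = fps_const (x powi int j)"
      by (simp only: fps_const_mult)
    then show ?thesis unfolding * gpart_def using z assms(1) 2 * by (simp add: mult_ac del: fps_const_mult fps_const_add)
  next
    case 3
    have disj: "?P (int j) \<inter> ?P (- int j) = {}"
    proof (rule ccontr)
      assume "?P (int j) \<inter> ?P (- int j) \<noteq> {}"
      then obtain a b where "int j + 2 * H * a = - int j + 2 * H * b" by auto
      then have "int j = H * (b - a)" by (simp add: algebra_simps)
      then have "H dvd int j" by simp
      then show False using 3 zdvd_imp_le[of H "int j"] by (simp add: H_def)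
    qed
    have "ev (tb H (int j)) x = fps_const (x powi int j) * ?G + fps_const (x powi (- int j)) * ?G"
      unfolding ev_tb_gf[OF H] set gf_union_disjoint[OF ff ff disj] gP gM ..
    then show ?thesis unfolding z using 3 by (simp add: gpart_def algebra_simps flip: fps_const_add)
  qed
  then show ?thesis by (simp add: H_def)
qed

text \<open>By the triple product each factor is \<open>W * Y (h + j) * Y (h - j)\<close>. The value
  \<open>Y 0\<close> is twice \<open>Y (2h)\<close>, which absorbs the factor \<open>1/2\<close>.
  The arguments then exhaust \<open>1..2h\<close> once, giving \<open>L (- 1)\<close>, with
  \<open>h\<close> and \<open>2h\<close> left over, giving \<open>iprod (- 1) h h\<close>.\<close>

lemma prod_gpart:
  assumes h: "h > 0"
  shows "(\<Prod>j<Suc h. gpart h j) =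
           iprod 1 (2 * h) (2 * h) ^ Suc h * (iprod (- 1) h h * L (- 1 :: 'a::field_char_0))"
proof -
  let ?N = "2 * h"
  define W where "W = iprod (1 :: 'a) ?N ?N"
  define Y where "Y s = iprod (- 1 :: 'a) s ?N" for s
  have N: "?N > 0" using h by simp
  have gf: "gf UNIV (\<lambda>m. nat (jexp ?N (h + j) m)) (\<lambda>_. 1) = W * (Y (h + j) * Y (h - j))" if "j \<le> h" for j
    using jacobi_triple_product[of "1 :: 'a" "h + j" ?N] that h by (simp add: W_def Y_def mult_2)
  have "(\<Prod>j<h. gpart h j) = (\<Prod>j<h. W * (Y (h + j) * Y (h - j)))"
    by (intro prod.cong refl) (simp add: gpart_def gf)
  also have "\<dots> = W ^ h * ((\<Prod>j<h. Y (h + j)) * (\<Prod>j<h. Y (h - j)))"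
    by (simp add: prod.distrib)
  also have "(\<Prod>j<h. Y (h - j)) = (\<Prod>j<h. Y (1 + j))"
  proof -
    have "(\<Prod>j<h. Y (h - j)) = (\<Prod>j<h. Y (1 + (h - Suc j)))"
      by (intro prod.cong refl) (auto intro: arg_cong[of _ _ Y])
    then show ?thesis by (simp only: prod.nat_diff_reindex[of "\<lambda>j. Y (1 + j)"])
  qed
  finally have 1: "(\<Prod>j<h. gpart h j) = W ^ h * ((\<Prod>j<h. Y (h + j)) * (\<Prod>j<h. Y (1 + j)))" .
  have "Y 0 = fps_const 2 * Y ?N"
    using iprod_0[OF N, of "- 1 :: 'a"] by (simp add: Y_def)
  moreover have "gpart h h = fps_const (1 / 2) * (W * (Y ?N * Y 0))"
    unfolding gpart_def gf[OF order_refl] by (simp add: mult_2)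
  ultimately have "gpart h h = (fps_const (1 / 2) * fps_const 2) * (W * (Y ?N * Y ?N))"
    by (simp only: mult_ac)
  then have 2: "gpart h h = W * (Y ?N * Y ?N)" by simp
  have 3: "(\<Prod>j<h. Y (h + j)) * Y ?N = Y h * (\<Prod>j<h. Y (1 + (h + j)))"
  proof -
    have "(\<Prod>j<h. Y (h + j)) * Y ?N = (\<Prod>j<Suc h. Y (h + j))" by (simp add: mult_2)
    also have "\<dots> = Y h * (\<Prod>j<h. Y (1 + (h + j)))"
      by (subst prod.lessThan_Suc_shift) simp
    finally show ?thesis .
  qed
  have 4: "(\<Prod>j<h. Y (1 + j)) * (\<Prod>j<h. Y (1 + (h + j))) = L (- 1)"
  proof -
    have "(\<Prod>j<h. Y (1 + j)) * (\<Prod>j<h. Y (1 + (h + j))) = (\<Prod>j<h + h. Y (1 + j))"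
      by (rule prod_lessThan_add[symmetric])
    also have "\<dots> = (\<Prod>j<?N. iprod (- 1) (1 + 1 * j) (1 * ?N))"
      by (simp add: Y_def mult_2)
    also have "\<dots> = L (- 1)" by (rule iprod_split) (use h in auto)
    finally show ?thesis .
  qed
  have 5: "Y h * Y ?N = iprod (- 1) h h"
    using iprod_split[of h 2 "- 1 :: 'a" h] h by (simp add: Y_def numeral_2_eq_2 lessThan_Suc mult.commute)
  have "(\<Prod>j<Suc h. gpart h j) = W ^ Suc h * (((\<Prod>j<h. Y (h + j)) * Y ?N) * (\<Prod>j<h. Y (1 + j)) * Y ?N)"
    by (simp add: 1 2 mult_ac)
  also have "\<dots> = W ^ Suc h * ((Y h * Y ?N) * ((\<Prod>j<h. Y (1 + j)) * (\<Prod>j<h. Y (1 + (h + j)))))"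
    unfolding 3 by (simp only: mult_ac)
  finally show ?thesis unfolding 4 5 W_def .
qed

lemma ofi_iprod: "ofi (iprod c s d) = iprod (of_int c :: 'a::comm_ring_1) s d"
proof -
  interpret ofi: comm_ring_hom "ofi :: int fps \<Rightarrow> 'a fps" by (rule ofi_hom)
  have X: "ofi (1 - fps_const c * fps_X ^ k) = 1 - fps_const (of_int c :: 'a) * fps_X ^ k" for k
    by (auto simp: fps_eq_iff fps_one_nth)
  have "ofi (fprod c s d n) = fprod (of_int c :: 'a) s d n" for n
    unfolding fprod_def by (simp only: ofi.hom_prod X)
  then have "of_int (fprod c s d n $ m) = fprod (of_int c :: 'a) s d n $ m" for n m
    by (metis ofi_nth)
  then show ?thesis
    by (simp add: fps_eq_iff iprod_def)
qed

lemma ofi_inj: "(ofi a :: 'a::{comm_ring_1, ring_char_0} fps) = ofi b \<Longrightarrow> a = b"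
  by (simp add: fps_eq_iff)

section \<open>Determination of the constant\<close>

lemma exists_complex_root:
  assumes "N > 0"
  obtains q :: complex where "q ^ N = 1" "\<And>k. 0 < k \<Longrightarrow> k < N \<Longrightarrow> q ^ k \<noteq> 1"
proof
  define a where "a = 2 * pi / real N"
  have p: "cis a ^ k = cis (real k * a)" for k by (rule Complex.DeMoivre)
  have Na: "real N * a = 2 * pi" using assms by (simp add: a_def)
  show "cis a ^ N = 1" unfolding p Na by simp
  fix k assume k: "0 < k" "k < N"
  show "cis a ^ k \<noteq> 1"
  proof
    assume "cis a ^ k = 1"
    then have "cos (real k * a) = 1"
      unfolding p by (simp add: complex_eq_iff)
    then have "cos (real k * (2 * pi / real N)) = 1" by (simp add: a_def)
    then obtain m :: int where "real k * (2 * pi / real N) = of_int m * 2 * pi"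
      using cos_one_2pi_int by blast
    then have "real k = of_int m * real N" using assms by (simp add: field_simps)
    then have "int k = m * int N" by (metis of_int_eq_iff of_int_mult of_int_of_nat_eq)
    then have "int N dvd int k" by simp
    then show False using k by (auto dest: zdvd_imp_le)
  qed
qed

text \<open>At the points \<open>q^i\<close> with \<open>q\<close> a primitive complex
  \<open>2h\<close>-th root of unity, both the product and the theta determinant are known and share
  the same series \<open>G\<close>. Cancelling it leaves an equation between images of integer
  series, which descends because \<open>ofi\<close> is injective.\<close>

lemma mac_const_eq:
  assumes n: "n \<ge> 2"
  shows "mac_const n $ 0 \<noteq> 0"
    and "fps_const (mac_const n $ 0) * iprod 1 1 1 ^ (n * (n - 1)) = mac_const n * iprod 1 1 1 ^ n"
proof -
  define h where "h = n - 1"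
  have h: "h > 0" "n = Suc h" "int n - 1 = int h" using n by (auto simp: h_def)
  obtain q :: complex where q: "q ^ (2 * h) = 1" "\<And>k. 0 < k \<Longrightarrow> k < 2 * h \<Longrightarrow> q ^ k \<noteq> 1"
    by (rule exists_complex_root[of "2 * h"]) (use h in auto)
  define x where "x i = q ^ i" for i :: nat
  have q0: "q \<noteq> 0" using q(1) h by (cases "q = 0") (auto simp: power_0_left)
  have x0: "x i \<noteq> 0" for i using q0 by (simp add: x_def)
  have xN: "x i ^ (2 * h) = 1" for i
  proof -
    have "x i ^ (2 * h) = (q ^ (2 * h)) ^ i" unfolding x_def by (simp only: power_mult[symmetric] mult.commute)
    then show ?thesis using q(1) by simp
  qed
  have w0: "wdiff n x \<noteq> 0"
  proof -
    \<comment> \<open>The difference is a unit times \<open>(x j - x i) * (x i * x j - 1)\<close>.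
      Since \<open>i < j \<le> h\<close>, both \<open>j - i\<close> and \<open>i + j\<close> lie
      strictly between 0 and \<open>2h\<close>.\<close>
    have "(x j + inverse (x j)) - (x i + inverse (x i)) \<noteq> 0" if "i < j" "j < n" for i j
    proof -
      have "q ^ j = q ^ i * q ^ (j - i)" using that by (simp flip: power_add)
      then have 1: "x j - x i \<noteq> 0" using q(2)[of "j - i"] that h q0 by (auto simp: x_def)
      have 2: "x i * x j \<noteq> 1" using q(2)[of "i + j"] that h by (simp add: x_def flip: power_add)
      have "((x j + inverse (x j)) - (x i + inverse (x i))) * (x i * x j) = (x j - x i) * (x i * x j - 1)"
        using x0 by (simp add: field_simps)
      then show ?thesis using 1 2 by auto
    qed
    then show ?thesis by (auto simp: wdiff_def)
  qed
  interpret c: comm_ring_hom "fps_const :: complex \<Rightarrow> _" by (rule fps_const_hom)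
  have "Dmat n x = mat n n (\<lambda>(i, j). gpart h j * fps_const (ev (tb (int h) (int j)) (x i) $ 0))"
    unfolding Dmat_def h(3)
    by (intro eq_matI) (use ev_tb_root[OF h(1) _ xN] h(2) in auto)
  then have "Determinant.det (Dmat n x) = (\<Prod>j<n. gpart h j) *
      Determinant.det (mat n n (\<lambda>(i, j). fps_const (ev (tb (int h) (int j)) (x i) $ 0)))"
    by (simp add: det_scale_cols)
  also have "Determinant.det (mat n n (\<lambda>(i, j). fps_const (ev (tb (int h) (int j)) (x i) $ 0))) = fps_const (D0 n x)"
    unfolding D0_def h(3) c.hom_det[symmetric] by (intro arg_cong[of _ _ Determinant.det] eq_matI) auto
  finally have det: "Determinant.det (Dmat n x) = (\<Prod>j<n. gpart h j) * fps_const (D0 n x)" .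
  define G where "G = (\<Prod>j<n. gpart h j :: complex fps)"
  have KG: "Kprod n x * L 1 ^ n = G"
    using Kprod_root[OF q h(1)] prod_gpart[OF h(1), where ?'a = complex]
    unfolding G_def h(2) x_def by (simp only:)
  have "G $ 0 = 1"
    unfolding KG[symmetric] by (simp add: Kprod_nth_0 fps_power_zeroth iprod_nth_0)
  then have G0: "G \<noteq> 0" by (metis fps_zero_nth zero_neq_one)
  note main = Kprod_Dmat[of n x, OF n x0]
  show "mac_const n $ 0 \<noteq> 0" using main(2) w0 by auto
  have D0: "D0 n x \<noteq> 0" using main(2) w0 by auto
  have "(fps_const (D0 n x) * G) * (fps_const (of_int (mac_const n $ 0)) * L 1 ^ (n * (n - 1))) =
      (fps_const (wdiff n x) * L 1 ^ (n * (n - 1)) * Kprod n x) * L 1 ^ n"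
    unfolding main(2) KG[symmetric] by (simp add: mult_ac flip: fps_const_mult)
  also have "\<dots> = (fps_const (D0 n x) * G) * (ofi (mac_const n) * L 1 ^ n)"
    unfolding main(1) det G_def by (simp only: mult_ac)
  finally have "fps_const (of_int (mac_const n $ 0)) * L 1 ^ (n * (n - 1)) = ofi (mac_const n) * (L (1 :: complex)) ^ n"
    using D0 G0 by simp
  moreover interpret ofi: comm_ring_hom "ofi :: int fps \<Rightarrow> complex fps" by (rule ofi_hom)
  have "ofi (fps_const (mac_const n $ 0)) = fps_const (of_int (mac_const n $ 0) :: complex)"
    by (auto simp: fps_eq_iff)
  ultimately have "(ofi (fps_const (mac_const n $ 0) * iprod 1 1 1 ^ (n * (n - 1))) :: complex fps) =
      ofi (mac_const n * iprod 1 1 1 ^ n)"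
    by (simp add: ofi.hom_mult ofi.hom_power ofi_iprod)
  then show "fps_const (mac_const n $ 0) * iprod 1 1 1 ^ (n * (n - 1)) = mac_const n * iprod 1 1 1 ^ n"
    by (rule ofi_inj)
qed

text \<open>With the value of the constant inserted, \<open>wdiff\<close> and the constant cancel in
  favour of the degree 0 determinant. In the second claim \<open>D0\<close> inherits nonvanishing
  from \<open>wdiff\<close>, which is a visible product.\<close>

theorem macdonald_D:
  fixes x :: "nat \<Rightarrow> 'a::field"
  assumes n: "n \<ge> 2" and x: "\<And>i. x i \<noteq> 0" and char0: "\<And>c::int. of_int c = (0 :: 'a) \<Longrightarrow> c = 0"
  shows "fps_const (D0 n x) * (L 1 ^ n * Kprod n x) = Determinant.det (Dmat n x)"
    and "D0 n x = 0 \<Longrightarrow> wdiff n x = 0"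
proof -
  interpret ofi: comm_ring_hom "ofi :: int fps \<Rightarrow> 'a fps" by (rule ofi_hom)
  let ?c = "of_int (mac_const n $ 0) :: 'a"
  note main = Kprod_Dmat[of n x, OF n x]
  have c: "?c \<noteq> 0" using char0[of "mac_const n $ 0"] mac_const_eq(1)[OF n] by auto
  have "ofi (fps_const (mac_const n $ 0)) = fps_const ?c"
    by (auto simp: fps_eq_iff)
  moreover have "ofi (fps_const (mac_const n $ 0) * iprod 1 1 1 ^ (n * (n - 1))) = (ofi (mac_const n * iprod 1 1 1 ^ n) :: 'a fps)"
    using mac_const_eq(2)[OF n] by simp
  ultimately have *: "fps_const ?c * L 1 ^ (n * (n - 1)) = ofi (mac_const n) * L 1 ^ n"
    by (simp only: ofi.hom_mult ofi.hom_power ofi_iprod of_int_1)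
  have "(fps_const ?c * L 1 ^ (n * (n - 1))) * (fps_const (D0 n x) * (L 1 ^ n * Kprod n x)) =
      (fps_const (wdiff n x) * L 1 ^ (n * (n - 1)) * Kprod n x) * L 1 ^ n"
    unfolding main(2) fps_const_mult[symmetric] by (simp only: mult_ac)
  also have "\<dots> = (ofi (mac_const n) * L 1 ^ n) * Determinant.det (Dmat n x)"
    unfolding main(1) by (simp only: mult_ac)
  finally have "(fps_const ?c * L 1 ^ (n * (n - 1))) * (fps_const (D0 n x) * (L 1 ^ n * Kprod n x)) =
      (fps_const ?c * L 1 ^ (n * (n - 1))) * Determinant.det (Dmat n x)"
    by (simp only: *)
  moreover have "fps_const ?c * L 1 ^ (n * (n - 1)) \<noteq> 0"
    using c iprod_nonzero[of 1 "1 :: 'a" 1] by (simp only: mult_eq_0_iff power_eq_0_iff fps_const_eq_0_iff) simp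
  ultimately show "fps_const (D0 n x) * (L 1 ^ n * Kprod n x) = Determinant.det (Dmat n x)"
    by (simp only: mult_cancel_left) simp
  show "wdiff n x = 0" if "D0 n x = 0" unfolding main(2) that by simp
qed

section \<open>Beads of a partition\<close>

lemma part_eq_0: "i = 0 \<or> length l < i \<Longrightarrow> part l i = 0"
  by (auto simp: part_def)

lemma part_pos:
  assumes "is_partition l" "1 \<le> i" "i \<le> length l"
  shows "part l i > 0"
proof -
  have "l ! (i - 1) \<in> set l" using assms by auto
  moreover have "0 \<notin> set l" using assms(1) by (simp add: is_partition_def)
  ultimately have "l ! (i - 1) \<noteq> 0" by metis
  then show ?thesis using assms by (simp add: part_def)
qed

lemma part_antimono:
  assumes "is_partition l" "1 \<le> i" "i \<le> j"
  shows "part l j \<le> part l i"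
proof (cases "i < j \<and> j \<le> length l")
  case True
  then have "i - 1 < j - 1" "j - 1 < length l" using assms by auto
  then have "l ! (i - 1) \<ge> l ! (j - 1)"
    using assms(1) by (simp add: is_partition_def sorted_wrt_iff_nth_less)
  then show ?thesis using True assms by (simp add: part_def)
next
  case False
  then show ?thesis using assms by (cases "i = j") (auto simp: part_def)
qed

lemma partition_eqI:
  assumes "is_partition l" "is_partition l'" "\<And>i. 1 \<le> i \<Longrightarrow> part l i = part l' i"
  shows "l = l'"
proof -
  have *: "length l \<le> length l'" if "is_partition l" "\<And>i. 1 \<le> i \<Longrightarrow> part l i = part l' i" for l l'
  proof (rule ccontr)
    assume "\<not> length l \<le> length l'"
    then have "part l (length l) > 0" "part l' (length l) = 0"
      using part_pos[OF that(1), of "length l"] part_eq_0[of "length l" l'] by (cases l; auto)+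
    then show False using that(2)[of "length l"] \<open>\<not> length l \<le> length l'\<close> by simp
  qed
  have len: "length l = length l'"
    using *[of l l'] *[of l' l] assms by (simp add: le_antisym)
  show ?thesis
  proof (rule nth_equalityI[OF len])
    fix i assume "i < length l"
    then show "l ! i = l' ! i" using assms(3)[of "Suc i"] len by (simp add: part_def)
  qed
qed

text \<open>The list stops before the first zero value, since partitions are lists of positive
  parts; monotonicity makes all later values zero.\<close>

lemma partition_exists:
  fixes f :: "nat \<Rightarrow> nat"
  assumes mono: "\<And>i j. 1 \<le> i \<Longrightarrow> i \<le> j \<Longrightarrow> f j \<le> f i" and zero: "f (Suc M) = 0"
  shows "\<exists>l. is_partition l \<and> (\<forall>i\<ge>1. part l i = f i)"
proof -
  define K where "K = (LEAST K. f (Suc K) = 0)"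
  have K: "f (Suc K) = 0" unfolding K_def by (rule LeastI[of _ M]) (rule zero)
  have pos: "f (Suc i) > 0" if "i < K" for i
    using not_less_Least[of i "\<lambda>K. f (Suc K) = 0"] that by (auto simp: K_def)
  define l where "l = map (\<lambda>i. f (Suc i)) [0..<K]"
  have "is_partition l"
    unfolding is_partition_def
  proof
    show "sorted_wrt (\<ge>) l" using mono by (auto simp: l_def sorted_wrt_iff_nth_less)
    show "0 \<notin> set l"
    proof
      assume "0 \<in> set l"
      then obtain i where "i < K" "f (Suc i) = 0" by (auto simp: l_def)
      then show False using pos[of i] by simp
    qed
  qed
  moreover have "part l i = f i" if "1 \<le> i" for i
  proof (cases "i \<le> K")
    case True
    then show ?thesis using that by (auto simp: part_def l_def)
  next
    case False
    then have "f i \<le> f (Suc K)" by (intro mono) auto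
    then show ?thesis using K False by (auto simp: part_def l_def)
  qed
  ultimately show ?thesis by blast
qed

section \<open>Conjugate partitions\<close>

lemma finite_rows:
  assumes "1 \<le> j"
  shows "finite {i. 1 \<le> i \<and> j \<le> part l i}"
proof (rule finite_subset)
  show "{i. 1 \<le> i \<and> j \<le> part l i} \<subseteq> {..length l}"
  proof
    fix i assume "i \<in> {i. 1 \<le> i \<and> j \<le> part l i}"
    then show "i \<in> {..length l}"
      using assms part_eq_0[of i l] by (cases "i \<le> length l") auto
  qed
qed simp

lemma part_conj:
  assumes "is_partition l" "1 \<le> j"
  shows "part (conj_partition l) j = card {i. 1 \<le> i \<and> j \<le> part l i}"
proof (cases "j \<le> part l 1")
  case True
  have "length (conj_partition l) = part l 1" by (simp add: conj_partition_def)
  then have "part (conj_partition l) j = conj_partition l ! (j - 1)"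
    unfolding part_def[of "conj_partition l"] using True assms by simp
  also have "[1..<part l 1 + 1] ! (j - 1) = j" "j - 1 < length [1..<part l 1 + 1]"
    using True assms by (simp_all add: nth_upt del: upt_Suc)
  then have "conj_partition l ! (j - 1) = card {i. 1 \<le> i \<and> j \<le> part l i}"
    unfolding conj_partition_def by (subst nth_map) simp_all
  finally show ?thesis .
next
  case False
  have "{i. 1 \<le> i \<and> j \<le> part l i} = {}"
  proof (rule ccontr)
    assume "{i. 1 \<le> i \<and> j \<le> part l i} \<noteq> {}"
    then obtain i where "1 \<le> i" "j \<le> part l i" by blast
    then show False using False part_antimono[OF assms(1), of 1 i] by simp
  qed
  moreover have "part (conj_partition l) j = 0"
    using False by (intro part_eq_0) (simp add: conj_partition_def)
  ultimately show ?thesis by (simp only: card.empty)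
qed

lemma rows_eq:
  assumes "is_partition l" "1 \<le> j"
  shows "{i. 1 \<le> i \<and> j \<le> part l i} = {1..part (conj_partition l) j}"
proof -
  let ?A = "{i. 1 \<le> i \<and> j \<le> part l i}"
  have down: "i' \<in> ?A" if "i \<in> ?A" "1 \<le> i'" "i' \<le> i" for i i'
    using that part_antimono[OF assms(1), of i' i] by auto
  have "?A = {1..card ?A}"
  proof (cases "?A = {}")
    case True
    show ?thesis unfolding True by simp
  next
    case False
    define m where "m = Max ?A"
    have "m \<in> ?A" unfolding m_def using finite_rows[OF assms(2)] False by (rule Max_in)
    have "?A = {1..m}"
    proof
      show "?A \<subseteq> {1..m}" using finite_rows[OF assms(2), of l] by (auto simp: m_def intro: Max_ge)
      show "{1..m} \<subseteq> ?A" using down[OF \<open>m \<in> ?A\<close>] by auto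
    qed
    then show ?thesis by simp
  qed
  then show ?thesis by (simp only: part_conj[OF assms])
qed

lemma conj_galois:
  assumes "is_partition l" "1 \<le> i" "1 \<le> j"
  shows "i \<le> part (conj_partition l) j \<longleftrightarrow> j \<le> part l i"
proof -
  have "i \<in> {i. 1 \<le> i \<and> j \<le> part l i} \<longleftrightarrow> i \<in> {1..part (conj_partition l) j}"
    unfolding rows_eq[OF assms(1,3)] ..
  then show ?thesis using assms(2) by simp
qed

lemma is_partition_conj:
  assumes "is_partition l"
  shows "is_partition (conj_partition l)"
proof -
  have "card {i. 1 \<le> i \<and> j \<le> part l i} \<noteq> 0" if "1 \<le> j" "j \<le> part l 1" for j
    using that finite_rows[OF that(1), of l] by (auto simp: card_eq_0_iff)
  moreover have "card {i. 1 \<le> i \<and> j' \<le> part l i} \<le> card {i. 1 \<le> i \<and> j \<le> part l i}" if "1 \<le> j" "j \<le> j'" for j j'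
    by (rule card_mono) (use finite_rows[OF that(1)] that in auto)
  ultimately show ?thesis
    unfolding is_partition_def conj_partition_def
  proof (intro conjI)
    define f where "f j = card {i. 1 \<le> i \<and> j \<le> part l i}" for j
    assume pos: "\<And>j. 1 \<le> j \<Longrightarrow> j \<le> part l 1 \<Longrightarrow> card {i. 1 \<le> i \<and> j \<le> part l i} \<noteq> 0"
      and mono: "\<And>j j'. 1 \<le> j \<Longrightarrow> j \<le> j' \<Longrightarrow> card {i. 1 \<le> i \<and> j' \<le> part l i} \<le> card {i. 1 \<le> i \<and> j \<le> part l i}"
    show "sorted_wrt (\<ge>) (map (\<lambda>j. card {i. 1 \<le> i \<and> j \<le> part l i}) [1..<part l 1 + 1])"
      using mono unfolding f_def[symmetric] by (simp add: sorted_wrt_iff_nth_less nth_upt del: upt_Suc)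
    show "0 \<notin> set (map (\<lambda>j. card {i. 1 \<le> i \<and> j \<le> part l i}) [1..<part l 1 + 1])"
      using pos unfolding f_def[symmetric] by fastforce
  qed
qed

lemma nat_eq_if_le_iff:
  fixes a b :: nat
  assumes "\<And>k. 1 \<le> k \<Longrightarrow> k \<le> a \<longleftrightarrow> k \<le> b"
  shows "a = b"
proof (rule antisym)
  show "a \<le> b" using assms[of a] by (cases a) auto
  show "b \<le> a" using assms[of b] by (cases b) auto
qed

lemma conj_conj:
  assumes "is_partition l"
  shows "conj_partition (conj_partition l) = l"
proof (rule partition_eqI)
  show "is_partition (conj_partition (conj_partition l))" "is_partition l"
    using assms by (auto intro: is_partition_conj)
  fix i :: nat assume i: "1 \<le> i"
  have "k \<le> part (conj_partition (conj_partition l)) i \<longleftrightarrow> k \<le> part l i" if "1 \<le> k" for k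
    using conj_galois[OF is_partition_conj[OF assms] that i] conj_galois[OF assms i that] by simp
  then show "part (conj_partition (conj_partition l)) i = part l i"
    by (rule nat_eq_if_le_iff)
qed

text \<open>One more than the position of a 0 of the word. With this offset the symmetry of
  partitions in \<open>DD'\<close> is reflection at 0.\<close>

definition bead :: "nat list \<Rightarrow> nat \<Rightarrow> int" where
  "bead l i = int (part l i) - int i + 1"

text \<open>One more than the position of a 1 of the word, indexed by columns.\<close>

definition gap :: "nat list \<Rightarrow> nat \<Rightarrow> int" where
  "gap l j = int j - int (part (conj_partition l) j)"

definition Bd :: "nat list \<Rightarrow> int set" where
  "Bd l = bead l ` {1..}"

lemma word_eq_0: "word l k = 0 \<longleftrightarrow> k + 1 \<in> Bd l"
proof -
  have "k + 1 \<in> Bd l \<longleftrightarrow> (\<exists>i\<ge>1. k = int (part l i) - int i)"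
    unfolding Bd_def bead_def image_iff by (auto simp: Bex_def)
  then show ?thesis by (simp add: word_def)
qed

lemma word_eq_iff: "word l k = word l' k' \<longleftrightarrow> (k + 1 \<in> Bd l \<longleftrightarrow> k' + 1 \<in> Bd l')"
  using word_eq_0[of l k] word_eq_0[of l' k'] by (auto simp: word_def split: if_splits)

lemma bead_strict:
  assumes "is_partition l" "1 \<le> i" "i < j"
  shows "bead l j < bead l i"
  using part_antimono[OF assms(1,2), of j] assms(3) by (simp add: bead_def)

lemma bead_less_iff:
  assumes "is_partition l" "1 \<le> i" "1 \<le> j"
  shows "bead l j < bead l i \<longleftrightarrow> i < j"
  using bead_strict[OF assms(1), of i j] bead_strict[OF assms(1), of j i] assms by (cases i j rule: linorder_cases) auto

lemma bead_inj:
  assumes "is_partition l"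
  shows "inj_on (bead l) {1..}"
proof (rule inj_onI)
  fix i j assume "i \<in> {1..}" "j \<in> {1..}" "bead l i = bead l j"
  then show "i = j"
    using bead_strict[OF assms, of i j] bead_strict[OF assms, of j i] by (cases i j rule: linorder_cases) auto
qed

lemma gap_strict:
  assumes "is_partition l" "1 \<le> i" "i < j"
  shows "gap l i < gap l j"
  using part_antimono[OF is_partition_conj[OF assms(1)] assms(2), of j] assms(3) by (simp add: gap_def)

lemma gap_inj:
  assumes "is_partition l"
  shows "inj_on (gap l) {1..}"
proof (rule inj_onI)
  fix i j assume "i \<in> {1..}" "j \<in> {1..}" "gap l i = gap l j"
  then show "i = j"
    using gap_strict[OF assms, of i j] gap_strict[OF assms, of j i] by (cases i j rule: linorder_cases) auto
qed

text \<open>Inside the diagram \<open>bead l i - gap l j\<close> is the hook length of the box;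
  outside, row \<open>i\<close> ends before column \<open>j\<close> and column \<open>j\<close> ends
  before row \<open>i\<close>, so the difference is negative.\<close>

lemma gap_less_bead:
  assumes "is_partition l" "1 \<le> i" "1 \<le> j"
  shows "j \<le> part l i \<Longrightarrow> gap l j < bead l i" "\<not> j \<le> part l i \<Longrightarrow> bead l i < gap l j"
  using conj_galois[OF assms] by (auto simp: gap_def bead_def)

lemma bead_ge: "bead l i \<ge> 1 - int i"
  by (simp add: bead_def)

lemma bead_large: "length l < i \<Longrightarrow> bead l i = 1 - int i"
  by (simp add: bead_def part_eq_0)

lemma gap_not_in_Bd:
  assumes "is_partition l" "1 \<le> j"
  shows "gap l j \<notin> Bd l"
proof
  assume "gap l j \<in> Bd l"
  then obtain i where "1 \<le> i" "gap l j = bead l i" by (auto simp: Bd_def)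
  then show False using gap_less_bead[OF assms(1) _ assms(2), of i] by (cases "j \<le> part l i") auto
qed

lemma not_in_Bd_gap:
  assumes l: "is_partition l" and X: "X \<notin> Bd l"
  obtains j where "1 \<le> j" "X = gap l j"
proof -
  define i where "i = (LEAST i. 1 \<le> i \<and> bead l i \<le> X)"
  have "1 \<le> Suc (length l + nat (- X)) \<and> bead l (Suc (length l + nat (- X))) \<le> X"
    by (simp add: bead_large)
  then have i: "1 \<le> i \<and> bead l i \<le> X"
    unfolding i_def by (rule LeastI)
  have "bead l i \<noteq> X" using X i by (auto simp: Bd_def)
  with i have lt: "bead l i < X" by simp
  \<comment> \<open>If \<open>X\<close> is the gap of column \<open>j\<close>, that column must have
    length \<open>i - 1\<close>, where \<open>i\<close> is the first row whose bead is at most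
    \<open>X\<close>. Solving \<open>gap l j = X\<close> gives this \<open>j\<close>.\<close>
  define j where "j = nat (X + int i - 1)"
  have j: "int j = X + int i - 1" "1 \<le> j" "\<not> j \<le> part l i" using lt by (auto simp: j_def bead_def)
  have "part (conj_partition l) j = i - 1"
  proof (rule antisym)
    show "part (conj_partition l) j \<le> i - 1"
      using conj_galois[OF l conjunct1[OF i] j(2)] j(3) by linarith
    show "i - 1 \<le> part (conj_partition l) j"
    proof (cases "i = 1")
      case False
      then have i1: "1 \<le> i - 1" "i - 1 < i" using i by auto
      have "\<not> (1 \<le> i - 1 \<and> bead l (i - 1) \<le> X)"
        using i1(2) unfolding i_def by (rule not_less_Least)
      then have "X < bead l (i - 1)" using i1(1) by linarith
      then have "j \<le> part l (i - 1)" using j(1) i1 by (simp add: bead_def of_nat_diff)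
      then show ?thesis using conj_galois[OF l i1(1) j(2)] by simp
    qed simp
  qed
  then have "X = gap l j" using j(1) i by (simp add: gap_def of_nat_diff)
  then show ?thesis by (rule that[OF j(2)])
qed

lemma diag_length:
  assumes "is_partition l" "1 \<le> s"
  shows "s \<le> part l s \<longleftrightarrow> s \<le> diag_length l"
proof -
  let ?A = "{s. part l s \<ge> s}"
  have fin: "finite ?A"
  proof (rule finite_subset)
    show "?A \<subseteq> {..length l}"
    proof
      fix s assume "s \<in> ?A"
      then show "s \<in> {..length l}"
        using part_eq_0[of s l] by (cases "s \<le> length l") auto
    qed
  qed simp
  have "0 \<in> ?A" by simp
  then have d: "diag_length l \<in> ?A"
    unfolding diag_length_def by (intro Max_in[OF fin]) blast
  show ?thesis
  proof
    assume "s \<le> part l s"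
    then show "s \<le> diag_length l" unfolding diag_length_def by (intro Max_ge fin) auto
  next
    assume s: "s \<le> diag_length l"
    then have "part l (diag_length l) \<le> part l s" by (intro part_antimono assms)
    then show "s \<le> part l s" using s d by simp
  qed
qed

lemma diag_length_conj:
  assumes "is_partition l"
  shows "diag_length (conj_partition l) = diag_length l"
proof -
  have "part (conj_partition l) s \<ge> s \<longleftrightarrow> part l s \<ge> s" for s
    using conj_galois[OF assms, of s s] by (cases "s = 0") auto
  then show ?thesis by (simp add: diag_length_def)
qed

lemma DD'_iff:
  "l \<in> DD' \<longleftrightarrow> is_partition l \<and> (\<forall>j. 1 \<le> j \<and> j \<le> diag_length l \<longrightarrow> part (conj_partition l) j = part l j + 1)"
proof
  assume "l \<in> DD'"
  then obtain k where "k \<in> DD" and l: "l = conj_partition k" by (auto simp: DD'_def)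
  then have k: "is_partition k" "\<And>i. 1 \<le> i \<Longrightarrow> i \<le> diag_length k \<Longrightarrow> part k i = part (conj_partition k) i + 1"
    by (auto simp: DD_def)
  show "is_partition l \<and> (\<forall>j. 1 \<le> j \<and> j \<le> diag_length l \<longrightarrow> part (conj_partition l) j = part l j + 1)"
    using k by (simp add: l conj_conj diag_length_conj is_partition_conj)
next
  assume *: "is_partition l \<and> (\<forall>j. 1 \<le> j \<and> j \<le> diag_length l \<longrightarrow> part (conj_partition l) j = part l j + 1)"
  then have "conj_partition l \<in> DD"
    by (simp add: DD_def conj_conj diag_length_conj is_partition_conj)
  moreover have "l = conj_partition (conj_partition l)" using * by (simp add: conj_conj)
  ultimately show "l \<in> DD'" unfolding DD'_def by blast
qed

text \<open>Partitions in \<open>DD'\<close> have bead sets that are antisymmetric except at the bead \<open>0\<close>.\<close>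

definition symB :: "int set \<Rightarrow> bool" where
  "symB S \<longleftrightarrow> 0 \<in> S \<and> (\<forall>k>0. k \<in> S \<longleftrightarrow> - k \<notin> S)"

lemma symB_uminus:
  assumes "symB S" "x \<noteq> 0"
  shows "x \<in> S \<longleftrightarrow> - x \<notin> S"
proof (cases "x > 0")
  case True
  then show ?thesis using assms(1) unfolding symB_def by blast
next
  case False
  then have "- x > 0" using assms(2) by simp
  then have "- x \<in> S \<longleftrightarrow> - (- x) \<notin> S" using assms(1) unfolding symB_def by blast
  then show ?thesis by simp
qed

lemma bead_pos_iff:
  assumes "is_partition l" "1 \<le> i"
  shows "bead l i > 0 \<longleftrightarrow> i \<le> diag_length l"
  using diag_length[OF assms] by (auto simp: bead_def)

lemma gap_le_0_iff:
  assumes "is_partition l" "1 \<le> j"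
  shows "gap l j \<le> 0 \<longleftrightarrow> j \<le> diag_length l"
  using diag_length[OF is_partition_conj[OF assms(1)] assms(2)] diag_length_conj[OF assms(1)] by (auto simp: gap_def)

lemma DD'_gap:
  assumes "l \<in> DD'" "1 \<le> j" "j \<le> diag_length l"
  shows "gap l j = - bead l j"
  using assms DD'_iff[of l] by (simp add: gap_def bead_def)

text \<open>Positive beads and nonpositive gaps belong to the rows and columns up to the diagonal
  length, and there the condition of \<open>DD'\<close> reads \<open>gap l j = - bead l j\<close>. A
  gap at 0 would sit in such a column and contradict the positivity of the bead.\<close>

lemma DD'_symB:
  assumes "l \<in> DD'"
  shows "symB (Bd l)"
proof -
  have l: "is_partition l" using assms DD'_iff by blast
  have neg: "x \<notin> Bd l \<longleftrightarrow> - x \<in> Bd l" if "x < 0" for x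
  proof
    assume "x \<notin> Bd l"
    then obtain j where j: "1 \<le> j" "x = gap l j" by (rule not_in_Bd_gap[OF l])
    then have "j \<le> diag_length l" using gap_le_0_iff[OF l j(1)] that by simp
    then show "- x \<in> Bd l" using DD'_gap[OF assms j(1)] j by (auto simp: Bd_def)
  next
    assume "- x \<in> Bd l"
    then obtain j where j: "1 \<le> j" "- x = bead l j" by (auto simp: Bd_def)
    then have "j \<le> diag_length l" using bead_pos_iff[OF l j(1)] that by simp
    then have "x = gap l j" using DD'_gap[OF assms j(1)] j by simp
    then show "x \<notin> Bd l" using gap_not_in_Bd[OF l j(1)] by simp
  qed
  have "0 \<in> Bd l"
  proof (rule ccontr)
    assume "0 \<notin> Bd l"
    then obtain j where j: "1 \<le> j" "0 = gap l j" by (rule not_in_Bd_gap[OF l])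
    then have "j \<le> diag_length l" using gap_le_0_iff[OF l j(1)] by simp
    then have "bead l j = 0" using DD'_gap[OF assms j(1)] j by simp
    then show False using bead_pos_iff[OF l j(1)] \<open>j \<le> diag_length l\<close> by simp
  qed
  moreover have "k \<in> Bd l \<longleftrightarrow> - k \<notin> Bd l" if "k > 0" for k
    using neg[of "- k"] that by (simp only: minus_minus neg_less_0_iff_less)
  ultimately show ?thesis unfolding symB_def by blast
qed

text \<open>Two increasing enumerations of one set over the same indices must agree: at the first
  difference the smaller value could not be attained by the other. It turns equality of bead or gap
  sets into equality of parts.\<close>

lemma strict_mono_image_unique:
  fixes f g :: "nat \<Rightarrow> int"
  assumes "f ` A = g ` A"
    and "\<And>i j. i \<in> A \<Longrightarrow> j \<in> A \<Longrightarrow> i < j \<Longrightarrow> f i < f j"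
    and "\<And>i j. i \<in> A \<Longrightarrow> j \<in> A \<Longrightarrow> i < j \<Longrightarrow> g i < g j"
    and "i \<in> A"
  shows "f i = g i"
  using assms(4)
proof (induction i rule: less_induct)
  case (less i)
  have le: "g' i \<le> f' i"
    if "f' ` A = g' ` A" "\<And>j. j \<in> A \<Longrightarrow> j < i \<Longrightarrow> f' j = g' j"
      "\<And>i j. i \<in> A \<Longrightarrow> j \<in> A \<Longrightarrow> i < j \<Longrightarrow> f' i < f' j"
      "\<And>i j. i \<in> A \<Longrightarrow> j \<in> A \<Longrightarrow> i < j \<Longrightarrow> g' i < g' j" for f' g' :: "nat \<Rightarrow> int"
  proof -
    have "f' i \<in> g' ` A" using that(1) less.prems by blast
    then obtain k where k: "k \<in> A" "f' i = g' k" by blast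
    show ?thesis
    proof (cases i k rule: linorder_cases)
      case less': less
      then show ?thesis using that(4)[OF less.prems k(1) less'] k by simp
    next
      case equal
      then show ?thesis using k by simp
    next
      case greater
      then have "f' k = g' k" "f' k < f' i" using that(2)[OF k(1)] that(3)[OF k(1) less.prems] by auto
      then show ?thesis using k by simp
    qed
  qed
  have IH: "f j = g j" if "j \<in> A" "j < i" for j using less.IH that by blast
  show ?case
  proof (rule antisym)
    show "g i \<le> f i" by (rule le) (use assms IH in auto)
    show "f i \<le> g i" by (rule le) (use assms IH in auto)
  qed
qed

text \<open>Antisymmetry makes the nonpositive gaps and the negatives of the positive beads the same
  set. Both are listed increasingly by the same indices, so they agree term by term.\<close>

lemma symB_DD':
  assumes l: "is_partition l" and S: "symB (Bd l)"
  shows "l \<in> DD'"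
proof -
  let ?A = "{1..diag_length l}"
  have neg: "x \<notin> Bd l \<longleftrightarrow> - x \<in> Bd l" if "x < 0" for x
    using symB_uminus[OF S less_imp_neq[OF that]] by blast
  have "(\<lambda>j. - bead l j) ` ?A = gap l ` ?A"
  proof (intro equalityI subsetI)
    fix x assume "x \<in> (\<lambda>j. - bead l j) ` ?A"
    then obtain j where j: "1 \<le> j" "j \<le> diag_length l" "x = - bead l j" by auto
    then have "x < 0" using bead_pos_iff[OF l j(1)] by simp
    moreover have "- x \<in> Bd l" using j by (auto simp: Bd_def)
    ultimately have "x \<notin> Bd l" using neg by blast
    then obtain i where i: "1 \<le> i" "x = gap l i" by (rule not_in_Bd_gap[OF l])
    then show "x \<in> gap l ` ?A" using gap_le_0_iff[OF l i(1)] \<open>x < 0\<close> by auto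
  next
    fix x assume "x \<in> gap l ` ?A"
    then obtain j where j: "1 \<le> j" "j \<le> diag_length l" "x = gap l j" by auto
    then have "x \<le> 0" using gap_le_0_iff[OF l j(1)] by simp
    moreover have "x \<notin> Bd l" using gap_not_in_Bd[OF l j(1)] j by simp
    moreover have "0 \<in> Bd l" using S by (simp add: symB_def)
    ultimately have "x < 0" by (cases "x = 0") auto
    then have "- x \<in> Bd l" using neg \<open>x \<notin> Bd l\<close> by blast
    then obtain i where i: "1 \<le> i" "- x = bead l i" by (auto simp: Bd_def)
    then show "x \<in> (\<lambda>j. - bead l j) ` ?A"
      using bead_pos_iff[OF l i(1)] \<open>x < 0\<close> by (intro image_eqI[of _ _ i]) auto
  qed
  note img = this
  have "- bead l j = gap l j" if j: "j \<in> ?A" for j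
  proof (rule strict_mono_image_unique[OF img _ _ j])
    fix i k assume "i \<in> ?A" "k \<in> ?A" "i < k"
    then show "- bead l i < - bead l k" "gap l i < gap l k"
      using bead_strict[OF l, of i k] gap_strict[OF l, of i k] by auto
  qed
  note eq = this
  have "part (conj_partition l) j = part l j + 1" if "1 \<le> j \<and> j \<le> diag_length l" for j
  proof -
    have "j \<in> ?A" using that by simp
    from eq[OF this] show ?thesis unfolding bead_def gap_def by linarith
  qed
  then show ?thesis
    unfolding DD'_iff using l by blast
qed

section \<open>The charge of a bead set\<close>

lemma Bd_inter:
  assumes l: "is_partition l" and M: "length l \<le> M"
  shows "Bd l \<inter> {- int M<..} = bead l ` {1..M}"
proof (intro equalityI subsetI)
  fix x assume "x \<in> Bd l \<inter> {- int M<..}"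
  then obtain i where i: "1 \<le> i" "x = bead l i" "x > - int M" by (auto simp: Bd_def)
  have "i \<le> M"
  proof (rule ccontr)
    assume "\<not> i \<le> M"
    then have "x = 1 - int i" using i bead_large[of l i] M by simp
    then show False using i \<open>\<not> i \<le> M\<close> by simp
  qed
  then show "x \<in> bead l ` {1..M}" using i by auto
next
  fix x assume "x \<in> bead l ` {1..M}"
  then obtain i where i: "1 \<le> i" "i \<le> M" "x = bead l i" by auto
  then show "x \<in> Bd l \<inter> {- int M<..}" using bead_ge[of i l] by (auto simp: Bd_def)
qed

lemma Bd_card:
  assumes "is_partition l" "length l \<le> M"
  shows "card (Bd l \<inter> {- int M<..}) = M"
proof -
  have "inj_on (bead l) {1..M}" using bead_inj[OF assms(1)] by (rule inj_on_subset) auto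
  then show ?thesis unfolding Bd_inter[OF assms] by (simp add: card_image)
qed

lemma Bd_inj:
  assumes "is_partition l" "is_partition l'" "Bd l = Bd l'"
  shows "l = l'"
proof (rule partition_eqI[OF assms(1,2)])
  fix i :: nat assume i: "1 \<le> i"
  have img: "(\<lambda>i. - bead l i) ` {1..} = (\<lambda>i. - bead l' i) ` {1..}"
    using assms(3) unfolding Bd_def by (metis image_image)
  have "- bead l i = - bead l' i"
  proof (rule strict_mono_image_unique[OF img])
    show "i \<in> {1..}" using i by simp
    fix j k :: nat assume "j \<in> {1..}" "k \<in> {1..}" "j < k"
    then show "- bead l j < - bead l k" "- bead l' j < - bead l' k"
      using bead_strict[OF assms(1), of j k] bead_strict[OF assms(2), of j k] by auto
  qed
  then show "part l i = part l' i" by (simp add: bead_def)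
qed

text \<open>For a bead set of a partition exactly \<open>M\<close> beads lie above
  \<open>- M\<close> once \<open>M\<close> is large. A shift by \<open>s\<close> changes this count
  by \<open>s\<close>, so the normalisation admits no other shift.\<close>

lemma Bd_shift_unique:
  assumes l: "is_partition l" and l': "is_partition l'" and sh: "\<And>x. x \<in> Bd l \<longleftrightarrow> x + s \<in> Bd l'"
  shows "s = 0 \<and> l = l'"
proof -
  define M where "M = max (length l) (length l') + nat \<bar>s\<bar>"
  have M: "length l \<le> M" by (simp add: M_def)
  have M': "length l' \<le> nat (int M - s)" "int (nat (int M - s)) = int M - s" by (auto simp: M_def)
  have "bij_betw (\<lambda>x. x + s) (Bd l \<inter> {- int M<..}) (Bd l' \<inter> {- int (nat (int M - s))<..})"
  proof (rule bij_betw_byWitness[where f' = "\<lambda>x. x - s"])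
    show "(\<lambda>x. x + s) ` (Bd l \<inter> {- int M<..}) \<subseteq> Bd l' \<inter> {- int (nat (int M - s))<..}"
      using sh M'(2) by auto
    show "(\<lambda>x. x - s) ` (Bd l' \<inter> {- int (nat (int M - s))<..}) \<subseteq> Bd l \<inter> {- int M<..}"
    proof
      fix y assume "y \<in> (\<lambda>x. x - s) ` (Bd l' \<inter> {- int (nat (int M - s))<..})"
      then show "y \<in> Bd l \<inter> {- int M<..}" using sh[of y] M'(2) by auto
    qed
  qed auto
  from bij_betw_same_card[OF this] have "M = nat (int M - s)"
    unfolding Bd_card[OF l M] Bd_card[OF l' M'(1)] .
  then have s: "s = 0" using M'(2) by linarith
  have "Bd l = Bd l'" using sh unfolding s by auto
  then show ?thesis using s Bd_inj[OF l l'] by simp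
qed

text \<open>A set that is bounded above and contains all small integers has a decreasing
  enumeration. Adding the row number to it gives weakly decreasing values that are eventually
  constant, and the shift makes that constant 0.\<close>

lemma Bd_exists:
  fixes S :: "int set"
  assumes up: "\<And>x. x \<in> S \<Longrightarrow> x \<le> U" and low: "\<And>x. x \<le> D \<Longrightarrow> x \<in> S"
  shows "\<exists>l s. is_partition l \<and> (\<forall>x. x \<in> Bd l \<longleftrightarrow> x + s \<in> S)"
proof -
  define A where "A = S \<inter> {D<..}"
  have fin: "finite A"
  proof (rule finite_subset)
    show "A \<subseteq> {D..U}" using up by (auto simp: A_def)
  qed simp
  define n where "n = card A"
  define xs where "xs = sorted_list_of_set A"
  have xs: "length xs = n" "set xs = A" "sorted_wrt (<) xs"
    using fin by (simp_all add: xs_def n_def)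
  \<comment> \<open>This is the charge: after subtracting it, the members not exceeding
    \<open>D\<close> become the beads \<open>1 - i\<close> of the empty rows
    \<open>i > n\<close>.\<close>
  define s where "s = D + int n"
  define X where "X i = (if i \<le> n then xs ! (n - i) else D + int n + 1 - int i)" for i
  have X_D: "X i > D" if "1 \<le> i" "i \<le> n" for i
  proof -
    have "n - i < length xs" using xs(1) that by simp
    then have "xs ! (n - i) \<in> A" using nth_mem xs(2) by blast
    then show ?thesis using that by (simp add: X_def A_def)
  qed
  have X_step: "X (Suc i) < X i" if "1 \<le> i" for i
  proof (cases "Suc i \<le> n")
    case True
    then have "xs ! (n - Suc i) < xs ! (n - i)"
      using xs that by (intro sorted_wrt_nth_less[OF xs(3)]) auto
    then show ?thesis using True by (simp add: X_def)
  next
    case False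
    then show ?thesis using X_D[of i] that by (cases "i = n") (auto simp: X_def)
  qed
  have X_diff: "X j + int (j - i) \<le> X i" if "1 \<le> i" "i \<le> j" for i j
    using that(2)
  proof (induction j rule: dec_induct)
    case (step j)
    then show ?case using X_step[of j] that by (simp add: Suc_diff_le)
  qed simp
  define f where "f i = nat (X i - s + int i - 1)" for i
  have X_n: "X (Suc n) = D" by (simp add: X_def)
  have X_large: "X i - s + int i - 1 = 0" if "i > n" for i
    using that by (simp add: X_def s_def)
  have X_nonneg: "X i - s + int i - 1 \<ge> 0" if "1 \<le> i" for i
  proof (cases "i \<le> n")
    case True
    then show ?thesis using X_diff[of i "Suc n"] that X_n by (simp add: s_def Suc_diff_le of_nat_diff)
  next
    case False
    then show ?thesis using X_large[of i] by simp
  qed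
  have "\<exists>l. is_partition l \<and> (\<forall>i\<ge>1. part l i = f i)"
  proof (rule partition_exists[of f n])
    fix i j :: nat assume "1 \<le> i" "i \<le> j"
    then show "f j \<le> f i" using X_diff[of i j] by (simp add: f_def nat_mono of_nat_diff)
  next
    show "f (Suc n) = 0" using X_large[of "Suc n"] by (simp add: f_def)
  qed
  then obtain l where l: "is_partition l" "\<And>i. 1 \<le> i \<Longrightarrow> part l i = f i" by blast
  have bead: "bead l i + s = X i" if "1 \<le> i" for i
    using l(2)[OF that] X_nonneg[OF that] by (simp add: bead_def f_def)
  have X_S: "X ` {1..} = S"
  proof (intro equalityI subsetI)
    fix x assume "x \<in> X ` {1..}"
    then obtain i where i: "1 \<le> i" "x = X i" by auto
    show "x \<in> S"
    proof (cases "i \<le> n")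
      case True
      then have "x = xs ! (n - i)" "n - i < n" using i by (auto simp: X_def)
      then have "x \<in> A" using nth_mem[of "n - i" xs] xs by simp
      then show ?thesis by (simp add: A_def)
    next
      case False
      then have "x \<le> D" using i by (simp add: X_def)
      then show ?thesis by (rule low)
    qed
  next
    fix x assume x: "x \<in> S"
    show "x \<in> X ` {1..}"
    proof (cases "x > D")
      case True
      then have "x \<in> set xs" using x xs by (simp add: A_def)
      then obtain k where k: "k < n" "x = xs ! k" using xs(1) by (metis in_set_conv_nth)
      then have "X (n - k) = x" "1 \<le> n - k" by (auto simp: X_def)
      then show ?thesis by (metis atLeast_iff imageI)
    next
      case False
      define i where "i = nat (D + int n + 1 - x)"
      have "1 \<le> i" "X i = x" using False by (auto simp: i_def X_def)
      then show ?thesis by (metis atLeast_iff imageI)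
    qed
  qed
  have "x \<in> Bd l \<longleftrightarrow> x + s \<in> S" for x
  proof -
    have "x \<in> Bd l \<longleftrightarrow> x + s \<in> (\<lambda>i. bead l i + s) ` {1..}" by (auto simp: Bd_def)
    also have "(\<lambda>i. bead l i + s) ` {1..} = X ` {1..}" using bead by (intro image_cong) auto
    finally show ?thesis by (simp only: X_S)
  qed
  then show ?thesis using l(1) by blast
qed

section \<open>Partitions from antisymmetric bead sets\<close>

definition symset :: "int set \<Rightarrow> int set" where
  "symset P = insert 0 (P \<union> {x. x < 0 \<and> - x \<notin> P})"

lemma symB_symset:
  assumes "P \<subseteq> {0<..}"
  shows "symB (symset P)" "symset P \<inter> {0<..} = P"
  using assms by (auto simp: symB_def symset_def)

lemma symset_symB:
  assumes "symB S"
  shows "symset (S \<inter> {0<..}) = S"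
proof (rule Set.set_eqI)
  fix x :: int
  consider "x > 0" | "x = 0" | "x < 0" by linarith
  then show "x \<in> symset (S \<inter> {0<..}) \<longleftrightarrow> x \<in> S"
  proof cases
    case 3
    have "x \<in> symset (S \<inter> {0<..}) \<longleftrightarrow> - x \<notin> S" using 3 by (auto simp: symset_def)
    then show ?thesis using symB_uminus[OF assms less_imp_neq[OF 3]] by blast
  next
    case 2
    then show ?thesis using assms unfolding symB_def symset_def by blast
  next
    case 1
    then show ?thesis by (auto simp: symset_def)
  qed
qed

text \<open>An antisymmetric set containing 0 has exactly one of \<open>k\<close> and
  \<open>- k\<close> for every \<open>k > 0\<close>. In particular it has charge zero without any
  further condition.\<close>

lemma symB_abs_bij:
  assumes S: "symB S"
  shows "bij_betw (\<lambda>x. nat \<bar>x\<bar>) (S \<inter> {- int M<..<int M}) {..<M}"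
proof (rule bij_betwI')
  fix x y assume xy: "x \<in> S \<inter> {- int M<..<int M}" "y \<in> S \<inter> {- int M<..<int M}"
  show "nat \<bar>x\<bar> = nat \<bar>y\<bar> \<longleftrightarrow> x = y"
  proof
    assume "nat \<bar>x\<bar> = nat \<bar>y\<bar>"
    then have "x = y \<or> x = - y" by linarith
    moreover have "y = 0" if "x = - y"
      using symB_uminus[OF S, of y] xy that by blast
    ultimately show "x = y" by auto
  qed simp
next
  fix k assume k: "k \<in> {..<M}"
  have "0 \<in> S" using S by (simp add: symB_def)
  then have "int k \<in> S \<or> - int k \<in> S" using symB_uminus[OF S, of "int k"] by fastforce
  then show "\<exists>x\<in>S \<inter> {- int M<..<int M}. k = nat \<bar>x\<bar>"
    using k by (auto intro: bexI[of _ "int k"] bexI[of _ "- int k"])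
qed auto

text \<open>The set is the bead set of some partition up to a shift; counting elements on a large
  window with \<open>symB_abs_bij\<close> shows that the shift is 0.\<close>

lemma partition_of_symB:
  assumes "finite P" "P \<subseteq> {0<..}"
  shows "\<exists>l\<in>DD'. Bd l = symset P"
proof -
  let ?S = "symset P"
  have S: "symB ?S" by (rule symB_symset[OF assms(2)])
  obtain U where U: "\<And>x. x \<in> P \<Longrightarrow> x \<le> U" "U > 0"
  proof
    show "x \<le> max 1 (Max P)" if "x \<in> P" for x using assms(1) that by (simp add: max.coboundedI2)
  qed simp
  have "\<exists>l s. is_partition l \<and> (\<forall>x. x \<in> Bd l \<longleftrightarrow> x + s \<in> ?S)"
  proof (rule Bd_exists[of ?S U "- U - 1"])
    show "x \<le> U" if "x \<in> ?S" for x using that U by (auto simp: symset_def)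
    show "x \<in> ?S" if "x \<le> - U - 1" for x using that U(1)[of "- x"] U(2) by (auto simp: symset_def)
  qed
  then obtain l s where l: "is_partition l" "\<And>x. x \<in> Bd l \<longleftrightarrow> x + s \<in> ?S" by blast
  define M where "M = nat (U + 1) + length l + nat \<bar>s\<bar>"
  define N where "N = nat (int M + s)"
  have MU: "U < int M" using U(2) by (simp add: M_def)
  have N: "int N = int M + s" "length l \<le> N" by (auto simp: N_def M_def)
  have "bij_betw (\<lambda>x. x + s) (Bd l \<inter> {- int N<..}) (?S \<inter> {- int M<..<int M})"
  proof (rule bij_betw_byWitness[where f' = "\<lambda>x. x - s"])
    have "x < int M" if "x \<in> ?S" for x
    proof -
      have "x \<le> U" using that U by (auto simp: symset_def)
      then show ?thesis using MU by simp
    qed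
    then show "(\<lambda>x. x + s) ` (Bd l \<inter> {- int N<..}) \<subseteq> ?S \<inter> {- int M<..<int M}"
      using l(2) N by auto
    show "(\<lambda>x. x - s) ` (?S \<inter> {- int M<..<int M}) \<subseteq> Bd l \<inter> {- int N<..}"
    proof
      fix y assume "y \<in> (\<lambda>x. x - s) ` (?S \<inter> {- int M<..<int M})"
      then show "y \<in> Bd l \<inter> {- int N<..}" using l(2)[of y] N by auto
    qed
  qed auto
  from bij_betw_same_card[OF this] have "N = card (?S \<inter> {- int M<..<int M})"
    unfolding Bd_card[OF l(1) N(2)] .
  also have "\<dots> = M"
    using bij_betw_same_card[OF symB_abs_bij[OF S, of M]] by simp
  finally have "s = 0" using N by simp
  then have "Bd l = ?S" using l(2) by auto
  then show ?thesis using symB_DD'[OF l(1)] S by (intro bexI[of _ l]) simp_all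
qed

text \<open>The size is the sum of \<open>bead l i + (i - 1)\<close> over the first \<open>M\<close>
  rows. The beads there are the numbers below \<open>M\<close>, each with one sign, so adding the
  sum of the \<open>i - 1\<close> cancels the negative beads and doubles the positive ones.\<close>

lemma DD'_size:
  assumes "l \<in> DD'"
  shows "int (sum_list l) = 2 * (\<Sum>x\<in>Bd l \<inter> {0<..}. x)"
    and "diag_length l = card (Bd l \<inter> {0<..})"
    and "finite (Bd l \<inter> {0<..})"
proof -
  have l: "is_partition l" using assms DD'_iff by blast
  have S: "symB (Bd l)" by (rule DD'_symB[OF assms])
  define M where "M = length l + part l 1 + 1"
  have bound: "x < int M" if x: "x \<in> Bd l" for x
  proof -
    obtain i where "1 \<le> i" "x = bead l i" using x by (auto simp: Bd_def)
    then show ?thesis using part_antimono[OF l, of 1 i] by (simp add: bead_def M_def)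
  qed
  have P: "Bd l \<inter> {0<..} = bead l ` {1..diag_length l}"
    using bead_pos_iff[OF l] by (auto simp: Bd_def)
  show "finite (Bd l \<inter> {0<..})" unfolding P by simp
  have "inj_on (bead l) {1..diag_length l}" using bead_inj[OF l] by (rule inj_on_subset) auto
  then show "diag_length l = card (Bd l \<inter> {0<..})" unfolding P by (simp add: card_image)
  have "sum_list l = (\<Sum>i<length l. part l (Suc i))"
    by (simp add: sum_list_sum_nth part_def lessThan_atLeast0)
  also have "\<dots> = (\<Sum>i<M. part l (Suc i))"
    by (rule sum.mono_neutral_left) (auto simp: M_def part_eq_0)
  also have "\<dots> = (\<Sum>i=1..M. part l i)"
    by (rule sum.reindex_bij_witness[of _ "\<lambda>i. i - 1" Suc]) auto
  finally have "int (sum_list l) = (\<Sum>i=1..M. bead l i + int (i - 1))"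
    by (simp add: bead_def of_nat_diff)
  also have "\<dots> = (\<Sum>i=1..M. bead l i) + (\<Sum>i=1..M. int (i - 1))"
    by (rule sum.distrib)
  also have "(\<Sum>i=1..M. int (i - 1)) = (\<Sum>k<M. int k)"
    by (rule sum.reindex_bij_witness[of _ Suc "\<lambda>i. i - 1"]) auto
  also have "(\<Sum>i=1..M. bead l i) = (\<Sum>x\<in>Bd l \<inter> {- int M<..<int M}. x)"
  proof -
    have inj: "inj_on (bead l) {1..M}" using bead_inj[OF l] by (rule inj_on_subset) auto
    have "length l \<le> M" by (simp add: M_def)
    moreover have "Bd l \<inter> {- int M<..<int M} = Bd l \<inter> {- int M<..}" using bound by auto
    ultimately have "Bd l \<inter> {- int M<..<int M} = bead l ` {1..M}" using Bd_inter[OF l, of M] by simp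
    then show ?thesis by (simp only: sum.reindex[OF inj] o_def)
  qed
  also have "\<dots> = (\<Sum>x\<in>Bd l \<inter> {- int M<..<int M}.
      if int (nat \<bar>x\<bar>) \<in> Bd l then int (nat \<bar>x\<bar>) else - int (nat \<bar>x\<bar>))"
  proof (intro sum.cong refl)
    fix x assume "x \<in> Bd l \<inter> {- int M<..<int M}"
    then have x: "x \<in> Bd l" by simp
    show "x = (if int (nat \<bar>x\<bar>) \<in> Bd l then int (nat \<bar>x\<bar>) else - int (nat \<bar>x\<bar>))"
    proof (cases "x \<ge> 0")
      case False
      then have "- x \<notin> Bd l" using symB_uminus[OF S, of x] x by simp
      then show ?thesis using False by simp
    qed (use x in simp)
  qed
  also have "\<dots> = (\<Sum>k<M. if int k \<in> Bd l then int k else - int k)"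
    by (rule sum.reindex_bij_betw[OF symB_abs_bij[OF S]])
  also have "\<dots> + (\<Sum>k<M. int k) = (\<Sum>k<M. if int k \<in> Bd l then 2 * int k else 0)"
    unfolding sum.distrib[symmetric] by (intro sum.cong) auto
  also have "\<dots> = (\<Sum>k\<in>{k\<in>{..<M}. int k \<in> Bd l \<and> k > 0}. 2 * int k)"
    by (rule sum.mono_neutral_cong_right) auto
  also have "\<dots> = (\<Sum>x\<in>Bd l \<inter> {0<..}. 2 * x)"
  proof -
    have "Bd l \<inter> {0<..} = int ` {k\<in>{..<M}. int k \<in> Bd l \<and> k > 0}"
    proof (intro equalityI subsetI)
      fix x assume x: "x \<in> Bd l \<inter> {0<..}"
      then have "x = int (nat x)" "nat x < M" using bound[of x] by auto
      then show "x \<in> int ` {k\<in>{..<M}. int k \<in> Bd l \<and> k > 0}"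
        using x by (intro image_eqI[of _ _ "nat x"]) auto
    qed auto
    then show ?thesis by (simp add: sum.reindex)
  qed
  finally show "int (sum_list l) = 2 * (\<Sum>x\<in>Bd l \<inter> {0<..}. x)"
    by (simp add: sum_distrib_left)
qed

text \<open>Boxes correspond to pairs of a bead \<open>x\<close> and a gap \<open>z < x\<close>, with hook length \<open>x - z\<close>. For
  partitions in \<open>DD'\<close> the boxes strictly above the diagonal are those with \<open>x + z > 0\<close>.\<close>

definition hpairs :: "int \<Rightarrow> int set \<Rightarrow> (int \<times> int) set" where
  "hpairs g S = {(x, z). x \<in> S \<and> z \<notin> S \<and> z < x \<and> x - z < g \<and> 0 < x + z}"

text \<open>For a column up to the diagonal length the gap is \<open>- bead l j\<close>, and the
  sign of the sum compares \<open>i\<close> with \<open>j\<close>. For a later column the gap is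
  positive, and the row must lie within the diagonal length, so its bead is positive as
  well.\<close>

lemma card_H_lt_plus:
  assumes "l \<in> DD'"
  shows "card (H_lt_plus g l) = card (hpairs (int g) (Bd l))"
proof -
  have l: "is_partition l" using assms DD'_iff by blast
  have box: "(i, j) \<in> boxes l \<longleftrightarrow> 1 \<le> i \<and> 1 \<le> j \<and> gap l j < bead l i" for i j
    using gap_less_bead[OF l, of i j] by (cases "j \<le> part l i") (auto simp: boxes_def)
  have hook: "int (hook l (i, j)) = bead l i - gap l j" if "(i, j) \<in> boxes l" for i j
  proof -
    have "1 \<le> i" "1 \<le> j" "j \<le> part l i" using that by (auto simp: boxes_def)
    then have "i \<le> part (conj_partition l) j" using conj_galois[OF l] by simp
    then show ?thesis using \<open>j \<le> part l i\<close> by (simp add: hook_def bead_def gap_def of_nat_diff)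
  qed
  have diag: "i < j \<longleftrightarrow> 0 < bead l i + gap l j" if "(i, j) \<in> boxes l" for i j
  proof -
    have ij: "1 \<le> i" "1 \<le> j" "j \<le> part l i" using that by (auto simp: boxes_def)
    show ?thesis
    proof (cases "j \<le> diag_length l")
      case True
      then show ?thesis using DD'_gap[OF assms ij(2)] bead_less_iff[OF l ij(1,2)] by simp
    next
      case False
      then have g: "gap l j > 0" using gap_le_0_iff[OF l ij(2)] by simp
      have i: "i \<le> diag_length l"
      proof (rule ccontr)
        assume *: "\<not> i \<le> diag_length l"
        define m where "m = min i j"
        have m: "1 \<le> m" "\<not> m \<le> diag_length l" using * False ij by (auto simp: m_def)
        have "part l i \<le> part l m" by (rule part_antimono[OF l m(1)]) (simp add: m_def)
        then have "m \<le> part l m" using ij by (simp add: m_def)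
        then show False using diag_length[OF l m(1)] m by simp
      qed
      then have "bead l i > 0" using bead_pos_iff[OF l ij(1)] by simp
      then show ?thesis using g i False by simp
    qed
  qed
  have "bij_betw (\<lambda>(i, j). (bead l i, gap l j)) (H_lt_plus g l) (hpairs (int g) (Bd l))"
    unfolding bij_betw_def
  proof
    show "inj_on (\<lambda>(i, j). (bead l i, gap l j)) (H_lt_plus g l)"
    proof (rule inj_onI, clarify)
      fix i j i' j' assume "(i, j) \<in> H_lt_plus g l" "(i', j') \<in> H_lt_plus g l" "bead l i = bead l i'" "gap l j = gap l j'"
      then show "i = i' \<and> j = j'"
        using bead_inj[OF l] gap_inj[OF l] by (auto simp: H_lt_plus_def boxes_def dest: inj_onD)
    qed
    show "(\<lambda>(i, j). (bead l i, gap l j)) ` H_lt_plus g l = hpairs (int g) (Bd l)"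
    proof (intro equalityI subsetI)
      fix p assume "p \<in> (\<lambda>(i, j). (bead l i, gap l j)) ` H_lt_plus g l"
      then obtain i j where p: "p = (bead l i, gap l j)" and ij: "(i, j) \<in> boxes l" "hook l (i, j) < g" "i < j"
        by (auto simp: H_lt_plus_def eps'_def split: if_splits)
      then show "p \<in> hpairs (int g) (Bd l)"
        using hook[OF ij(1)] diag[OF ij(1)] box[of i j] gap_not_in_Bd[OF l, of j]
        by (auto simp: hpairs_def Bd_def)
    next
      fix p assume "p \<in> hpairs (int g) (Bd l)"
      then obtain x z where p: "p = (x, z)" "x \<in> Bd l" "z \<notin> Bd l" "z < x" "x - z < int g" "0 < x + z"
        by (auto simp: hpairs_def)
      obtain i where i: "1 \<le> i" "x = bead l i" using p by (auto simp: Bd_def)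
      obtain j where j: "1 \<le> j" "z = gap l j" by (rule not_in_Bd_gap[OF l p(3)])
      have b: "(i, j) \<in> boxes l" using box i j p by simp
      have "(i, j) \<in> H_lt_plus g l"
        using hook[OF b] diag[OF b] b p i j by (auto simp: H_lt_plus_def eps'_def)
      then show "p \<in> (\<lambda>(i, j). (bead l i, gap l j)) ` H_lt_plus g l"
        using p(1) i j by force
    qed
  qed
  then show ?thesis by (rule bij_betw_same_card)
qed

section \<open>Sign and size\<close>

text \<open>Partitions in \<open>DD2'\<close> are encoded by exponents \<open>e j\<close> congruent to \<open>j\<close> or \<open>-j\<close> modulo \<open>2h\<close>: their
  positive beads are the positive numbers among \<open>e j - h, e j - 3h, \<dots>\<close>. The \<open>V\<close>-coding then
  consists of the numbers \<open>e j + h - 1\<close>.\<close>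

definition Tup :: "nat \<Rightarrow> (nat \<Rightarrow> nat) set" where
  "Tup h = PiE {..h} (\<lambda>j. {n. cls (int h) (int n) = int j})"

definition ptup :: "nat \<Rightarrow> (nat \<Rightarrow> nat) \<Rightarrow> int set" where
  "ptup h e = {x. 0 < x \<and> (\<exists>j\<le>h. \<exists>k. int (e j) = x + int h + 2 * int h * int k)}"

text \<open>The sign of the Vandermonde product of the exponents. It plays the part of the sign of
  the sorting permutation and can be updated one exponent at a time.\<close>

definition sgp :: "nat \<Rightarrow> (nat \<Rightarrow> nat) \<Rightarrow> int" where
  "sgp n e = (\<Prod>j<n. \<Prod>i<j. sgn (int (e j) - int (e i)))"

lemma TupD:
  assumes "e \<in> Tup h" "j \<le> h"
  shows "cls (int h) (int (e j)) = int j"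
  using PiE_mem[OF assms(1)[unfolded Tup_def], of j] assms(2) by simp

lemma Tup_inj:
  assumes "e \<in> Tup h"
  shows "inj_on e {..h}"
proof (rule inj_onI)
  fix i j assume ij: "i \<in> {..h}" "j \<in> {..h}" and eq: "e i = e j"
  have "i \<le> h" "j \<le> h" using ij by auto
  then have "int i = cls (int h) (int (e i))" "cls (int h) (int (e j)) = int j"
    using TupD[OF assms] by auto
  then show "i = j" unfolding eq by simp
qed

lemma ptup_pos: "ptup h e \<subseteq> {0<..}"
  unfolding ptup_def by blast

lemma ptup_finite: "finite (ptup h e)"
proof (rule finite_subset)
  show "ptup h e \<subseteq> (\<Union>j\<le>h. {0..int (e j)})"
  proof
    fix x assume "x \<in> ptup h e"
    then obtain j k where x: "0 < x" "j \<le> h" "int (e j) = x + int h + 2 * int h * int k" by (auto simp: ptup_def)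
    have "0 \<le> 2 * int h * int k" by simp
    then have "x \<le> int (e j)" unfolding x(3) by linarith
    then show "x \<in> (\<Union>j\<le>h. {0..int (e j)})" using x(1,2) by (intro UN_I[of j]) auto
  qed
qed simp

lemma cls_small:
  assumes "h > 0" "n \<le> h"
  shows "cls (int h) (int n) = int n"
  using assms by (intro cls_id) auto

lemma cls_value:
  assumes "h > 0" "cls (int h) (int n) = int c" "n < 3 * h"
  shows "n = c \<and> c \<le> h \<or> n = 2 * h - c \<and> c < h \<or> n = 2 * h + c \<and> c < h"
proof (cases "n < 2 * h")
  case True
  then have "int n mod (2 * int h) = int n" by simp
  then show ?thesis using assms True by (auto simp: cls_def split: if_splits)
next
  case False
  have "int n mod (2 * int h) = (int n - 2 * int h) mod (2 * int h)" by simp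
  also have "\<dots> = int n - 2 * int h" using False assms by (intro mod_pos_pos_trivial) auto
  finally show ?thesis using assms False by (auto simp: cls_def split: if_splits)
qed

section \<open>Effect of lowering one exponent\<close>

lemma prod_pairs_point:
  fixes u :: "nat \<Rightarrow> int"
  shows "(\<Prod>j<n. \<Prod>i<j. if j = c then u i else if i = c then u j else 1) =
           (if c < n then \<Prod>i\<in>{..<n} - {c}. u i else 1)"
proof (induction n)
  case 0
  then show ?case by simp
next
  case (Suc n)
  consider "n < c" | "n = c" | "c < n" by linarith
  then show ?case
  proof cases
    case 1
    then have "(\<Prod>i<n. if n = c then u i else if i = c then u n else 1) = 1" by (intro prod.neutral) auto
    then show ?thesis using Suc 1 by simp
  next
    case 2
    then have "{..<Suc n} - {c} = {..<n}" by auto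
    then show ?thesis using Suc 2 by simp
  next
    case 3
    have "(\<Prod>i<n. if n = c then u i else if i = c then u n else 1) = (\<Prod>i<n. if i = c then u n else 1)"
      using 3 by (intro prod.cong) auto
    also have "\<dots> = u n" using 3 by (simp add: prod.delta)
    finally have 1: "(\<Prod>i<n. if n = c then u i else if i = c then u n else 1) = u n" .
    have "{..<Suc n} - {c} = insert n ({..<n} - {c})" using 3 by auto
    then show ?thesis using Suc 3 1 by (simp add: mult.commute)
  qed
qed

text \<open>Only pairs containing \<open>c\<close> can change sign. As \<open>e c\<close> is the
  maximum, such a pair changes sign exactly when the other exponent lies between the new value and
  the old one.\<close>

lemma sgp_update:
  assumes c: "c < n" and inj: "inj_on e {..<n}" and max: "\<And>i. i < n \<Longrightarrow> i \<noteq> c \<Longrightarrow> e i < e c"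
    and v: "v < e c" "\<And>i. i < n \<Longrightarrow> i \<noteq> c \<Longrightarrow> e i \<noteq> v"
  shows "sgp n e = sgp n (e(c := v)) * (- 1) ^ card {i. i < n \<and> v < e i \<and> e i < e c}"
proof -
  define u where "u i = (if v < e i \<and> e i < e c then - 1 else (1 :: int))" for i
  have "sgp n e = (\<Prod>j<n. \<Prod>i<j. sgn (int ((e(c := v)) j) - int ((e(c := v)) i)) *
      (if j = c then u i else if i = c then u j else 1))"
    unfolding sgp_def
  proof (intro prod.cong refl)
    fix i j assume "j \<in> {..<n}" "i \<in> {..<j}"
    then have ij: "i < n" "j < n" "i \<noteq> j" by auto
    show "sgn (int (e j) - int (e i)) = sgn (int ((e(c := v)) j) - int ((e(c := v)) i)) *
        (if j = c then u i else if i = c then u j else 1)"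
    proof (cases "j = c")
      case True
      then have "e i < e c" "e i \<noteq> v" using max v(2) ij by auto
      then show ?thesis using True ij v(1) by (auto simp: u_def)
    next
      case False
      show ?thesis
      proof (cases "i = c")
        case True
        then have "e j < e c" "e j \<noteq> v" using max v(2) ij by auto
        then show ?thesis using True ij v(1) by (auto simp: u_def)
      qed (use False in simp)
    qed
  qed
  also have "\<dots> = sgp n (e(c := v)) * (\<Prod>j<n. \<Prod>i<j. if j = c then u i else if i = c then u j else 1)"
    by (simp only: prod.distrib sgp_def)
  also have "(\<Prod>j<n. \<Prod>i<j. if j = c then u i else if i = c then u j else 1) = (\<Prod>i\<in>{..<n} - {c}. u i)"
    using c by (simp only: prod_pairs_point if_True)
  also have "\<dots> = (\<Prod>i\<in>{i. i < n \<and> v < e i \<and> e i < e c}. - 1)"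
    by (rule prod.mono_neutral_cong_right) (auto simp: u_def)
  also have "\<dots> = (- 1) ^ card {i. i < n \<and> v < e i \<and> e i < e c}" by simp
  finally show ?thesis .
qed

text \<open>Of the \<open>2a - 1\<close> integers in the open interval, one of each pair
  \<open>k\<close>, \<open>- k\<close> and the number 0 belong to the set, which is \<open>a\<close>
  of them.\<close>

lemma card_symB_compl:
  assumes S: "symB S" and a: "a > 0"
  shows "int (card {z. z \<notin> S \<and> - a < z \<and> z < a}) = a - 1"
proof -
  have a': "int (nat a) = a" using a by simp
  have "card (S \<inter> {- a<..<a}) = nat a"
    using bij_betw_same_card[OF symB_abs_bij[OF S, of "nat a"], unfolded a'] by simp
  moreover have "card {- a<..<a} = nat (2 * a - 1)" by simp
  moreover have "{- a<..<a} = (S \<inter> {- a<..<a}) \<union> {z. z \<notin> S \<and> - a < z \<and> z < a}" by auto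
  moreover have "card ((S \<inter> {- a<..<a}) \<union> {z. z \<notin> S \<and> - a < z \<and> z < a}) =
      card (S \<inter> {- a<..<a}) + card {z. z \<notin> S \<and> - a < z \<and> z < a}"
  proof (rule card_Un_disjoint)
    have "{z. z \<notin> S \<and> - a < z \<and> z < a} \<subseteq> {- a<..<a}" by auto
    then show "finite {z. z \<notin> S \<and> - a < z \<and> z < a}" by (rule finite_subset) simp
  qed auto
  ultimately have "nat (2 * a - 1) = nat a + card {z. z \<notin> S \<and> - a < z \<and> z < a}" by simp
  then show ?thesis using a by linarith
qed

lemma even_of_int_eq: "int n = 2 * m \<Longrightarrow> even n"
  by presburger

text \<open>Reflecting the largest exponent \<open>e c\<close> modulo \<open>2h\<close> removes exactly the bead \<open>X0\<close>; the sign
  and size formulas follow by induction on the sum of the exponents.\<close>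

context
  fixes h :: nat and e :: "nat \<Rightarrow> nat" and c :: nat
  assumes h: "h > 0" and e: "e \<in> Tup h" and c: "c \<le> h" and vh: "e c > h"
    and max0: "\<forall>i. i \<le> h \<longrightarrow> i \<noteq> c \<longrightarrow> e i < e c"
begin

lemma e_less_e_c: "i \<le> h \<Longrightarrow> i \<noteq> c \<Longrightarrow> e i < e c"
  using max0 by blast

text \<open>Translation by \<open>- 2h\<close>, followed by a change of sign if the result is
  negative. The class is preserved and the exponent stays a natural number.\<close>

definition red :: nat where
  "red = nat \<bar>int (e c) - 2 * int h\<bar>"

lemma red_less: "red < e c"
  using h vh by (auto simp: red_def)

lemma cls_red: "cls (int h) (int red) = int c"
proof -
  have "cls (int h) (int red) = cls (int h) (int (e c) - 2 * int h)"
    using h cls_uminus[of "int h" "int (e c) - 2 * int h"] by (simp add: red_def abs_if)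
  also have "\<dots> = cls (int h) (int (e c))"
    using cls_add[of "int h" "int (e c)" "- 1"] by simp
  finally show ?thesis using TupD[OF e c] by simp
qed

lemma texp_red: "texp (int h) (int (e c)) = texp (int h) (int red) + (int (e c) - int h)"
proof -
  have "texp (int h) (int red) = texp (int h) (int (e c) - 2 * int h)"
    using h texp_uminus[of "int h" "int (e c) - 2 * int h"] by (simp add: red_def abs_if)
  then show ?thesis using texp_add[of "int h" "int (e c) - 2 * int h"] h by simp
qed

lemma Tup_red: "e(c := red) \<in> Tup h"
proof -
  have "e(c := red) \<in> PiE (insert c {..h}) (\<lambda>j. {n. cls (int h) (int n) = int j})"
    by (rule PiE_fun_upd) (use cls_red e in \<open>auto simp: Tup_def\<close>)
  moreover have "insert c {..h} = {..h}" using c by auto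
  ultimately show ?thesis by (simp add: Tup_def)
qed

lemma red_fresh: "i \<le> h \<Longrightarrow> i \<noteq> c \<Longrightarrow> e i \<noteq> red"
  using TupD[OF e, of i] cls_red by (metis of_nat_eq_iff)

abbreviation (input) X0 :: int where
  "X0 \<equiv> int (e c) - int h"

text \<open>If \<open>e c \<ge> 2h\<close>, the new exponent starts the same sequence one step
  lower; if \<open>e c < 2h\<close>, it is below \<open>h\<close> and produces no positive bead.
  Either way only the top bead of that sequence disappears, and it is the largest positive bead of
  all.\<close>

lemma ptup_red: "ptup h e = insert X0 (ptup h (e(c := red)))" "\<And>x. x \<in> ptup h (e(c := red)) \<Longrightarrow> x < X0"
proof -
  show lt: "x < X0" if x: "x \<in> ptup h (e(c := red))" for x
  proof -
    obtain j k where j: "j \<le> h" "int ((e(c := red)) j) = x + int h + 2 * int h * int k" using x by (auto simp: ptup_def)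
    have "(e(c := red)) j < e c" using e_less_e_c[OF j(1)] red_less by auto
    moreover have "0 \<le> 2 * int h * int k" by simp
    ultimately show ?thesis using j(2) by linarith
  qed
  show "ptup h e = insert X0 (ptup h (e(c := red)))"
  proof (intro equalityI subsetI)
    fix x assume "x \<in> ptup h e"
    then obtain j k where x: "0 < x" "j \<le> h" "int (e j) = x + int h + 2 * int h * int k" by (auto simp: ptup_def)
    show "x \<in> insert X0 (ptup h (e(c := red)))"
    proof (cases "j = c")
      case False
      then have "int ((e(c := red)) j) = x + int h + 2 * int h * int k" using x by simp
      then show ?thesis using x unfolding ptup_def by blast
    next
      case True
      show ?thesis
      proof (cases k)
        case 0
        then show ?thesis using x True by simp
      next
        case (Suc k')
        then have *: "int (e c) - 2 * int h = x + int h + 2 * int h * int k'" using x True by (simp add: algebra_simps)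
        moreover have "0 \<le> 2 * int h * int k'" by simp
        ultimately have "int red = x + int h + 2 * int h * int k'" using x(1) by (simp add: red_def)
        then have "int ((e(c := red)) c) = x + int h + 2 * int h * int k'" by simp
        then show ?thesis using x(1) c unfolding ptup_def by blast
      qed
    qed
  next
    fix x assume "x \<in> insert X0 (ptup h (e(c := red)))"
    then consider "x = X0" | "x \<in> ptup h (e(c := red))" by blast
    then show "x \<in> ptup h e"
    proof cases
      case 1
      then have "0 < x" "int (e c) = x + int h + 2 * int h * int 0" using vh by auto
      then show ?thesis using c unfolding ptup_def by blast
    next
      case 2
      then obtain j k where x: "0 < x" "j \<le> h" "int ((e(c := red)) j) = x + int h + 2 * int h * int k" by (auto simp: ptup_def)
      show ?thesis
      proof (cases "j = c")
        case False
        then have "int (e j) = x + int h + 2 * int h * int k" using x by simp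
        then show ?thesis using x unfolding ptup_def by blast
      next
        case True
        have "0 \<le> 2 * int h * int k" by simp
        moreover have "int red = x + int h + 2 * int h * int k" using x True by simp
        ultimately have "int red > int h" using x(1) by linarith
        then have "int red = int (e c) - 2 * int h" using vh by (simp add: red_def)
        then have "int (e c) = x + int h + 2 * int h * int (Suc k)" using x True by (simp add: algebra_simps)
        then show ?thesis using x(1) c unfolding ptup_def by blast
      qed
    qed
  qed
qed

text \<open>The gaps that form a pair of \<open>hpairs (2h)\<close> with the bead
  \<open>X0\<close>.\<close>

definition Aset :: "int set" where
  "Aset = {z. z \<notin> symset (ptup h e) \<and> - X0 < z \<and> z < X0 \<and> X0 - z < 2 * int h}"

lemma finite_Aset: "finite Aset"
proof (rule finite_subset)
  show "Aset \<subseteq> {- X0<..<X0}" by (auto simp: Aset_def)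
qed simp

lemma finite_hpairs:
  assumes "finite P" "P \<subseteq> {0<..}"
  shows "finite (hpairs g (symset P))"
proof (rule finite_subset)
  show "hpairs g (symset P) \<subseteq> (SIGMA x:P. {- x<..<x})"
    by (auto simp: hpairs_def symset_def)
  show "finite (SIGMA x:P. {- x<..<x})" using assms(1) by simp
qed

text \<open>Removing \<open>X0\<close> changes the antisymmetric set only at \<open>X0\<close> and
  \<open>- X0\<close>. Pairs with a smaller bead \<open>x\<close> involve only gaps between
  \<open>- x\<close> and \<open>x\<close>, hence are untouched.\<close>

lemma card_hpairs_red:
  "card (hpairs (2 * int h) (symset (ptup h e))) = card (hpairs (2 * int h) (symset (ptup h (e(c := red))))) + card Aset"
proof -
  let ?P = "ptup h e" and ?P' = "ptup h (e(c := red))"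
  have X0: "X0 > 0" using vh by simp
  have same: "z \<in> symset ?P \<longleftrightarrow> z \<in> symset ?P'" if "- X0 < z" "z < X0" for z
    using that unfolding ptup_red(1) symset_def by auto
  have "hpairs (2 * int h) (symset ?P) = hpairs (2 * int h) (symset ?P') \<union> Pair X0 ` Aset"
  proof (intro equalityI subsetI)
    fix p assume "p \<in> hpairs (2 * int h) (symset ?P)"
    then obtain x z where p: "p = (x, z)" "x \<in> symset ?P" "z \<notin> symset ?P" "z < x" "x - z < 2 * int h" "0 < x + z"
      by (auto simp: hpairs_def)
    then have "x \<in> ?P" by (auto simp: symset_def)
    show "p \<in> hpairs (2 * int h) (symset ?P') \<union> Pair X0 ` Aset"
    proof (cases "x = X0")
      case True
      then show ?thesis using p by (auto simp: Aset_def)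
    next
      case False
      then have "x \<in> ?P'" using \<open>x \<in> ?P\<close> ptup_red(1) by blast
      then have "x < X0" by (rule ptup_red(2))
      then have "z \<notin> symset ?P'" using same[of z] p by simp
      moreover have "x \<in> symset ?P'" using \<open>x \<in> ?P'\<close> by (simp add: symset_def)
      ultimately show ?thesis using p by (auto simp: hpairs_def)
    qed
  next
    fix p assume "p \<in> hpairs (2 * int h) (symset ?P') \<union> Pair X0 ` Aset"
    then consider "p \<in> hpairs (2 * int h) (symset ?P')" | "p \<in> Pair X0 ` Aset" by blast
    then show "p \<in> hpairs (2 * int h) (symset ?P)"
    proof cases
      case 1
      then obtain x z where p: "p = (x, z)" "x \<in> symset ?P'" "z \<notin> symset ?P'" "z < x" "x - z < 2 * int h" "0 < x + z"
        by (auto simp: hpairs_def)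
      then have "x \<in> ?P'" by (auto simp: symset_def)
      then have "x < X0" by (rule ptup_red(2))
      then have "x \<in> symset ?P" "z \<notin> symset ?P" using same[of z] same[of x] p by auto
      then show ?thesis using p by (auto simp: hpairs_def)
    next
      case 2
      moreover have "X0 \<in> symset ?P" using ptup_red(1) by (auto simp: symset_def)
      ultimately show ?thesis by (auto simp: hpairs_def Aset_def)
    qed
  qed
  moreover have "hpairs (2 * int h) (symset ?P') \<inter> Pair X0 ` Aset = {}"
  proof (rule ccontr)
    assume "\<not> ?thesis"
    then obtain z where "(X0, z) \<in> hpairs (2 * int h) (symset ?P')" by auto
    then have "X0 \<in> ?P'" using X0 by (auto simp: hpairs_def symset_def)
    then show False using ptup_red(2) by blast
  qed
  moreover have "card (Pair X0 ` Aset) = card Aset"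
    by (rule card_image) (auto simp: inj_on_def)
  ultimately show ?thesis
    using finite_hpairs[OF ptup_finite ptup_pos, of "2 * int h" h "e(c := red)"] finite_Aset
    by (simp add: card_Un_disjoint)
qed

text \<open>In a window of width at most \<open>2h\<close> below \<open>X0\<close> every exponent
  contributes at most its top bead: a second one would push that exponent beyond the maximum
  \<open>e c\<close>.\<close>

lemma card_ptup_interval:
  assumes "lo \<ge> 0" "lo \<ge> X0 - 2 * int h"
  shows "card {x \<in> ptup h e. lo < x \<and> x < X0} = card {i. i \<le> h \<and> lo + int h < int (e i) \<and> e i < e c}"
proof -
  have "bij_betw (\<lambda>i. int (e i) - int h) {i. i \<le> h \<and> lo + int h < int (e i) \<and> e i < e c} {x \<in> ptup h e. lo < x \<and> x < X0}"
    unfolding bij_betw_def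
  proof
    show "inj_on (\<lambda>i. int (e i) - int h) {i. i \<le> h \<and> lo + int h < int (e i) \<and> e i < e c}"
      using Tup_inj[OF e] by (auto simp: inj_on_def)
    show "(\<lambda>i. int (e i) - int h) ` {i. i \<le> h \<and> lo + int h < int (e i) \<and> e i < e c} = {x \<in> ptup h e. lo < x \<and> x < X0}"
    proof (intro equalityI subsetI)
      fix x assume "x \<in> (\<lambda>i. int (e i) - int h) ` {i. i \<le> h \<and> lo + int h < int (e i) \<and> e i < e c}"
      then obtain i where i: "i \<le> h" "lo + int h < int (e i)" "e i < e c" "x = int (e i) - int h" by auto
      then have "0 < x" "int (e i) = x + int h + 2 * int h * int 0" using assms by auto
      then have "x \<in> ptup h e" using i(1) unfolding ptup_def by blast
      then show "x \<in> {x \<in> ptup h e. lo < x \<and> x < X0}" using i by auto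
    next
      fix x assume x: "x \<in> {x \<in> ptup h e. lo < x \<and> x < X0}"
      then obtain j k where j: "j \<le> h" "int (e j) = x + int h + 2 * int h * int k" by (auto simp: ptup_def)
      have "k = 0"
      proof (rule ccontr)
        assume "k \<noteq> 0"
        then have "1 \<le> int k" by simp
        then have "2 * int h * 1 \<le> 2 * int h * int k" by (intro mult_left_mono) auto
        then have "int (e j) \<ge> x + int h + 2 * int h" using j by simp
        then have "int (e j) > int (e c)" using x assms by auto
        then show False using e_less_e_c[OF j(1)] by (cases "j = c") auto
      qed
      then show "x \<in> (\<lambda>i. int (e i) - int h) ` {i. i \<le> h \<and> lo + int h < int (e i) \<and> e i < e c}"
        using j x by (intro image_eqI[of _ _ j]) auto
    qed
  qed
  from bij_betw_same_card[OF this] show ?thesis ..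
qed

lemma card_compl_ptup_interval:
  assumes "lo \<ge> 0" "lo \<ge> X0 - 2 * int h" "lo < X0"
  shows "int (card {z. z \<notin> symset (ptup h e) \<and> lo < z \<and> z < X0}) =
           X0 - lo - 1 - int (card {i. i \<le> h \<and> lo + int h < int (e i) \<and> e i < e c})"
proof -
  have "{z. z \<notin> symset (ptup h e) \<and> lo < z \<and> z < X0} = {lo<..<X0} - {x \<in> ptup h e. lo < x \<and> x < X0}"
    using assms by (auto simp: symset_def)
  moreover have "card ({lo<..<X0} - {x \<in> ptup h e. lo < x \<and> x < X0}) =
      card {lo<..<X0} - card {x \<in> ptup h e. lo < x \<and> x < X0}"
    using ptup_finite[of h e] by (intro card_Diff_subset) auto
  moreover have "card {x \<in> ptup h e. lo < x \<and> x < X0} \<le> card {lo<..<X0}"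
    by (intro card_mono) auto
  ultimately show ?thesis
    using assms unfolding card_ptup_interval[OF assms(1,2)] by (simp add: of_nat_diff)
qed

text \<open>The gaps range over the \<open>z < X0\<close> above both \<open>- X0\<close> and
  \<open>X0 - 2h\<close>. Symmetric parts of this window are counted by antisymmetry, and positive
  parts by exponents. The cases differ in which of the two kinds of part occur.\<close>

lemma Aset_parity: "even (card Aset + 1 + card {i. i \<le> h \<and> red < e i \<and> e i < e c})"
proof -
  let ?S = "symset (ptup h e)"
  let ?C = "{i. i \<le> h \<and> red < e i \<and> e i < e c}"
  have S: "symB ?S" by (rule symB_symset[OF ptup_pos])
  have finC: "finite {i. i \<le> h \<and> Q i}" for Q
    by (rule finite_subset[of _ "{..h}"]) auto
  consider "X0 \<le> int h" | "int h < X0" "X0 < 2 * int h" | "2 * int h \<le> X0" by linarith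
  then show ?thesis
  proof cases
    \<comment> \<open>The window is symmetric and has \<open>X0 - 1 = h - c - 1\<close> gaps, while
      the exponents jumped over are those with index in \<open>c+1..h\<close>.\<close>
    case 1
    then have v: "h < e c" "e c \<le> 2 * h" using vh by auto
    have "Aset = {z. z \<notin> ?S \<and> - X0 < z \<and> z < X0}" using 1 by (auto simp: Aset_def)
    then have A: "int (card Aset) = X0 - 1" using card_symB_compl[OF S, of X0] vh by simp
    have rc: "red = 2 * h - e c" "c = 2 * h - e c"
    proof -
      show "red = 2 * h - e c" using v by (auto simp: red_def)
      show "c = 2 * h - e c" using cls_value[OF h TupD[OF e c]] v h by linarith
    qed
    have val: "e i = i \<or> e i = 2 * h - i \<and> i < h \<or> e i = 2 * h + i \<and> i < h"
        if i: "i \<le> h" "e i < e c" for i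
      proof -
        have "e i < 3 * h" using i(2) v h by linarith
        then show ?thesis using cls_value[OF h TupD[OF e i(1)]] by blast
      qed
    have "?C = {c<..h}"
    proof (intro equalityI subsetI)
      fix i assume "i \<in> ?C"
      then have i: "i \<le> h" "red < e i" "e i < e c" by auto
      then have "c < i" using val[OF i(1,3)] v rc h by linarith
      then show "i \<in> {c<..h}" using i by simp
    next
      fix i assume "i \<in> {c<..h}"
      then have i: "i \<le> h" "c < i" by auto
      then have "e i < e c" using e_less_e_c[of i] by simp
      moreover have "red < e i" using val[OF i(1) \<open>e i < e c\<close>] v rc h i by linarith
      ultimately show "i \<in> ?C" using i by simp
    qed
    then have "int (card ?C) = int h - int c" using c by simp
    then have "int (card Aset + 1 + card ?C) = 2 * (int h - int c)" using A rc v by auto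
    then show ?thesis by (rule even_of_int_eq)
  next
    \<comment> \<open>The window splits into a symmetric part \<open>\<bar>z\<bar> < 2h - X0\<close>
      and a positive remainder. The exponents jumped over split accordingly, those not seen by the
      remainder having index above \<open>c\<close>.\<close>
    case 2
    then have v: "2 * h < e c" "e c < 3 * h" by auto
    have rc: "red = e c - 2 * h" "c = e c - 2 * h"
    proof -
      show "red = e c - 2 * h" using v by (auto simp: red_def)
      show "c = e c - 2 * h" using cls_value[OF h TupD[OF e c]] v h by linarith
    qed
    \<comment> \<open>The offset -1 makes the strict inequality \<open>lo < z\<close> start at
      \<open>2h - X0\<close>, just after the symmetric part.\<close>
    define lo where "lo = 2 * int h - X0 - 1"
    let ?C1 = "{i. i \<le> h \<and> lo + int h < int (e i) \<and> e i < e c}"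
    have "Aset = {z. z \<notin> ?S \<and> - (2 * int h - X0) < z \<and> z < 2 * int h - X0} \<union> {z. z \<notin> ?S \<and> lo < z \<and> z < X0}"
      using 2 by (auto simp: Aset_def lo_def)
    moreover have "{z. z \<notin> ?S \<and> - (2 * int h - X0) < z \<and> z < 2 * int h - X0} \<inter> {z. z \<notin> ?S \<and> lo < z \<and> z < X0} = {}"
      by (auto simp: lo_def)
    ultimately have "card Aset = card {z. z \<notin> ?S \<and> - (2 * int h - X0) < z \<and> z < 2 * int h - X0} + card {z. z \<notin> ?S \<and> lo < z \<and> z < X0}"
      using finite_Aset by (simp add: card_Un_disjoint)
    moreover have "int (card {z. z \<notin> ?S \<and> - (2 * int h - X0) < z \<and> z < 2 * int h - X0}) = 2 * int h - X0 - 1"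
      by (rule card_symB_compl[OF S]) (use 2 in simp)
    moreover have "int (card {z. z \<notin> ?S \<and> lo < z \<and> z < X0}) = X0 - lo - 1 - int (card ?C1)"
      by (rule card_compl_ptup_interval) (use 2 in \<open>auto simp: lo_def\<close>)
    ultimately have A: "int (card Aset) = X0 - 1 - int (card ?C1)" by (simp add: lo_def)
    have val: "e i = i \<or> e i = 2 * h - i \<and> i < h \<or> e i = 2 * h + i \<and> i < h"
        if i: "i \<le> h" "e i < e c" for i
      proof -
        have "e i < 3 * h" using i(2) v h by linarith
        then show ?thesis using cls_value[OF h TupD[OF e i(1)]] by blast
      qed
    have C: "?C = ?C1 \<union> {c<..h}"
    proof (intro equalityI subsetI)
      fix i assume "i \<in> ?C"
      then have i: "i \<le> h" "red < e i" "e i < e c" by auto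
      have "lo + int h < int (e i) \<or> c < i" using val[OF i(1,3)] i v rc h unfolding lo_def by linarith
      then show "i \<in> ?C1 \<union> {c<..h}" using i by auto
    next
      fix i assume "i \<in> ?C1 \<union> {c<..h}"
      then consider "i \<in> ?C1" | "c < i" "i \<le> h" by auto
      then show "i \<in> ?C"
      proof cases
        case 1
        then show ?thesis using rc v h by (auto simp: lo_def)
      next
        case 2
        then have "e i < e c" using e_less_e_c[of i] by simp
        moreover have "red < e i" using val[OF 2(2) \<open>e i < e c\<close>] v rc h 2 by linarith
        ultimately show ?thesis using 2 by simp
      qed
    qed
    have disj: "?C1 \<inter> {c<..h} = {}"
    proof (rule ccontr)
      assume "?C1 \<inter> {c<..h} \<noteq> {}"
      then obtain i where i: "i \<le> h" "c < i" "lo + int h < int (e i)" "e i < e c" by auto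
      then show False using val[OF i(1,4)] v rc h unfolding lo_def by linarith
    qed
    have "card ?C = card ?C1 + (h - c)"
      unfolding C by (subst card_Un_disjoint[OF finC _ disj]) auto
    then have "int (card Aset + 1 + card ?C) = 2 * int h" using A rc v c by auto
    then show ?thesis by (rule even_of_int_eq)
  next
    \<comment> \<open>The window lies on the positive side, so gaps and exponents jumped over are
      complementary among its \<open>2h - 1\<close> places.\<close>
    case 3
    have r: "int red = int (e c) - 2 * int h" using 3 by (simp add: red_def)
    have "Aset = {z. z \<notin> ?S \<and> X0 - 2 * int h < z \<and> z < X0}" using 3 h by (auto simp: Aset_def)
    moreover have "int (card {z. z \<notin> ?S \<and> X0 - 2 * int h < z \<and> z < X0}) =
        X0 - (X0 - 2 * int h) - 1 - int (card {i. i \<le> h \<and> (X0 - 2 * int h) + int h < int (e i) \<and> e i < e c})"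
      by (rule card_compl_ptup_interval) (use 3 h in auto)
    moreover have "{i. i \<le> h \<and> (X0 - 2 * int h) + int h < int (e i) \<and> e i < e c} = ?C"
      using r by auto
    ultimately have "int (card Aset + 1 + card ?C) = 2 * int h" by simp
    then show ?thesis by (rule even_of_int_eq)
  qed
qed

end

definition psign :: "nat \<Rightarrow> int set \<Rightarrow> int" where
  "psign h P = (- 1) ^ (card P + card (hpairs (2 * int h) (symset P)))"

text \<open>If no exponent exceeds \<open>h\<close>, then \<open>e j = j\<close> and the bead set is
  that of the empty partition. Otherwise the largest exponent is reflected: the removed bead
  \<open>e c - h\<close> is exactly the loss in \<open>texp\<close>, and \<open>Aset_parity\<close>
  equates the two changes of sign.\<close>

theorem psign_ptup:
  assumes h: "h > 0"
  shows "e \<in> Tup h \<Longrightarrow> psign h (ptup h e) = sgp (Suc h) e \<and>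
           (\<Sum>x\<in>ptup h e. x) = (\<Sum>j\<le>h. texp (int h) (int (e j)))"
proof (induction "\<Sum>j\<le>h. e j" arbitrary: e rule: less_induct)
  case less
  note e = less.prems
  show ?case
  proof (cases "\<exists>j\<le>h. e j > h")
    case False
    then have ej: "e j = j" if "j \<le> h" for j
      using TupD[OF e that] cls_small[OF h, of "e j"] that by (simp add: not_less)
    have "ptup h e = {}"
    proof (rule ccontr)
      assume "ptup h e \<noteq> {}"
      then obtain x j k where x: "0 < x" "j \<le> h" "int (e j) = x + int h + 2 * int h * int k" by (auto simp: ptup_def)
      moreover have "0 \<le> 2 * int h * int k" by simp
      ultimately show False using ej[of j] by simp
    qed
    moreover have "hpairs (2 * int h) (symset {}) = {}" by (auto simp: hpairs_def symset_def)
    moreover have "sgp (Suc h) e = 1"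
      unfolding sgp_def by (intro prod.neutral ballI) (auto simp: ej)
    moreover have "texp (int h) (int (e j)) = 0" if "j \<le> h" for j
      using that h by (simp add: ej texp_def cls_small)
    ultimately show ?thesis by (simp add: psign_def)
  next
    case True
    have "Max (e ` {..h}) \<in> e ` {..h}" by (rule Max_in) auto
    then obtain c where "c \<in> {..h}" and m: "Max (e ` {..h}) = e c" by blast
    then have c: "c \<le> h" "\<And>i. i \<le> h \<Longrightarrow> e i \<le> e c"
      using Max_ge[of "e ` {..h}"] by (auto simp flip: m)
    have max: "e i < e c" if "i \<le> h" "i \<noteq> c" for i
      using c(2)[OF that(1)] inj_onD[OF Tup_inj[OF e], of i c] that c(1) by (cases "e i = e c") auto
    have vh: "h < e c"
    proof -
      obtain j where "j \<le> h" "h < e j" using True by blast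
      then show ?thesis using c(2)[of j] by simp
    qed
    have max0: "\<forall>i. i \<le> h \<longrightarrow> i \<noteq> c \<longrightarrow> e i < e c" using max by blast
    note cx = h e c(1) vh max0
    let ?r = "red h e c" and ?e' = "e(c := red h e c)"
    have e': "?e' \<in> Tup h" by (rule Tup_red[OF cx])
    have "(\<Sum>j\<le>h. ?e' j) < (\<Sum>j\<le>h. e j)"
      by (rule sum_strict_mono_ex1) (use red_less[OF cx] c(1) in \<open>auto intro!: bexI[of _ c] simp: less_imp_le\<close>)
    note IH = less.hyps[OF this e']
    have notin: "int (e c) - int h \<notin> ptup h ?e'" using ptup_red(2)[OF cx] by blast
    note P = ptup_red(1)[OF cx]
    have cP: "card (ptup h e) = Suc (card (ptup h ?e'))"
      unfolding P using notin ptup_finite[of h ?e'] by simp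
    let ?C = "{i. i \<le> h \<and> ?r < e i \<and> e i < e c}"
    have par: "(- 1 :: int) ^ (card (Aset h e c) + 1) = (- 1) ^ card ?C"
      using Aset_parity[OF cx] by (auto simp: minus_one_power_iff)
    have "psign h (ptup h e) = psign h (ptup h ?e') * (- 1) ^ (card (Aset h e c) + 1)"
      unfolding psign_def cP card_hpairs_red[OF cx] by (simp add: power_add)
    also have "\<dots> = sgp (Suc h) ?e' * (- 1) ^ card ?C" unfolding par using IH by simp
    also have "?C = {i. i < Suc h \<and> ?r < e i \<and> e i < e c}" by (auto simp: less_Suc_eq_le)
    also have "sgp (Suc h) ?e' * (- 1) ^ card {i. i < Suc h \<and> ?r < e i \<and> e i < e c} = sgp (Suc h) e"
      by (rule sgp_update[symmetric])
         (use c(1) Tup_inj[OF e] max red_less[OF cx] red_fresh[OF cx] in \<open>auto simp: less_Suc_eq_le lessThan_Suc_atMost\<close>)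
    finally have 1: "psign h (ptup h e) = sgp (Suc h) e" .
    have "(\<Sum>x\<in>ptup h e. x) = (int (e c) - int h) + (\<Sum>x\<in>ptup h ?e'. x)"
      unfolding P using notin ptup_finite[of h ?e'] by simp
    also have "(\<Sum>x\<in>ptup h ?e'. x) = (\<Sum>j\<le>h. texp (int h) (int (?e' j)))" using IH by simp
    also have "\<dots> = texp (int h) (int ?r) + (\<Sum>j\<in>{..h} - {c}. texp (int h) (int (e j)))"
      by (subst sum.remove[of _ c]) (use c(1) in \<open>auto intro!: sum.cong\<close>)
    also have "(int (e c) - int h) + \<dots> = (\<Sum>j\<le>h. texp (int h) (int (e j)))"
      using texp_red[OF cx] by (subst (2) sum.remove[of _ c]) (use c(1) in auto)
    finally show ?thesis using 1 by simp
  qed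
qed

section \<open>Quotients and codings\<close>

lemma Bd_bounds:
  assumes "is_partition l"
  shows "x \<in> Bd l \<Longrightarrow> x \<le> int (part l 1)" and "x \<le> - int (length l) \<Longrightarrow> x \<in> Bd l"
proof -
  assume "x \<in> Bd l"
  then obtain i where "1 \<le> i" "x = bead l i" by (auto simp: Bd_def)
  then show "x \<le> int (part l 1)" using part_antimono[OF assms, of 1 i] by (simp add: bead_def)
next
  assume "x \<le> - int (length l)"
  then have "bead l (nat (1 - x)) = x" "1 \<le> nat (1 - x)" by (auto simp: bead_large)
  then show "x \<in> Bd l" unfolding Bd_def by (metis atLeast_iff imageI)
qed

text \<open>The definite description in \<open>quotient\<close> is meaningful because existence
  follows from \<open>Bd_exists\<close> and uniqueness from \<open>Bd_shift_unique\<close>. The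
  offset between word positions and beads disappears into the shift.\<close>

lemma quotient_eq_iff:
  assumes l: "is_partition l" and g: "g > 0" and nu: "is_partition nu"
  shows "quotient g l k = nu \<longleftrightarrow> (\<exists>s. \<forall>x. x \<in> Bd nu \<longleftrightarrow> int g * (x + s) + int k + 1 \<in> Bd l)"
proof -
  define R where "R \<mu> \<longleftrightarrow> is_partition \<mu> \<and> (\<exists>s. \<forall>x. x \<in> Bd \<mu> \<longleftrightarrow> int g * (x + s) + int k + 1 \<in> Bd l)" for \<mu>
  have R_word: "R \<mu> \<longleftrightarrow> is_partition \<mu> \<and> (\<exists>s. \<forall>i. word \<mu> i = word l (int g * (i + s) + int k))" for \<mu>
  proof -
    have "(\<exists>s. \<forall>x. x \<in> Bd \<mu> \<longleftrightarrow> int g * (x + s) + int k + 1 \<in> Bd l) \<longleftrightarrow>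
        (\<exists>s. \<forall>i. i + 1 \<in> Bd \<mu> \<longleftrightarrow> int g * (i + s) + int k + 1 \<in> Bd l)"
    proof
      assume "\<exists>s. \<forall>x. x \<in> Bd \<mu> \<longleftrightarrow> int g * (x + s) + int k + 1 \<in> Bd l"
      then obtain s where s: "\<And>x. x \<in> Bd \<mu> \<longleftrightarrow> int g * (x + s) + int k + 1 \<in> Bd l" by blast
      have "i + 1 \<in> Bd \<mu> \<longleftrightarrow> int g * (i + (s + 1)) + int k + 1 \<in> Bd l" for i
        using s[of "i + 1"] by (simp add: ac_simps)
      then show "\<exists>s. \<forall>i. i + 1 \<in> Bd \<mu> \<longleftrightarrow> int g * (i + s) + int k + 1 \<in> Bd l" by blast
    next
      assume "\<exists>s. \<forall>i. i + 1 \<in> Bd \<mu> \<longleftrightarrow> int g * (i + s) + int k + 1 \<in> Bd l"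
      then obtain s where s: "\<And>i. i + 1 \<in> Bd \<mu> \<longleftrightarrow> int g * (i + s) + int k + 1 \<in> Bd l" by blast
      have "x \<in> Bd \<mu> \<longleftrightarrow> int g * (x + (s - 1)) + int k + 1 \<in> Bd l" for x
        using s[of "x - 1"] by (simp add: algebra_simps)
      then show "\<exists>s. \<forall>x. x \<in> Bd \<mu> \<longleftrightarrow> int g * (x + s) + int k + 1 \<in> Bd l" by blast
    qed
    then show ?thesis unfolding R_def word_eq_iff by simp
  qed
  have uniq: "\<mu> = \<mu>'" if R: "R \<mu>" "R \<mu>'" for \<mu> \<mu>'
  proof -
    obtain s where s: "\<And>x. x \<in> Bd \<mu> \<longleftrightarrow> int g * (x + s) + int k + 1 \<in> Bd l" using R(1) by (auto simp: R_def)
    obtain s' where s': "\<And>x. x \<in> Bd \<mu>' \<longleftrightarrow> int g * (x + s') + int k + 1 \<in> Bd l" using R(2) by (auto simp: R_def)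
    have "x \<in> Bd \<mu> \<longleftrightarrow> x + (s - s') \<in> Bd \<mu>'" for x
      unfolding s s' by simp
    then show ?thesis using Bd_shift_unique[of \<mu> \<mu>' "s - s'"] R by (auto simp: R_def)
  qed
  have "\<exists>\<mu>. R \<mu>"
  proof -
    let ?S = "{y. int g * y + int k + 1 \<in> Bd l}"
    have "\<exists>\<mu> s. is_partition \<mu> \<and> (\<forall>x. x \<in> Bd \<mu> \<longleftrightarrow> x + s \<in> ?S)"
    proof (rule Bd_exists)
      fix y assume "y \<in> ?S"
      then have "int g * y + int k + 1 \<le> int (part l 1)" using Bd_bounds(1)[OF l] by simp
      then have "int g * y \<le> int (part l 1)" by simp
      show "y \<le> int (part l 1)"
      proof (cases "y \<ge> 0")
        case True
        then have "1 * y \<le> int g * y" using g by (intro mult_right_mono) auto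
        then show ?thesis using \<open>int g * y \<le> int (part l 1)\<close> by simp
      qed simp
    next
      fix y assume y: "y \<le> - int (length l) - int k - 1"
      then have "int g * y \<le> 1 * y" using g by (intro mult_right_mono_neg) auto
      then have "int g * y + int k + 1 \<le> - int (length l)" using y by linarith
      then show "y \<in> ?S" using Bd_bounds(2)[OF l] by simp
    qed
    then show ?thesis unfolding R_def by auto
  qed
  then obtain \<mu> where \<mu>: "R \<mu>" by blast
  have "quotient g l k = (THE \<nu>. R \<nu>)"
    unfolding quotient_def R_word ..
  also have "\<dots> = \<mu>" by (rule the_equality) (use \<mu> uniq in auto)
  finally have "quotient g l k = nu \<longleftrightarrow> R nu" using \<mu> uniq by auto
  then show ?thesis using nu by (simp add: R_def)
qed

section \<open>Rectangular quotients in terms of runners\<close>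

lemma is_partition_rectangle: "is_partition (rectangle a b)"
  by (auto simp: rectangle_def is_partition_def sorted_wrt_iff_nth_less)

lemma Bd_rectangle: "x \<in> Bd (rectangle a b) \<longleftrightarrow> x \<le> - int a \<or> int b - int a + 1 \<le> x \<and> x \<le> int b"
proof -
  have bead: "bead (rectangle a b) i = (if i \<le> a then int b else 0) - int i + 1" if "1 \<le> i" for i
    using that by (auto simp: bead_def part_def rectangle_def)
  show ?thesis
  proof
    assume "x \<in> Bd (rectangle a b)"
    then obtain i where "1 \<le> i" "x = bead (rectangle a b) i" by (auto simp: Bd_def)
    then show "x \<le> - int a \<or> int b - int a + 1 \<le> x \<and> x \<le> int b"
      by (auto simp: bead split: if_splits)
  next
    assume x: "x \<le> - int a \<or> int b - int a + 1 \<le> x \<and> x \<le> int b"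
    define i where "i = (if x \<le> - int a then nat (1 - x) else nat (int b + 1 - x))"
    have "1 \<le> i" "bead (rectangle a b) i = x"
    proof -
      show "1 \<le> i" using x by (auto simp: i_def)
      then show "bead (rectangle a b) i = x" using x by (auto simp: bead i_def)
    qed
    then show "x \<in> Bd (rectangle a b)" unfolding Bd_def by (metis atLeast_iff imageI)
  qed
qed

text \<open>The offset of the beads moves word runner \<open>k\<close> to residue
  \<open>k + 1\<close>. The two exceptional runners thus become the residues 0 and \<open>h\<close>,
  the ones fixed by \<open>x \<mapsto> - x\<close> modulo \<open>2h\<close>.\<close>

lemma DD2'_iff:
  assumes h: "h > 0" "t = Suc h"
  shows "l \<in> DD2' t \<longleftrightarrow> l \<in> DD' \<and>
    (\<forall>k<2 * h. k \<noteq> h - 1 \<and> k \<noteq> 2 * h - 1 \<longrightarrow> (\<exists>s. \<forall>x. x \<le> 0 \<longleftrightarrow> 2 * int h * (x + s) + int k + 1 \<in> Bd l)) \<and>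
    (\<exists>m\<ge>1. \<exists>s. \<forall>x. (x \<le> - int m \<or> 0 \<le> x \<and> x \<le> int m - 1) \<longleftrightarrow> 2 * int h * (x + s) + 2 * int h \<in> Bd l) \<and>
    (\<exists>m::nat. \<exists>s. \<forall>x. (x \<le> - int m \<or> 1 \<le> x \<and> x \<le> int m) \<longleftrightarrow> 2 * int h * (x + s) + int h \<in> Bd l)"
proof (cases "l \<in> DD'")
  case False
  then show ?thesis by (simp add: DD2'_def)
next
  case True
  then have l: "is_partition l" using DD'_iff by blast
  have g: "2 * h > 0" using h by simp
  have Q: "quotient (2 * h) l k = rectangle a b \<longleftrightarrow>
      (\<exists>s. \<forall>x. (x \<le> - int a \<or> int b - int a + 1 \<le> x \<and> x \<le> int b) \<longleftrightarrow> 2 * int h * (x + s) + int k + 1 \<in> Bd l)" for k a b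
    unfolding quotient_eq_iff[OF l g is_partition_rectangle] Bd_rectangle by simp
  have e: "2 * t - 2 = 2 * h" "t - 2 = h - 1" "2 * t - 3 = 2 * h - 1" using h by auto
  have Q0: "quotient (2 * h) l k = [] \<longleftrightarrow> (\<exists>s. \<forall>x. x \<le> 0 \<longleftrightarrow> 2 * int h * (x + s) + int k + 1 \<in> Bd l)" for k
  proof -
    have "[] = rectangle 0 0" by (simp add: rectangle_def)
    then have "quotient (2 * h) l k = [] \<longleftrightarrow> quotient (2 * h) l k = rectangle 0 0" by simp
    also have "\<dots> \<longleftrightarrow> (\<exists>s. \<forall>x. x \<le> 0 \<longleftrightarrow> 2 * int h * (x + s) + int k + 1 \<in> Bd l)"
      unfolding Q by (intro ex_cong1 all_cong1) auto
    finally show ?thesis .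
  qed
  have Q1: "quotient (2 * h) l (2 * h - 1) = rectangle m (m - 1) \<longleftrightarrow>
      (\<exists>s. \<forall>x. (x \<le> - int m \<or> 0 \<le> x \<and> x \<le> int m - 1) \<longleftrightarrow> 2 * int h * (x + s) + 2 * int h \<in> Bd l)" if "m \<ge> 1" for m
  proof -
    have "int (2 * h - 1) = 2 * int h - 1" "int (m - 1) = int m - 1" using h that by auto
    then show ?thesis unfolding Q by (intro ex_cong1 all_cong1) simp
  qed
  have Q2: "quotient (2 * h) l (h - 1) = rectangle m m \<longleftrightarrow>
      (\<exists>s. \<forall>x. (x \<le> - int m \<or> 1 \<le> x \<and> x \<le> int m) \<longleftrightarrow> 2 * int h * (x + s) + int h \<in> Bd l)" for m
  proof -
    have "int (h - 1) = int h - 1" using h by auto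
    then show ?thesis unfolding Q by (intro ex_cong1 all_cong1) simp
  qed
  have "(\<exists>m\<ge>1. quotient (2 * h) l (2 * h - 1) = rectangle m (m - 1)) \<longleftrightarrow>
      (\<exists>m\<ge>1. \<exists>s. \<forall>x. (x \<le> - int m \<or> 0 \<le> x \<and> x \<le> int m - 1) \<longleftrightarrow> 2 * int h * (x + s) + 2 * int h \<in> Bd l)"
    using Q1 by (intro ex_cong1 conj_cong refl) blast
  then show ?thesis
    unfolding DD2'_def e mem_Collect_eq Q0 Q2 using True by simp
qed

text \<open>The bead set of an \<open>m\<close> by \<open>m - 1\<close> rectangle is already
  antisymmetric about its own origin. Testing the antisymmetry at the highest bead and at the lowest
  gap shows that the origin is 0.\<close>

lemma runner_shift_0:
  fixes A :: "int \<Rightarrow> bool"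
  assumes A: "\<And>J. A J \<longleftrightarrow> J - s \<le> - int m \<or> 0 \<le> J - s \<and> J - s \<le> int m - 1" and m: "m \<ge> 1"
    and sym: "\<And>J. J \<noteq> 0 \<Longrightarrow> A J \<longleftrightarrow> \<not> A (- J)" and zero: "A 0"
  shows "s = 0"
proof (rule antisym)
  show "s \<le> 0"
  proof (cases "s + int m - 1 = 0")
    case False
    then have "A (s + int m - 1) \<longleftrightarrow> \<not> A (- (s + int m - 1))" by (rule sym)
    then show ?thesis using m unfolding A by linarith
  qed (use m in linarith)
  show "s \<ge> 0"
  proof (rule ccontr)
    assume s: "\<not> s \<ge> 0"
    have "m \<ge> 2" using zero s m unfolding A by linarith
    then have "A (s + 1 - int m) \<longleftrightarrow> \<not> A (- (s + 1 - int m))" using s by (intro sym) linarith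
    then show False using s \<open>m \<ge> 2\<close> unfolding A by linarith
  qed
qed

text \<open>The analogue for the residue \<open>h\<close>, where reflection exchanges
  \<open>J\<close> and \<open>- 1 - J\<close> and the block is a square; the test points are again
  the highest bead and the lowest gap.\<close>

lemma runner_shift_half:
  fixes A :: "int \<Rightarrow> bool"
  assumes A: "\<And>J. A J \<longleftrightarrow> J - s \<le> - int m \<or> 1 \<le> J - s \<and> J - s \<le> int m"
    and sym: "\<And>J. A J \<longleftrightarrow> \<not> A (- 1 - J)"
  shows "s = - 1"
proof (rule antisym)
  show "s \<le> - 1" using sym[of "s + int m"] unfolding A by linarith
  show "s \<ge> - 1" using sym[of "s + 1 - int m"] unfolding A by linarith
qed

text \<open>These two closure properties are all that is needed to recover exponents: positive beads
  on a runner have no holes below them, and two distinct opposite runners never both carry positive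
  beads.\<close>

lemma DD2'_closed:
  assumes h: "h > 0" "t = Suc h" and l: "l \<in> DD2' t"
  defines "P \<equiv> Bd l \<inter> {0<..}"
  shows "x \<in> P \<Longrightarrow> 2 * int h < x \<Longrightarrow> x - 2 * int h \<in> P"
    and "x \<in> P \<Longrightarrow> y \<in> P \<Longrightarrow> 2 * int h dvd x + y \<Longrightarrow> 2 * int h dvd x - y"
proof -
  let ?g = "2 * int h"
  note D = l[unfolded DD2'_iff[OF h]]
  have S: "symB (Bd l)" using D DD'_symB by blast
  have g: "?g > 0" using h by simp
  \<comment> \<open>On a runner with empty quotient the beads are pushed down completely, so every
    place below a bead is a bead.\<close>
  have normal: "z \<in> Bd l" if x: "x \<in> Bd l" "z \<le> x" "?g dvd x - z" "\<not> ?g dvd x" "\<not> ?g dvd x - int h" for x z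
  proof -
    define k where "k = nat ((x - 1) mod ?g)"
    have k: "int k = (x - 1) mod ?g" "k < 2 * h"
      using g pos_mod_sign[of ?g "x - 1"] pos_mod_bound[of ?g "x - 1"] by (auto simp: k_def nat_less_iff)
    have xk: "x = ?g * ((x - 1) div ?g) + int k + 1" using k(1) mult_div_mod_eq[of ?g "x - 1"] by simp
    have "k \<noteq> 2 * h - 1"
    proof
      assume "k = 2 * h - 1"
      then have "x = ?g * ((x - 1) div ?g + 1)" using xk h by (simp add: algebra_simps)
      then show False using x(4) by (metis dvd_triv_left)
    qed
    moreover have "k \<noteq> h - 1"
    proof
      assume "k = h - 1"
      then have "x - int h = ?g * ((x - 1) div ?g)" using xk h by simp
      then show False using x(5) by (metis dvd_triv_left)
    qed
    ultimately obtain s where s: "\<And>y. y \<le> 0 \<longleftrightarrow> ?g * (y + s) + int k + 1 \<in> Bd l" using D k(2) by blast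
    obtain n where n: "x - z = ?g * n" using x(3) by (auto elim: dvdE)
    have "n \<ge> 0" using n x(2) g by (smt (verit) mult_pos_neg)
    have "x = ?g * (((x - 1) div ?g - s) + s) + int k + 1" using xk by simp
    then have "(x - 1) div ?g - s \<le> 0" using s[of "(x - 1) div ?g - s"] x(1) by simp
    then have "(x - 1) div ?g - s - n \<le> 0" using \<open>n \<ge> 0\<close> by simp
    moreover have "z = ?g * (((x - 1) div ?g - s - n) + s) + int k + 1"
      using xk n by (simp add: algebra_simps)
    ultimately show ?thesis using s[of "(x - 1) div ?g - s - n"] by simp
  qed
  show "x - ?g \<in> P" if x: "x \<in> P" "?g < x"
  proof -
    have xS: "x \<in> Bd l" using x by (simp add: P_def)
    consider "?g dvd x" | "?g dvd x - int h" | "\<not> ?g dvd x" "\<not> ?g dvd x - int h" by blast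
    then have "x - ?g \<in> Bd l"
    proof cases
      case 1
      then obtain J where J: "x = ?g * J" by (auto elim: dvdE)
      obtain m s where m: "m \<ge> 1" and ms: "\<And>x. (x \<le> - int m \<or> 0 \<le> x \<and> x \<le> int m - 1) \<longleftrightarrow> ?g * (x + s) + ?g \<in> Bd l"
        using D by blast
      define A where "A J \<longleftrightarrow> ?g * J \<in> Bd l" for J
      have A: "A J \<longleftrightarrow> J - (s + 1) \<le> - int m \<or> 0 \<le> J - (s + 1) \<and> J - (s + 1) \<le> int m - 1" for J
        using ms[of "J - (s + 1)"] by (simp add: A_def algebra_simps)
      \<comment> \<open>Antisymmetry of the whole bead set fixes the shift, so the block on this
        runner begins at 0 and a positive bead past the first has one directly below it.\<close>
      have "s + 1 = 0"
      proof (rule runner_shift_0[of A])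
        show "A J \<longleftrightarrow> \<not> A (- J)" if "J \<noteq> 0" for J
          using symB_uminus[OF S, of "?g * J"] that g by (simp add: A_def)
        show "A 0" using S by (simp add: A_def symB_def)
      qed (use A m in auto)
      moreover have "J > 1" using x(2) g unfolding J by simp
      ultimately have "A (J - 1)" using A[of J] A[of "J - 1"] xS J unfolding A_def by auto
      then show ?thesis by (simp add: A_def J algebra_simps)
    next
      case 2
      then obtain J where J: "x - int h = ?g * J" by (auto elim: dvdE)
      then have J': "x = ?g * J + int h" by simp
      obtain m s where ms: "\<And>x. (x \<le> - int m \<or> 1 \<le> x \<and> x \<le> int m) \<longleftrightarrow> ?g * (x + s) + int h \<in> Bd l"
        using D by blast
      define A where "A J \<longleftrightarrow> ?g * J + int h \<in> Bd l" for J
      have A: "A J \<longleftrightarrow> J - s \<le> - int m \<or> 1 \<le> J - s \<and> J - s \<le> int m" for J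
        using ms[of "J - s"] by (simp add: A_def)
      have "s = - 1"
      proof (rule runner_shift_half[of A])
        fix J
        have "?g * J + int h \<noteq> 0"
        proof
          assume "?g * J + int h = 0"
          then have "int h * (2 * J + 1) = 0" by (simp add: algebra_simps)
          then show False using h by simp presburger
        qed
        moreover have "- (?g * J + int h) = ?g * (- 1 - J) + int h" by (simp add: algebra_simps)
        ultimately show "A J \<longleftrightarrow> \<not> A (- 1 - J)"
          using symB_uminus[OF S, of "?g * J + int h"] unfolding A_def by metis
      qed (rule A)
      moreover have "J \<ge> 1"
      proof (rule ccontr)
        assume "\<not> J \<ge> 1"
        then have "?g * J \<le> ?g * 0" using g by (intro mult_left_mono) auto
        then have "x \<le> int h" using J' by linarith
        then show False using x(2) h by simp
      qed
      ultimately have "A (J - 1)" using A[of J] A[of "J - 1"] xS J' unfolding A_def by auto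
      then show ?thesis by (simp add: A_def J' algebra_simps)
    next
      case 3
      then show ?thesis using normal[of x "x - ?g"] xS g by simp
    qed
    then show ?thesis using x(2) by (simp add: P_def)
  qed
  show "?g dvd x - y" if xy: "x \<in> P" "y \<in> P" "?g dvd x + y"
  proof (rule ccontr)
    assume nd: "\<not> ?g dvd x - y"
    have "\<not> ?g dvd x"
    proof
      assume "?g dvd x"
      then have "?g dvd (2 * x - (x + y))" using xy(3) by (intro dvd_diff dvd_mult) auto
      then show False using nd by simp
    qed
    moreover have "\<not> ?g dvd x - int h"
    proof
      assume "?g dvd x - int h"
      then have "?g dvd 2 * (x - int h)" by (rule dvd_mult)
      moreover have "?g dvd 2 * int h" by simp
      ultimately have "?g dvd (2 * (x - int h) + 2 * int h - (x + y))" by (intro dvd_diff[OF dvd_add xy(3)])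
      moreover have "2 * (x - int h) + 2 * int h - (x + y) = x - y" by simp
      ultimately show False using nd by (simp only:)
    qed
    \<comment> \<open>The place \<open>- y\<close> is on the runner of \<open>x\<close> and below
      it, hence a bead; but \<open>y\<close> and \<open>- y\<close> cannot both be beads.\<close>
    ultimately have "- y \<in> Bd l" using normal[of x "- y"] xy by (auto simp: P_def)
    moreover have "y \<in> Bd l" "y \<noteq> 0" using xy(2) by (auto simp: P_def)
    ultimately show False using symB_uminus[OF S, of y] by blast
  qed
qed

section \<open>Recovering the exponents from the positive beads\<close>

lemma cls_eq_cases:
  assumes "h > 0" "cls h x = cls h y"
  shows "2 * h dvd x - y \<or> 2 * h dvd x + y"
proof -
  obtain n where n: "x = cls h x + 2 * h * n \<or> x = - cls h x + 2 * h * n"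
    using cls_cases[OF assms(1), of x] by metis
  obtain n' where n': "y = cls h x + 2 * h * n' \<or> y = - cls h x + 2 * h * n'"
    using cls_cases[OF assms(1), of y] assms(2) by metis
  have "x - y = 2 * h * (n - n') \<or> x + y = 2 * h * (n + n')"
    using n n' by (auto simp: algebra_simps)
  then show ?thesis by (metis dvd_triv_left)
qed

text \<open>Each class up to sign contributes the exponent of its largest bead. By \<open>c2\<close>
  all beads of a class lie on one runner, and by \<open>c1\<close> they fill it downwards, so the
  largest bead determines them.\<close>

lemma ptup_exists:
  assumes h: "h > 0" and P: "finite P" "P \<subseteq> {0<..}"
    and c1: "\<And>x. x \<in> P \<Longrightarrow> 2 * int h < x \<Longrightarrow> x - 2 * int h \<in> P"
    and c2: "\<And>x y. x \<in> P \<Longrightarrow> y \<in> P \<Longrightarrow> 2 * int h dvd x + y \<Longrightarrow> 2 * int h dvd x - y"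
  shows "\<exists>e\<in>Tup h. ptup h e = P"
proof -
  define C where "C j = {x \<in> P. cls (int h) (x + int h) = int j}" for j
  have finC: "finite (C j)" for j using P(1) by (simp add: C_def)
  \<comment> \<open>The default \<open>j\<close> of an empty class is the least exponent in that
    class; being at most \<open>h\<close>, it creates no positive bead.\<close>
  define e where "e = restrict (\<lambda>j. if C j = {} then j else nat (Max (C j) + int h)) {..h}"
  have down: "x \<in> P" if "x > 0" "x + 2 * int h * int k \<in> P" for x k
    using that
  proof (induction k)
    case (Suc k)
    have "0 \<le> 2 * int h * int k" by simp
    then have "x + 2 * int h * int (Suc k) - 2 * int h \<in> P"
    proof (intro c1)
      show "x + 2 * int h * int (Suc k) \<in> P" by (rule Suc.prems(2))
      show "2 * int h < x + 2 * int h * int (Suc k)"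
        using Suc.prems(1) \<open>0 \<le> 2 * int h * int k\<close> by (simp only: of_nat_Suc distrib_left)
    qed
    then have "x + 2 * int h * int k \<in> P" by (simp add: algebra_simps)
    then show ?case using Suc by blast
  qed simp
  have eM: "int (e j) = Max (C j) + int h" "Max (C j) \<in> C j" if "j \<le> h" "C j \<noteq> {}" for j
  proof -
    show M: "Max (C j) \<in> C j" using finC that by (intro Max_in) auto
    then have "Max (C j) > 0" using P(2) by (auto simp: C_def)
    then show "int (e j) = Max (C j) + int h" using that by (simp add: e_def)
  qed
  have "e \<in> Tup h"
    unfolding Tup_def
  proof (rule PiE_I)
    fix j assume "j \<in> {..h}"
    then have j: "j \<le> h" by simp
    show "e j \<in> {n. cls (int h) (int n) = int j}"
    proof (cases "C j = {}")
      case True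
      then show ?thesis using j h by (simp add: e_def cls_small)
    next
      case False
      then show ?thesis using eM[OF j False] by (simp add: C_def)
    qed
  qed (simp add: e_def)
  moreover have "ptup h e = P"
  proof (intro equalityI subsetI)
    fix x assume "x \<in> ptup h e"
    then obtain j k where x: "0 < x" "j \<le> h" "int (e j) = x + int h + 2 * int h * int k" by (auto simp: ptup_def)
    have k0: "0 \<le> 2 * int h * int k" by simp
    show "x \<in> P"
    proof (cases "C j = {}")
      case True
      then have "e j = j" using x(2) by (simp add: e_def)
      then show ?thesis using x k0 by linarith
    next
      case False
      then have "x + 2 * int h * int k \<in> P" using eM[OF x(2) False] x(3) by (simp add: C_def)
      then show ?thesis using down x(1) by blast
    qed
  next
    fix x assume x: "x \<in> P"
    define j where "j = nat (cls (int h) (x + int h))"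
    have j: "int j = cls (int h) (x + int h)" "j \<le> h"
      using cls_range[of "int h" "x + int h"] h by (auto simp: j_def)
    have xC: "x \<in> C j" using x j by (simp add: C_def)
    then have ne: "C j \<noteq> {}" by auto
    define M where "M = Max (C j)"
    have "x \<le> M" unfolding M_def by (rule Max_ge[OF finC xC])
    moreover have "int (e j) = M + int h" "M \<in> C j" using eM[OF j(2) ne] by (simp_all add: M_def)
    ultimately have M: "int (e j) = M + int h" "M \<in> P" "cls (int h) (M + int h) = cls (int h) (x + int h)" "x \<le> M"
      using j(1) by (simp_all add: C_def)
    have "2 * int h dvd M - x"
    proof -
      have "2 * int h dvd (M + int h) - (x + int h) \<or> 2 * int h dvd (M + int h) + (x + int h)"
        by (rule cls_eq_cases) (use h M in auto)
      moreover have "(M + int h) + (x + int h) = (M + x) + 2 * int h" by simp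
      ultimately have "2 * int h dvd M - x \<or> 2 * int h dvd M + x" by (metis add_diff_cancel_right dvd_add_triv_right_iff)
      then show ?thesis using c2[OF M(2) x] by blast
    qed
    then obtain n where n: "M - x = 2 * int h * n" by (auto elim: dvdE)
    have "n \<ge> 0"
    proof (rule ccontr)
      assume "\<not> n \<ge> 0"
      then have "2 * int h * n < 0" using h by (intro mult_pos_neg) auto
      then show False using n M(4) by linarith
    qed
    then have "int (e j) = x + int h + 2 * int h * int (nat n)" using n M(1) by simp
    moreover have "0 < x" using x P(2) by auto
    ultimately show "x \<in> ptup h e" using j(2) unfolding ptup_def by blast
  qed
  ultimately show ?thesis by blast
qed

text \<open>An exponent above \<open>h\<close> is visible as the top bead of its class, and an
  exponent up to \<open>h\<close> must equal its index.\<close>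

lemma ptup_inj:
  assumes h: "h > 0" and e: "e \<in> Tup h" "e' \<in> Tup h" and eq: "ptup h e = ptup h e'"
  shows "e = e'"
proof -
  have le: "e j \<le> e' j" if "e \<in> Tup h" "e' \<in> Tup h" "ptup h e = ptup h e'" "j \<le> h" "e j > h" for e e' j
  proof -
    have "int (e j) = (int (e j) - int h) + int h + 2 * int h * int 0" "0 < int (e j) - int h" using that(5) by auto
    then have "int (e j) - int h \<in> ptup h e" using that(4) unfolding ptup_def by blast
    then have "int (e j) - int h \<in> ptup h e'" using that(3) by simp
    then obtain j' k where j': "j' \<le> h" "int (e' j') = int (e j) - int h + int h + 2 * int h * int k" by (auto simp: ptup_def)
    then have *: "int (e' j') = int (e j) + 2 * int h * int k" by simp
    have "int j' = cls (int h) (int (e' j'))" using TupD[OF that(2) j'(1)] by simp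
    also have "\<dots> = int j" unfolding * using TupD[OF that(1,4)] by simp
    finally have "j' = j" by simp
    moreover have "0 \<le> 2 * int h * int k" by simp
    ultimately show ?thesis using * by (simp only: of_nat_le_iff[symmetric, where ?'a = int])
  qed
  have small: "e j = j" if "e \<in> Tup h" "j \<le> h" "e j \<le> h" for e j
    using TupD[OF that(1,2)] cls_small[OF h that(3)] by simp
  have "e j = e' j" if j: "j \<le> h" for j
  proof -
    consider "e j > h" "e' j > h" | "e j > h" "e' j \<le> h" | "e j \<le> h" "e' j > h" | "e j \<le> h" "e' j \<le> h"
      by linarith
    then show ?thesis
    proof cases
      case 1
      then show ?thesis using le[OF e eq j] le[OF e(2,1) eq[symmetric] j] by simp
    next
      case 2
      then show ?thesis using le[OF e eq j] by simp
    next
      case 3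
      then show ?thesis using le[OF e(2,1) eq[symmetric] j] by simp
    next
      case 4
      then show ?thesis using small[OF e(1) j] small[OF e(2) j] by simp
    qed
  qed
  then show ?thesis using e unfolding Tup_def by (intro PiE_ext[of e "{..h}" _ e']) auto
qed

section \<open>The runners of the bead set of an exponent tuple\<close>

context
  fixes h :: nat and e :: "nat \<Rightarrow> nat" and S :: "int set"
  assumes h: "h > 0" and e: "e \<in> Tup h" and S_def: "S = symset (ptup h e)"
begin

lemma symS: "symB S"
  unfolding S_def by (rule symB_symset[OF ptup_pos])

lemma ptup_iff:
  assumes "j \<le> h" "cls (int h) (x + int h) = int j" "x > 0"
  shows "x \<in> ptup h e \<longleftrightarrow> (\<exists>k::nat. int (e j) = x + int h + 2 * int h * int k)"
proof
  assume "x \<in> ptup h e"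
  then obtain j' k where j': "j' \<le> h" "int (e j') = x + int h + 2 * int h * int k" by (auto simp: ptup_def)
  have "int j' = cls (int h) (int (e j'))" using TupD[OF e j'(1)] by simp
  also have "\<dots> = int j" unfolding j'(2) using assms(2) by simp
  finally show "\<exists>k::nat. int (e j) = x + int h + 2 * int h * int k" using j'(2) by auto
next
  assume "\<exists>k::nat. int (e j) = x + int h + 2 * int h * int k"
  then show "x \<in> ptup h e" using assms unfolding ptup_def by blast
qed

lemma pos_in_S: "x > 0 \<Longrightarrow> x \<in> S \<longleftrightarrow> x \<in> ptup h e"
  by (auto simp: S_def symset_def)

lemma exists_nat_multiple:
  assumes "c = b + 2 * int h * m"
  shows "(\<exists>k::nat. c = b + 2 * int h * int k) \<longleftrightarrow> m \<ge> 0"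
proof
  assume "\<exists>k::nat. c = b + 2 * int h * int k"
  then obtain k :: nat where "c = b + 2 * int h * int k" by blast
  then have "2 * int h * m = 2 * int h * int k" using assms by simp
  then show "m \<ge> 0" using h by simp
next
  assume "m \<ge> 0"
  then show "\<exists>k::nat. c = b + 2 * int h * int k" using assms by (intro exI[of _ "nat m"]) simp
qed

lemma cls_runner: "cls (int h) (int (e j) - int h + 2 * int h * y + int h) = cls (int h) (int (e j))"
  using cls_add[of "int h" "int (e j)" y] by (simp add: add.commute add.left_commute)

lemma pos_runner:
  assumes "j \<le> h" "int (e j) - int h + 2 * int h * y > 0"
  shows "int (e j) - int h + 2 * int h * y \<in> S \<longleftrightarrow> y \<le> 0"
proof -
  have "int (e j) = (int (e j) - int h + 2 * int h * y) + int h + 2 * int h * (- y)" by simp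
  from exists_nat_multiple[OF this] show ?thesis
    unfolding pos_in_S[OF assms(2)]
    by (subst ptup_iff[OF assms(1) _ assms(2)]) (use cls_runner TupD[OF e assms(1)] in auto)
qed

lemma e_not_multiple:
  assumes "0 < j" "j < h"
  shows "int (e j) \<noteq> int h * q"
proof
  assume eq: "int (e j) = int h * q"
  have c: "cls (int h) (int (e j)) = int j" using TupD[OF e] assms by simp
  show False
  proof (cases "even q")
    case True
    then obtain r where "q = 2 * r" by (auto elim: evenE)
    then have "int (e j) = 0 + 2 * int h * r" using eq by simp
    then have "cls (int h) (int (e j)) = cls (int h) 0" by (simp only: cls_add)
    then show False using c assms h by (simp add: cls_id)
  next
    case False
    then obtain r where "q = 2 * r + 1" by (auto elim: oddE)
    then have "int (e j) = int h + 2 * int h * r" using eq by (simp add: algebra_simps)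
    then have "cls (int h) (int (e j)) = cls (int h) (int h)" by (simp only: cls_add)
    then show False using c assms h by (simp add: cls_id)
  qed
qed

text \<open>The positive part holds by construction. A missing negative place would be the mirror
  image of a bead on the opposite runner; the classes \<open>j\<close> and \<open>- j\<close> would
  then coincide modulo \<open>2h\<close>, which \<open>0 < j < h\<close> forbids.\<close>

lemma runner_plus:
  assumes "0 < j" "j < h"
  shows "int (e j) - int h + 2 * int h * y \<in> S \<longleftrightarrow> y \<le> 0"
proof -
  let ?x = "int (e j) - int h + 2 * int h * y"
  have j: "j \<le> h" using assms by simp
  have nz: "?x \<noteq> 0"
  proof
    assume "?x = 0"
    then have "int (e j) = int h * (1 - 2 * y)" by (simp add: algebra_simps)
    then show False using e_not_multiple[OF assms] by blast
  qed
  consider "?x > 0" | "?x < 0" using nz by linarith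
  then show ?thesis
  proof cases
    case 1
    then show ?thesis by (rule pos_runner[OF j])
  next
    case 2
    have "y \<le> 0"
    proof (rule ccontr)
      assume "\<not> y \<le> 0"
      then have "2 * int h * 1 \<le> 2 * int h * y" by (intro mult_left_mono) auto
      then show False using 2 by linarith
    qed
    have "- ?x \<notin> ptup h e"
    proof
      assume p: "- ?x \<in> ptup h e"
      have "cls (int h) (- ?x + int h) = int j"
      proof -
        have "- ?x + int h = - (int (e j) + 2 * int h * (y - 1))" by (simp add: algebra_simps)
        then have "cls (int h) (- ?x + int h) = cls (int h) (int (e j))"
          using h by (simp only: cls_uminus cls_add of_nat_0_less_iff)
        then show ?thesis using TupD[OF e j] by simp
      qed
      then obtain k :: nat where "int (e j) = - ?x + int h + 2 * int h * int k"
        using p ptup_iff[OF j, of "- ?x"] 2 by auto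
      then have "int (e j) = int h * (1 - y + int k)" by (simp add: algebra_simps)
      then show False using e_not_multiple[OF assms] by blast
    qed
    then have "- ?x \<notin> S" using pos_in_S[of "- ?x"] 2 by simp
    then have "?x \<in> S" using symB_uminus[OF symS nz] by blast
    then show ?thesis using \<open>y \<le> 0\<close> by blast
  qed
qed

lemma runner_minus:
  assumes "0 < j" "j < h"
  shows "- int (e j) - int h + 2 * int h * y \<in> S \<longleftrightarrow> y \<le> 0"
proof -
  let ?x = "- int (e j) - int h + 2 * int h * y"
  have eq: "- ?x = int (e j) - int h + 2 * int h * (1 - y)" by (simp add: algebra_simps)
  have "- ?x \<noteq> 0"
  proof
    assume "- ?x = 0"
    then have "int (e j) = int h * (2 * y - 1)" by (simp add: algebra_simps)
    then show False using e_not_multiple[OF assms] by blast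
  qed
  then have "?x \<noteq> 0" by simp
  then have "?x \<in> S \<longleftrightarrow> - ?x \<notin> S" by (rule symB_uminus[OF symS])
  also have "- ?x \<in> S \<longleftrightarrow> 1 - y \<le> 0" unfolding eq by (rule runner_plus[OF assms])
  finally show ?thesis by auto
qed

lemma e_0: obtains m :: nat where "int (e 0) = 2 * int h * int m"
proof -
  have c: "cls (int h) (int (e 0)) = 0" using TupD[OF e, of 0] by simp
  have "\<exists>n. int (e 0) = 2 * int h * n"
    using cls_cases[of "int h" "int (e 0)"] h unfolding c by auto
  then obtain n where n: "int (e 0) = 2 * int h * n" by blast
  moreover have "n \<ge> 0"
  proof (rule ccontr)
    assume "\<not> n \<ge> 0"
    then have "2 * int h * n < 0" using h by (intro mult_pos_neg) auto
    then show False using n by linarith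
  qed
  ultimately have "int (e 0) = 2 * int h * int (nat n)" by simp
  then show ?thesis by (rule that)
qed

lemma e_h: obtains m :: nat where "int (e h) = int h + 2 * int h * int m"
proof -
  have c: "cls (int h) (int (e h)) = int h" using TupD[OF e, of h] by simp
  have hh: "int h > 0" using h by simp
  have "\<exists>n. int (e h) = int h + 2 * int h * n"
  proof (cases rule: cls_cases[OF hh, of "int (e h)"])
    case (2 n)
    then have "int (e h) = int h + 2 * int h * (n - 1)" unfolding c by (simp add: algebra_simps)
    then show ?thesis by blast
  next
    case (1 n)
    then show ?thesis unfolding c by blast
  qed
  then obtain n where n: "int (e h) = int h + 2 * int h * n" by blast
  moreover have "n \<ge> 0"
  proof (rule ccontr)
    assume "\<not> n \<ge> 0"
    then have "2 * int h * n \<le> 2 * int h * (- 1)" using h by (intro mult_left_mono) auto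
    then show False using n h by linarith
  qed
  ultimately have "int (e h) = int h + 2 * int h * int (nat n)" by simp
  then show ?thesis by (rule that)
qed

text \<open>The class 0 lies on the residue \<open>h\<close>, which is its own mirror image. Its
  \<open>m\<close> positive beads and their reflection form the pattern of an \<open>m\<close> by
  \<open>m\<close> square.\<close>

lemma runner_0:
  assumes m: "int (e 0) = 2 * int h * int m"
  shows "2 * int h * y + int h \<in> S \<longleftrightarrow> y + 1 \<le> - int m \<or> 1 \<le> y + 1 \<and> y + 1 \<le> int m"
proof -
  have pos: "2 * int h * y + int h \<in> S \<longleftrightarrow> y + 1 \<le> int m" if "y \<ge> 0" for y
  proof -
    have "2 * int h * y \<ge> 0" using that by simp
    then have "2 * int h * y + int h > 0" using h by linarith
    moreover have eq: "2 * int h * y + int h = int (e 0) - int h + 2 * int h * (y + 1 - int m)"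
      unfolding m by (simp add: algebra_simps)
    ultimately have "2 * int h * y + int h \<in> S \<longleftrightarrow> y + 1 - int m \<le> 0"
      unfolding eq by (intro pos_runner) simp_all
    then show ?thesis by simp
  qed
  show ?thesis
  proof (cases "y \<ge> 0")
    case True
    then show ?thesis using pos[OF True] by auto
  next
    case False
    have "2 * int h * y \<le> 2 * int h * (- 1)" using False by (intro mult_left_mono) auto
    then have "2 * int h * y + int h \<noteq> 0" using h by linarith
    then have "2 * int h * y + int h \<in> S \<longleftrightarrow> - (2 * int h * y + int h) \<notin> S" by (rule symB_uminus[OF symS])
    also have "- (2 * int h * y + int h) = 2 * int h * (- 1 - y) + int h" by (simp add: algebra_simps)
    also have "\<dots> \<in> S \<longleftrightarrow> - 1 - y + 1 \<le> int m" by (rule pos) (use False in simp)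
    finally show ?thesis using False by auto
  qed
qed

text \<open>The class \<open>h\<close> lies on the residue 0. The bead at 0 joins the
  \<open>m\<close> positive ones, which is why the rectangle has \<open>m + 1\<close> parts equal to
  \<open>m\<close>.\<close>

lemma runner_h:
  assumes m: "int (e h) = int h + 2 * int h * int m"
  shows "2 * int h * y \<in> S \<longleftrightarrow> y \<le> - int m - 1 \<or> 0 \<le> y \<and> y \<le> int m"
proof -
  have pos: "2 * int h * y \<in> S \<longleftrightarrow> y \<le> int m" if "y > 0" for y
  proof -
    have "2 * int h * y > 0" using that h by simp
    moreover have eq: "2 * int h * y = int (e h) - int h + 2 * int h * (y - int m)"
      unfolding m by (simp add: algebra_simps)
    ultimately have "2 * int h * y \<in> S \<longleftrightarrow> y - int m \<le> 0"
      unfolding eq by (intro pos_runner) simp_all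
    then show ?thesis by simp
  qed
  consider "y > 0" | "y = 0" | "y < 0" by linarith
  then show ?thesis
  proof cases
    case 1
    then show ?thesis using pos[OF 1] by auto
  next
    case 2
    then show ?thesis using symS by (simp add: symB_def)
  next
    case 3
    then have "2 * int h * y \<noteq> 0" using h by simp
    then have "2 * int h * y \<in> S \<longleftrightarrow> - (2 * int h * y) \<notin> S" by (rule symB_uminus[OF symS])
    also have "- (2 * int h * y) = 2 * int h * (- y)" by simp
    also have "\<dots> \<in> S \<longleftrightarrow> - y \<le> int m" by (rule pos) (use 3 in simp)
    finally show ?thesis using 3 by auto
  qed
qed

text \<open>The \<open>2h\<close> runners are those of \<open>e j\<close> for
  \<open>j \<le> h\<close> and of \<open>- e j\<close> for \<open>0 < j < h\<close>. For the indices
  0 and \<open>h\<close> both signs give the same runner.\<close>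

lemma residue_cases:
  obtains j n where "j \<le> h" "x = int (e j) - int h + 2 * int h * n"
  | j n where "0 < j" "j < h" "x = - int (e j) - int h + 2 * int h * n"
proof -
  define j where "j = nat (cls (int h) (x + int h))"
  have j: "int j = cls (int h) (x + int h)" "j \<le> h"
    using cls_range[of "int h" "x + int h"] h by (auto simp: j_def)
  have "cls (int h) (x + int h) = cls (int h) (int (e j))" using TupD[OF e j(2)] j(1) by simp
  then have "2 * int h dvd (x + int h) - int (e j) \<or> 2 * int h dvd (x + int h) + int (e j)"
    using h by (intro cls_eq_cases) auto
  then consider n where "(x + int h) - int (e j) = 2 * int h * n" | n where "(x + int h) + int (e j) = 2 * int h * n"
    by (elim disjE dvdE) blast+
  then show ?thesis
  proof cases
    case (1 n)
    then have "x = int (e j) - int h + 2 * int h * n" by simp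
    then show ?thesis using that(1) j(2) by blast
  next
    case (2 n)
    then have x: "x = - int (e j) - int h + 2 * int h * n" by simp
    consider "j = 0" | "j = h" | "0 < j" "j < h" using j(2) by linarith
    then show ?thesis
    proof cases
      case 1
      obtain m :: nat where m: "int (e 0) = 2 * int h * int m" by (rule e_0)
      have "x = int (e 0) - int h + 2 * int h * (n - 2 * int m)" using x m 1 by (simp add: algebra_simps)
      then show ?thesis using that(1)[of 0] by blast
    next
      case 2
      obtain m :: nat where m: "int (e h) = int h + 2 * int h * int m" by (rule e_h)
      have "x = int (e h) - int h + 2 * int h * (n - 2 * int m - 1)" using x m 2 by (simp add: algebra_simps)
      then show ?thesis using that(1)[of h] by blast
    next
      case 3
      then show ?thesis using that(2) x by blast
    qed
  qed
qed

lemma top_plus: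
  assumes "j \<le> h"
  shows "int (e j) - int h \<in> S" "y > 0 \<Longrightarrow> int (e j) - int h + 2 * int h * y \<notin> S"
proof -
  have "int (e j) - int h + 2 * int h * y \<in> S \<longleftrightarrow> y \<le> 0" if "y \<ge> 0" for y
  proof -
    consider "j = 0" | "j = h" | "0 < j" "j < h" using assms by linarith
    then show ?thesis
    proof cases
      case 1
      obtain m :: nat where m: "int (e 0) = 2 * int h * int m" by (rule e_0)
      have eq: "int (e j) - int h + 2 * int h * y = 2 * int h * (int m + y - 1) + int h"
        using m 1 by (simp add: algebra_simps)
      show ?thesis unfolding eq runner_0[OF m] using that by linarith
    next
      case 2
      obtain m :: nat where m: "int (e h) = int h + 2 * int h * int m" by (rule e_h)
      have eq: "int (e j) - int h + 2 * int h * y = 2 * int h * (int m + y)"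
        using m 2 by (simp add: algebra_simps)
      show ?thesis unfolding eq runner_h[OF m] using that by linarith
    next
      case 3
      then show ?thesis by (rule runner_plus)
    qed
  qed
  from this[of 0] this[of y] show "int (e j) - int h \<in> S" "y > 0 \<Longrightarrow> int (e j) - int h + 2 * int h * y \<notin> S"
    by auto
qed

lemma top_minus:
  assumes "0 < j" "j < h"
  shows "- int (e j) - int h \<in> S" "y > 0 \<Longrightarrow> - int (e j) - int h + 2 * int h * y \<notin> S"
  using runner_minus[OF assms, of 0] runner_minus[OF assms, of y] by auto

lemma in_DD2':
  assumes t: "t = Suc h" and l: "l \<in> DD'" "Bd l = S"
  shows "l \<in> DD2' t"
  unfolding DD2'_iff[OF h t]
proof (intro conjI allI impI)
  fix k :: nat assume k: "k < 2 * h" "k \<noteq> h - 1 \<and> k \<noteq> 2 * h - 1"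
  \<comment> \<open>The residue of a runner other than the two exceptional ones is neither 0 nor
    \<open>h\<close> modulo \<open>2h\<close>, so it belongs to an index strictly between 0 and
    \<open>h\<close>.\<close>
  have special: False if "int k + 1 = 2 * int h * n \<or> int k + 1 = int h + 2 * int h * n" for n
  proof -
    have "n \<ge> 0"
    proof (rule ccontr)
      assume "\<not> n \<ge> 0"
      then have "2 * int h * n \<le> 2 * int h * (- 1)" using h by (intro mult_left_mono) auto
      then show False using that h by linarith
    qed
    moreover have "n \<le> 1"
    proof (rule ccontr)
      assume "\<not> n \<le> 1"
      then have "2 * int h * 2 \<le> 2 * int h * n" using h by (intro mult_left_mono) auto
      then show False using that k h by linarith
    qed
    ultimately have "n = 0 \<or> n = 1" by linarith
    then show False using that k h by auto
  qed
  show "\<exists>s. \<forall>x. x \<le> 0 \<longleftrightarrow> 2 * int h * (x + s) + int k + 1 \<in> Bd l"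
  proof (cases rule: residue_cases[of "int k + 1"])
    case (1 j n)
    have "j \<noteq> 0"
    proof
      assume j: "j = 0"
      obtain m :: nat where m: "int (e 0) = 2 * int h * int m" by (rule e_0)
      have "int k + 1 = int h + 2 * int h * (int m + n - 1)" using 1 m j by (simp add: algebra_simps)
      then show False using special by blast
    qed
    moreover have "j \<noteq> h"
    proof
      assume j: "j = h"
      obtain m :: nat where m: "int (e h) = int h + 2 * int h * int m" by (rule e_h)
      have "int k + 1 = 2 * int h * (int m + n)" using 1 m j by (simp add: algebra_simps)
      then show False using special by blast
    qed
    ultimately have j: "0 < j" "j < h" using 1 by auto
    have "x \<le> 0 \<longleftrightarrow> 2 * int h * (x + (- n)) + int k + 1 \<in> Bd l" for x
    proof -
      have "2 * int h * (x + (- n)) + int k + 1 = int (e j) - int h + 2 * int h * x"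
        using 1(2) by (simp add: algebra_simps)
      then show ?thesis using runner_plus[OF j, of x] l(2) by simp
    qed
    then show ?thesis by blast
  next
    case (2 j n)
    have "x \<le> 0 \<longleftrightarrow> 2 * int h * (x + (- n)) + int k + 1 \<in> Bd l" for x
    proof -
      have "2 * int h * (x + (- n)) + int k + 1 = - int (e j) - int h + 2 * int h * x"
        using 2(3) by (simp add: algebra_simps)
      then show ?thesis using runner_minus[OF 2(1,2), of x] l(2) by simp
    qed
    then show ?thesis by blast
  qed
next
  obtain m :: nat where m: "int (e h) = int h + 2 * int h * int m" by (rule e_h)
  have "(x \<le> - int (Suc m) \<or> 0 \<le> x \<and> x \<le> int (Suc m) - 1) \<longleftrightarrow> 2 * int h * (x + (- 1)) + 2 * int h \<in> Bd l" for x
  proof -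
    have "2 * int h * (x + (- 1)) + 2 * int h = 2 * int h * x" by (simp add: algebra_simps)
    then show ?thesis using runner_h[OF m, of x] l(2) by auto
  qed
  then show "\<exists>m\<ge>1. \<exists>s. \<forall>x. (x \<le> - int m \<or> 0 \<le> x \<and> x \<le> int m - 1) \<longleftrightarrow> 2 * int h * (x + s) + 2 * int h \<in> Bd l"
    by (intro exI[of _ "Suc m"] conjI exI[of _ "- 1"]) auto
next
  obtain m :: nat where m: "int (e 0) = 2 * int h * int m" by (rule e_0)
  have "(x \<le> - int m \<or> 1 \<le> x \<and> x \<le> int m) \<longleftrightarrow> 2 * int h * (x + (- 1)) + int h \<in> Bd l" for x
    using runner_0[OF m, of "x - 1"] l(2) by simp
  then show "\<exists>m::nat. \<exists>s. \<forall>x. (x \<le> - int m \<or> 1 \<le> x \<and> x \<le> int m) \<longleftrightarrow> 2 * int h * (x + s) + int h \<in> Bd l"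
    by blast
qed (rule l)

text \<open>The highest bead \<open>x\<close> on the runner sits at word position
  \<open>x - 1\<close>, and \<open>beta\<close> adds one more period \<open>2h\<close>.\<close>

lemma beta_eq:
  assumes l: "Bd l = S" and x: "x \<in> S" "\<And>y. y > 0 \<Longrightarrow> x + 2 * int h * y \<notin> S" and i: "int i + 1 = x + 2 * int h * n"
  shows "beta (2 * h) l i = x - 1 + 2 * int h"
  unfolding beta_def
proof (rule Greatest_equality)
  have "(- n) * int (2 * h) + int i + 1 = x" using i by (simp add: algebra_simps)
  then show "\<exists>k. x - 1 + 2 * int h = (k + 1) * int (2 * h) + int i \<and> word l (k * int (2 * h) + int i) = 0"
    using i x(1) l unfolding word_eq_0 by (intro exI[of _ "- n"]) (auto simp: algebra_simps)
next
  fix b assume "\<exists>k. b = (k + 1) * int (2 * h) + int i \<and> word l (k * int (2 * h) + int i) = 0"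
  then obtain k where k: "b = (k + 1) * int (2 * h) + int i" "k * int (2 * h) + int i + 1 \<in> S"
    unfolding word_eq_0 l by blast
  have "k * int (2 * h) + int i + 1 = x + 2 * int h * (k + n)" using i by (simp add: algebra_simps)
  then have "k + n \<le> 0" using k(2) x(2)[of "k + n"] by (cases "k + n > 0") auto
  then have "2 * int h * (k + n) \<le> 2 * int h * 0" by (intro mult_left_mono) auto
  moreover have "b = x + 2 * int h * (k + n) - 1 + 2 * int h" using k(1) i by (simp add: algebra_simps)
  ultimately show "b \<le> x - 1 + 2 * int h" by linarith
qed

text \<open>Every runner has exactly one of the top beads \<open>e j - h\<close> or
  \<open>- e j - h\<close>, so the \<open>2h\<close> values of \<open>beta\<close> come in two
  families reflecting the sign of the exponent.\<close>

lemma beta_image: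
  assumes l: "Bd l = S"
  shows "beta (2 * h) l ` {0..<2 * h} =
    (\<lambda>j. int (e j) + int h - 1) ` {..h} \<union> (\<lambda>j. - int (e j) + int h - 1) ` {j. 0 < j \<and> j < h}"
proof (intro equalityI subsetI)
  fix b assume "b \<in> beta (2 * h) l ` {0..<2 * h}"
  then obtain i where i: "b = beta (2 * h) l i" by auto
  show "b \<in> (\<lambda>j. int (e j) + int h - 1) ` {..h} \<union> (\<lambda>j. - int (e j) + int h - 1) ` {j. 0 < j \<and> j < h}"
  proof (cases rule: residue_cases[of "int i + 1"])
    case (1 j n)
    have "b = int (e j) - int h - 1 + 2 * int h"
      unfolding i by (rule beta_eq[OF l top_plus[OF 1(1)] 1(2)])
    then show ?thesis using 1(1) by auto
  next
    case (2 j n)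
    have "b = - int (e j) - int h - 1 + 2 * int h"
      unfolding i by (rule beta_eq[OF l top_minus[OF 2(1,2)] 2(3)])
    then show ?thesis using 2(1,2) by auto
  qed
next
  have ex: "\<exists>i\<in>{0..<2 * h}. \<exists>n. int i + 1 = x + 2 * int h * n" for x
  proof -
    define i where "i = nat ((x - 1) mod (2 * int h))"
    have i: "int i = (x - 1) mod (2 * int h)" "i < 2 * h"
      using h pos_mod_sign[of "2 * int h" "x - 1"] pos_mod_bound[of "2 * int h" "x - 1"] by (auto simp: i_def nat_less_iff)
    have "int i + 1 = x + 2 * int h * (- ((x - 1) div (2 * int h)))"
      unfolding i(1) minus_mult_div_eq_mod[symmetric] by simp
    then show ?thesis using i(2) by (metis atLeastLessThan_iff zero_le)
  qed
  fix b assume "b \<in> (\<lambda>j. int (e j) + int h - 1) ` {..h} \<union> (\<lambda>j. - int (e j) + int h - 1) ` {j. 0 < j \<and> j < h}"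
  then consider j where "j \<le> h" "b = int (e j) + int h - 1" | j where "0 < j" "j < h" "b = - int (e j) + int h - 1"
    by auto
  then show "b \<in> beta (2 * h) l ` {0..<2 * h}"
  proof cases
    case (1 j)
    obtain i n where i: "i \<in> {0..<2 * h}" "int i + 1 = int (e j) - int h + 2 * int h * n" using ex by blast
    have "beta (2 * h) l i = b"
      using beta_eq[OF l top_plus[OF 1(1)] i(2)] 1(2) by simp
    then show ?thesis using i(1) by blast
  next
    case (2 j)
    obtain i n where i: "i \<in> {0..<2 * h}" "int i + 1 = - int (e j) - int h + 2 * int h * n" using ex by blast
    have "beta (2 * h) l i = b"
      using beta_eq[OF l top_minus[OF 2(1,2)] i(2)] 2(3) by simp
    then show ?thesis using i(1) by blast
  qed
qed

end

section \<open>Sorted exponents\<close>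

definition dsc :: "nat \<Rightarrow> (nat \<Rightarrow> nat) \<Rightarrow> nat \<Rightarrow> nat" where
  "dsc h e q = rev (sorted_list_of_set (e ` {..h})) ! q"

lemma length_sorted_Tup:
  assumes "inj_on e {..h}"
  shows "length (sorted_list_of_set (e ` {..h})) = Suc h"
  using card_image[OF assms] by simp

lemma dsc_strict:
  assumes "inj_on e {..h}" "i < j" "j \<le> h"
  shows "dsc h e j < dsc h e i"
proof -
  let ?xs = "sorted_list_of_set (e ` {..h})"
  have "?xs ! (h - j) < ?xs ! (h - i)"
    by (rule sorted_wrt_nth_less[of "(<)"]) (use length_sorted_Tup[OF assms(1)] assms in auto)
  then show ?thesis
    using length_sorted_Tup[OF assms(1)] assms by (simp add: dsc_def rev_nth)
qed

lemma dsc_in: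
  assumes "inj_on e {..h}" "q \<le> h"
  shows "dsc h e q \<in> e ` {..h}"
proof -
  let ?xs = "sorted_list_of_set (e ` {..h})"
  have "rev ?xs ! q \<in> set (rev ?xs)"
    by (rule nth_mem) (use length_sorted_Tup[OF assms(1)] assms(2) in simp)
  then show ?thesis by (simp add: dsc_def)
qed

lemma dsc_permutation:
  assumes inj: "inj_on e {..h}"
  obtains p where "p permutes {0..<Suc h}" "\<And>q. q \<le> h \<Longrightarrow> dsc h e q = e (p q)"
proof -
  define p where "p q = (if q \<le> h then the_inv_into {..h} e (dsc h e q) else q)" for q
  have e_p: "e (p q) = dsc h e q" "p q \<in> {..h}" if "q \<le> h" for q
  proof -
    note in_e = dsc_in[OF inj that]
    have p: "p q = the_inv_into {..h} e (dsc h e q)" using that by (simp add: p_def)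
    show "e (p q) = dsc h e q" unfolding p by (rule f_the_inv_into_f[OF inj in_e])
    show "p q \<in> {..h}" unfolding p by (rule the_inv_into_into[OF inj in_e subset_refl])
  qed
  have "inj_on p {..h}"
  proof (rule inj_onI)
    fix i j assume ij: "i \<in> {..h}" "j \<in> {..h}" "p i = p j"
    then have le: "i \<le> h" "j \<le> h" by simp_all
    then have eq: "dsc h e i = dsc h e j" using e_p(1)[of i] e_p(1)[of j] ij(3) by simp
    show "i = j"
    proof (rule ccontr)
      assume "i \<noteq> j"
      then consider "i < j" | "j < i" by linarith
      then show False
        using dsc_strict[OF inj _ le(2), of i] dsc_strict[OF inj _ le(1), of j] eq by cases simp_all
    qed
  qed
  moreover have "p ` {..h} \<subseteq> {..h}" using e_p(2) by blast
  ultimately have "bij_betw p {..h} {..h}"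
    by (simp add: bij_betw_def endo_inj_surj)
  then have "p permutes {..h}"
    by (rule bij_imp_permutes) (simp add: p_def)
  then have "p permutes {0..<Suc h}" by (simp only: atLeast0LessThan lessThan_Suc_atMost)
  then show ?thesis by (rule that) (simp only: e_p(1))
qed

lemma sgn_prod_int: "sgn (\<Prod>i\<in>A. f i :: int) = (\<Prod>i\<in>A. sgn (f i))"
  by (induction A rule: infinite_finite_induct) (simp_all add: sgn_mult)

text \<open>The sign of the sorting permutation is the quotient of the signs of two Vandermonde determinants.\<close>

lemma det_sorted:
  fixes F :: "nat \<Rightarrow> nat \<Rightarrow> 'a::comm_ring_1"
  assumes inj: "inj_on e {..h}"
  shows "Determinant.det (mat (Suc h) (Suc h) (\<lambda>(i, j). F i (dsc h e j))) =
    of_int ((\<Prod>j<Suc h. \<Prod>i<j. - 1) * sgp (Suc h) e) *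
    Determinant.det (mat (Suc h) (Suc h) (\<lambda>(i, j). F i (e j)))"
proof -
  let ?n = "Suc h"
  obtain p where p: "p permutes {0..<?n}" "\<And>q. q \<le> h \<Longrightarrow> dsc h e q = e (p q)"
    by (rule dsc_permutation[OF inj]) blast
  have rows: "Determinant.det (mat ?n ?n (\<lambda>(i, j). G (dsc h e i) j)) =
      of_int (sign p) * Determinant.det (mat ?n ?n (\<lambda>(i, j). G (e i) j))" for G :: "nat \<Rightarrow> nat \<Rightarrow> 'b::comm_ring_1"
  proof -
    let ?A = "mat ?n ?n (\<lambda>(i, j). G (e i) j)"
    have "mat ?n ?n (\<lambda>(i, j). G (dsc h e i) j) = mat ?n ?n (\<lambda>(i, j). ?A $$ (p i, j))"
    proof (intro eq_matI)
      fix i j assume "i < dim_row (mat ?n ?n (\<lambda>(i, j). ?A $$ (p i, j)))" "j < dim_col (mat ?n ?n (\<lambda>(i, j). ?A $$ (p i, j)))"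
      then have ij: "i < ?n" "j < ?n" by auto
      then have "p i < ?n" using permutes_in_image[OF p(1), of i] by simp
      then show "mat ?n ?n (\<lambda>(i, j). G (dsc h e i) j) $$ (i, j) = mat ?n ?n (\<lambda>(i, j). ?A $$ (p i, j)) $$ (i, j)"
        using ij p(2)[of i] by simp
    qed auto
    then show ?thesis using det_permute_rows[of ?A ?n p] p(1) by simp
  qed
  have tr: "Determinant.det (mat ?n ?n (\<lambda>(i, j). F i (f j))) = Determinant.det (mat ?n ?n (\<lambda>(i, j). F j (f i)))" for f
  proof -
    have "mat ?n ?n (\<lambda>(i, j). F j (f i)) = (mat ?n ?n (\<lambda>(i, j). F i (f j)))\<^sup>T" by (intro eq_matI) auto
    then show ?thesis using det_transpose[of "mat ?n ?n (\<lambda>(i, j). F i (f j))" ?n] by simp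
  qed
  \<comment> \<open>The fact \<open>rows\<close> is used for two matrices. Here it is applied to
    integer powers, where the Vandermonde product reveals the sign of \<open>p\<close>; at the end
    it is applied to the entries of \<open>F\<close>.\<close>
  have "(\<Prod>j<?n. \<Prod>i<j. int (dsc h e j) - int (dsc h e i)) = sign p * (\<Prod>j<?n. \<Prod>i<j. int (e j) - int (e i))"
    using rows[of "\<lambda>m j. int m ^ j"] by (simp only: det_vandermonde of_int_eq_id id_apply)
  then have "sgn (\<Prod>j<?n. \<Prod>i<j. int (dsc h e j) - int (dsc h e i)) = sgn (sign p) * sgn (\<Prod>j<?n. \<Prod>i<j. int (e j) - int (e i))"
    by (simp only: sgn_mult)
  moreover have "sgn (\<Prod>j<?n. \<Prod>i<j. int (e j) - int (e i)) = sgp ?n e"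
    unfolding sgn_prod_int sgp_def ..
  moreover have "sgn (\<Prod>j<?n. \<Prod>i<j. int (dsc h e j) - int (dsc h e i)) = (\<Prod>j<?n. \<Prod>i<j. - 1)"
    unfolding sgn_prod_int
  proof (intro prod.cong refl)
    fix i j assume "j \<in> {..<?n}" "i \<in> {..<j}"
    then have "dsc h e j < dsc h e i" by (intro dsc_strict[OF inj]) auto
    then show "sgn (int (dsc h e j) - int (dsc h e i)) = - 1" by simp
  qed
  moreover have "sgn (sign p) = sign p" by (simp add: sign_def)
  ultimately have k: "(\<Prod>j<?n. \<Prod>i<j. - 1) = sign p * sgp ?n e" by simp
  have "sgp ?n e * sgp ?n e = 1"
  proof -
    have "sgn (int (e j) - int (e i)) * sgn (int (e j) - int (e i)) = 1" if "j < ?n" "i < j" for i j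
    proof -
      have "e j \<noteq> e i" using inj_onD[OF inj, of j i] that by auto
      then show ?thesis by (cases "e j < e i") auto
    qed
    then show ?thesis unfolding sgp_def prod.distrib[symmetric] by (intro prod.neutral ballI) auto
  qed
  then have "(\<Prod>j<?n. \<Prod>i<j. - 1) * sgp ?n e = sign p" unfolding k by (simp add: mult.assoc)
  then show ?thesis using rows[of "\<lambda>m j. F j m"] unfolding tr by (simp only:)
qed

lemma sorted_list_of_set_append:
  fixes A C :: "'a::linorder set"
  assumes "finite A" "finite C" "\<And>c a. c \<in> C \<Longrightarrow> a \<in> A \<Longrightarrow> c < a"
  shows "sorted_list_of_set (C \<union> A) = sorted_list_of_set C @ sorted_list_of_set A"
proof (rule sorted_distinct_set_unique)
  show "sorted (sorted_list_of_set C @ sorted_list_of_set A)"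
    using assms by (auto simp: sorted_append less_imp_le)
  show "distinct (sorted_list_of_set C @ sorted_list_of_set A)"
    using assms by (auto dest: assms(3))
qed (use assms in auto)

text \<open>Since \<open>e j > 0\<close> for \<open>0 < j < h\<close>, every
  \<open>- e j + h - 1\<close> is below every \<open>e i + h - 1\<close>. The \<open>h + 1\<close>
  largest values of \<open>beta\<close> are therefore the shifted exponents in decreasing
  order.\<close>

lemma V_coding_eq:
  assumes h: "h > 0" and e: "e \<in> Tup h" and l: "Bd l = symset (ptup h e)" and q: "q \<le> h"
  shows "V_coding (2 * h) l (Suc q) = int (dsc h e q) + int h - 1"
proof -
  let ?f = "\<lambda>n. int n + int h - 1"
  let ?A = "(\<lambda>j. int (e j) + int h - 1) ` {..h}" and ?C = "(\<lambda>j. - int (e j) + int h - 1) ` {j. 0 < j \<and> j < h}"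
  let ?ys = "sorted_list_of_set (e ` {..h})"
  note inj = Tup_inj[OF e]
  have finC: "finite ?C" by (rule finite_imageI, rule finite_subset[of _ "{..h}"]) auto
  have lt: "c < a" if ca: "c \<in> ?C" "a \<in> ?A" for c a
  proof -
    obtain j where j: "0 < j" "j < h" "c = - int (e j) + int h - 1" using ca(1) by auto
    obtain i where i: "a = int (e i) + int h - 1" using ca(2) by auto
    have "e j \<noteq> 0" using e_not_multiple[OF h e refl j(1,2), of 0] by auto
    then show ?thesis using i j by simp
  qed
  have "sorted_list_of_set ?A = map ?f ?ys"
  proof (rule sorted_distinct_set_unique)
    have "?f (?ys ! i) \<le> ?f (?ys ! j)" if "i \<le> j" "j < length ?ys" for i j
      using sorted_nth_mono[of ?ys i j] that by simp
    then show "sorted (map ?f ?ys)" by (simp add: sorted_iff_nth_mono)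
    show "distinct (map ?f ?ys)" by (simp add: distinct_map inj_on_def)
  qed (auto simp: image_image)
  moreover have "beta (2 * h) l ` {0..<2 * h} = ?C \<union> ?A"
    using beta_image[OF h e refl l] by (simp add: Un_commute)
  ultimately have "rev (sorted_list_of_set (beta (2 * h) l ` {0..<2 * h})) = map ?f (rev ?ys) @ rev (sorted_list_of_set ?C)"
    by (simp add: sorted_list_of_set_append finC lt rev_map)
  then show ?thesis
    using q length_sorted_Tup[OF inj] by (simp add: V_coding_def nth_append dsc_def)
qed

section \<open>The identity\<close>

text \<open>At \<open>n = 0\<close> the value is 1, not 2, because the exponent 0 occurs once in the
  theta series. The discrepancy with the entries of \<open>orth_det\<close> is the source of the
  factor 2 in the character.\<close>

definition spow :: "'a::field \<Rightarrow> nat \<Rightarrow> 'a" where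
  "spow x n = (if n = 0 then 1 else x powi int n + x powi (- int n))"

definition sdet :: "nat \<Rightarrow> (nat \<Rightarrow> 'a::field) \<Rightarrow> (nat \<Rightarrow> nat) \<Rightarrow> 'a" where
  "sdet n x e = Determinant.det (mat n n (\<lambda>(i, j). spow (x i) (e j)))"

lemma gf_add: "gf A w c + gf A w d = gf A w (\<lambda>a. c a + d a)"
  by (simp add: gf_def fps_eq_iff sum.distrib)

lemma gf_restrict:
  assumes "finfib A w" "B \<subseteq> A" "\<And>a. a \<in> A - B \<Longrightarrow> c a = 0"
  shows "gf B w c = gf A w c"
proof (rule fps_ext)
  fix m
  have "finite {a \<in> A. w a = m}" using assms(1) by (simp add: finfib_def)
  then show "gf B w c $ m = gf A w c $ m"
    unfolding gf_def fps_nth_Abs_fps using assms(2,3) by (intro sum.mono_neutral_left) auto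
qed

text \<open>The exponents \<open>k\<close> and \<open>- k\<close> have the same class and the same
  \<open>texp\<close>, so they are merged into one term indexed by a natural number.\<close>

lemma ev_tb_spow:
  fixes x :: "'a::field"
  assumes h: "h > 0" "j \<le> h"
  shows "ev (tb (int h) (int j)) x =
      gf {n::nat. cls (int h) (int n) = int j} (\<lambda>n. nat (texp (int h) (int n))) (spow x)"
    and "finfib {n::nat. cls (int h) (int n) = int j} (\<lambda>n. nat (texp (int h) (int n)))"
proof -
  have H: "int h > 0" using h by simp
  let ?N = "{n::nat. cls (int h) (int n) = int j}"
  let ?w = "\<lambda>n::nat. nat (texp (int h) (int n))"
  have ff: "finfib A (\<lambda>k. nat (texp (int h) k))" for A by (rule finfib_texp[OF H])
  have b1: "bij_betw int B (int ` B)" for B by (simp add: bij_betw_def)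
  have b2: "bij_betw (\<lambda>n. - int n) B ((\<lambda>n. - int n) ` B)" for B by (simp add: bij_betw_def inj_on_def)
  show fN: "finfib ?N ?w" using ff[of "int ` ?N"] unfolding finfib_reindex[OF b1] .
  have "{k. cls (int h) k = int j} = int ` ?N \<union> (\<lambda>n. - int n) ` (?N - {0})"
  proof (intro equalityI subsetI)
    fix k assume k: "k \<in> {k. cls (int h) k = int j}"
    show "k \<in> int ` ?N \<union> (\<lambda>n. - int n) ` (?N - {0})"
    proof (cases "k \<ge> 0")
      case True
      then have "k = int (nat k)" "nat k \<in> ?N" using k by auto
      then show ?thesis by blast
    next
      case False
      then have "k = - int (nat (- k))" "nat (- k) \<noteq> 0" by auto
      moreover have "nat (- k) \<in> ?N" using False k H by simp
      ultimately have "k \<in> (\<lambda>n. - int n) ` (?N - {0})" by (intro image_eqI[of _ _ "nat (- k)"]) simp_all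
      then show ?thesis by (rule UnI2)
    qed
  qed (use H in auto)
  moreover have "int ` ?N \<inter> (\<lambda>n. - int n) ` (?N - {0}) = {}" by auto
  ultimately have "ev (tb (int h) (int j)) x = gf (int ` ?N) (\<lambda>k. nat (texp (int h) k)) (\<lambda>k. x powi k) +
      gf ((\<lambda>n. - int n) ` (?N - {0})) (\<lambda>k. nat (texp (int h) k)) (\<lambda>k. x powi k)"
    by (simp only: ev_tb_gf[OF H] gf_union_disjoint[OF ff ff])
  also have "gf (int ` ?N) (\<lambda>k. nat (texp (int h) k)) (\<lambda>k. x powi k) = gf ?N ?w (\<lambda>n. x powi int n)"
    unfolding gf_reindex[OF b1] ..
  also have "gf ((\<lambda>n. - int n) ` (?N - {0})) (\<lambda>k. nat (texp (int h) k)) (\<lambda>k. x powi k) =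
      gf (?N - {0}) ?w (\<lambda>n. if n = 0 then 0 else x powi (- int n))"
    unfolding gf_reindex[OF b2] texp_uminus[OF H] by (rule gf_cong) auto
  also have "\<dots> = gf ?N ?w (\<lambda>n. if n = 0 then 0 else x powi (- int n))"
    by (rule gf_restrict[OF fN]) auto
  also have "gf ?N ?w (\<lambda>n. x powi int n) + gf ?N ?w (\<lambda>n. if n = 0 then 0 else x powi (- int n)) = gf ?N ?w (spow x)"
    unfolding gf_add by (rule gf_cong) (auto simp: spow_def)
  finally show "ev (tb (int h) (int j)) x = gf ?N ?w (spow x)" .
qed

definition tw :: "nat \<Rightarrow> (nat \<Rightarrow> nat) \<Rightarrow> nat" where
  "tw h e = (\<Sum>j\<le>h. nat (texp (int h) (int (e j))))"

text \<open>In the Leibniz expansion column \<open>j\<close> is a sum over exponents of class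
  \<open>j\<close>, whatever row it is evaluated at. All permutations thus share the index set
  \<open>Tup h\<close>, and for a fixed tuple their sum is again a determinant.\<close>

lemma det_Dmat_gf:
  fixes x :: "nat \<Rightarrow> 'a::field"
  assumes h: "h > 0"
  shows "Determinant.det (Dmat (Suc h) x) = gf (Tup h) (tw h) (sdet (Suc h) x)"
    and "finfib (Tup h) (tw h)"
    and "D0 (Suc h) x = sdet (Suc h) x (\<lambda>j. j)"
proof -
  let ?n = "Suc h"
  let ?A = "\<lambda>j. {n::nat. cls (int h) (int n) = int j}"
  let ?w = "\<lambda>n. nat (texp (int h) (int n))"
  have n: "int ?n - 1 = int h" by simp
  have Tup: "Tup h = PiE {..<?n} ?A" by (simp only: Tup_def lessThan_Suc_atMost)
  have tw: "tw h = (\<lambda>e. \<Sum>j<?n. ?w (e j))" by (simp only: tw_def lessThan_Suc_atMost fun_eq_iff) simp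
  have ff: "finfib (?A j) ?w" if "j \<in> {..<?n}" for j using ev_tb_spow(2)[OF h, of j] that by simp
  show "finfib (Tup h) (tw h)"
    unfolding Tup tw by (rule gf_prod_PiE(2)) (use ff in auto)
  have "Determinant.det (Dmat ?n x) = (\<Sum>p | p permutes {0..<?n}. of_int (sign p) * (\<Prod>j<?n. Dmat ?n x $$ (p j, j)))"
    by (rule det_col) (simp add: Dmat_def)
  also have "\<dots> = (\<Sum>p | p permutes {0..<?n}. gf (Tup h) (tw h) (\<lambda>e. of_int (sign p) * (\<Prod>j<?n. spow (x (p j)) (e j))))"
  proof (intro sum.cong refl)
    fix p assume "p \<in> {p. p permutes {0..<?n}}"
    then have p: "p j < ?n" if "j < ?n" for j using permutes_in_image[of p "{0..<?n}" j] that by simp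
    have "(\<Prod>j<?n. Dmat ?n x $$ (p j, j)) = (\<Prod>j<?n. gf (?A j) ?w (spow (x (p j))))"
    proof (intro prod.cong refl)
      fix j assume "j \<in> {..<?n}"
      then have "j < ?n" "j \<le> h" by auto
      then show "Dmat ?n x $$ (p j, j) = gf (?A j) ?w (spow (x (p j)))"
        using p[of j] ev_tb_spow(1)[OF h, of j] unfolding Dmat_def n by simp
    qed
    also have "\<dots> = gf (Tup h) (tw h) (\<lambda>e. \<Prod>j<?n. spow (x (p j)) (e j))"
      unfolding Tup tw by (rule gf_prod_PiE(1)) (use ff in auto)
    finally show "of_int (sign p) * (\<Prod>j<?n. Dmat ?n x $$ (p j, j)) =
        gf (Tup h) (tw h) (\<lambda>e. of_int (sign p) * (\<Prod>j<?n. spow (x (p j)) (e j)))"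
      by (simp add: gf_cmult fps_of_int)
  qed
  also have "\<dots> = gf (Tup h) (tw h) (\<lambda>e. \<Sum>p | p permutes {0..<?n}. of_int (sign p) * (\<Prod>j<?n. spow (x (p j)) (e j)))"
    by (rule gf_sum[symmetric])
  also have "\<dots> = gf (Tup h) (tw h) (sdet ?n x)"
  proof (rule gf_cong[OF refl])
    fix e
    let ?M = "mat ?n ?n (\<lambda>(i, j). spow (x i) (e j))"
    have "sdet ?n x e = (\<Sum>p | p permutes {0..<?n}. of_int (sign p) * (\<Prod>j<?n. ?M $$ (p j, j)))"
      unfolding sdet_def by (rule det_col) simp
    also have "\<dots> = (\<Sum>p | p permutes {0..<?n}. of_int (sign p) * (\<Prod>j<?n. spow (x (p j)) (e j)))"
    proof (intro sum.cong refl arg_cong2[of _ _ _ _ "(*)"] prod.cong)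
      fix p j assume "p \<in> {p. p permutes {0..<?n}}" "j \<in> {..<?n}"
      then have "p j < ?n" "j < ?n" using permutes_in_image[of p "{0..<?n}" j] by auto
      then show "?M $$ (p j, j) = spow (x (p j)) (e j)" by simp
    qed
    finally show "(\<Sum>p | p permutes {0..<?n}. of_int (sign p) * (\<Prod>j<?n. spow (x (p j)) (e j))) = sdet ?n x e" ..
  qed
  finally show "Determinant.det (Dmat ?n x) = gf (Tup h) (tw h) (sdet ?n x)" .
  show "D0 ?n x = sdet ?n x (\<lambda>j. j)"
    unfolding D0_def sdet_def n
    by (intro arg_cong[of _ _ Determinant.det] eq_matI) (use h in \<open>auto simp: ev_tb_nth_0 spow_def\<close>)
qed

text \<open>The choice is unique, since \<open>Bd\<close> is injective on partitions.\<close>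

definition lam :: "nat \<Rightarrow> (nat \<Rightarrow> nat) \<Rightarrow> nat list" where
  "lam h e = (SOME l. l \<in> DD' \<and> Bd l = symset (ptup h e))"

lemma lam: "lam h e \<in> DD'" "Bd (lam h e) = symset (ptup h e)"
proof -
  have "\<exists>l. l \<in> DD' \<and> Bd l = symset (ptup h e)"
    using partition_of_symB[OF ptup_finite[of h e] ptup_pos[of h e]] by blast
  from someI_ex[OF this] show "lam h e \<in> DD'" "Bd (lam h e) = symset (ptup h e)"
    by (simp_all add: lam_def)
qed

lemma lam_bij:
  assumes h: "h > 0" and t: "t = Suc h"
  shows "bij_betw (lam h) (Tup h) (DD2' t)"
  unfolding bij_betw_def
proof
  have P: "Bd (lam h e) \<inter> {0<..} = ptup h e" for e
    unfolding lam(2) by (rule symB_symset(2)[OF ptup_pos])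
  show "inj_on (lam h) (Tup h)"
  proof (rule inj_onI)
    fix e e' assume e: "e \<in> Tup h" "e' \<in> Tup h" "lam h e = lam h e'"
    have "ptup h e = ptup h e'"
      unfolding P[symmetric] e(3) ..
    then show "e = e'" by (rule ptup_inj[OF h e(1,2)])
  qed
  show "lam h ` Tup h = DD2' t"
  proof (intro equalityI subsetI)
    fix l assume "l \<in> lam h ` Tup h"
    then show "l \<in> DD2' t"
    proof
      fix e assume e: "l = lam h e" "e \<in> Tup h"
      show "l \<in> DD2' t" unfolding e(1) by (rule in_DD2'[OF h e(2) refl t lam(1) lam(2)])
    qed
  next
    fix l assume l: "l \<in> DD2' t"
    then have DD: "l \<in> DD'" by (simp add: DD2'_def)
    have "\<exists>e\<in>Tup h. ptup h e = Bd l \<inter> {0<..}"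
      by (rule ptup_exists[OF h DD'_size(3)[OF DD] Int_lower2 DD2'_closed(1)[OF h t l] DD2'_closed(2)[OF h t l]])
    then obtain e where e: "e \<in> Tup h" "ptup h e = Bd l \<inter> {0<..}" by (rule bexE)
    have "Bd (lam h e) = Bd l" unfolding lam(2) e(2) by (rule symset_symB[OF DD'_symB[OF DD]])
    then have "lam h e = l"
      by (rule Bd_inj[OF DD'_iff[THEN iffD1, THEN conjunct1, OF lam(1)] DD'_iff[THEN iffD1, THEN conjunct1, OF DD]])
    then show "l \<in> lam h ` Tup h" using e(1) by (rule image_eqI[OF sym])
  qed
qed

lemma lam_sign_size:
  assumes h: "h > 0" and e: "e \<in> Tup h"
  shows "(- 1) ^ (diag_length (lam h e) + card (H_lt_plus (2 * h) (lam h e))) = sgp (Suc h) e"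
    and "sum_list (lam h e) div 2 = tw h e"
proof -
  have P: "Bd (lam h e) \<inter> {0<..} = ptup h e"
    unfolding lam(2) by (rule symB_symset(2)[OF ptup_pos])
  note s = psign_ptup[OF h e] and z = DD'_size[OF lam(1), of h e, unfolded P]
  show "(- 1) ^ (diag_length (lam h e) + card (H_lt_plus (2 * h) (lam h e))) = sgp (Suc h) e"
    using s unfolding psign_def z(2) card_H_lt_plus[OF lam(1)] lam(2) by simp
  have "texp (int h) k \<ge> 0" for k by (rule texp(2)) (use h in simp)
  then have "int (tw h e) = (\<Sum>j\<le>h. texp (int h) (int (e j)))" by (simp add: tw_def)
  then have "int (sum_list (lam h e)) = 2 * int (tw h e)" using z(1) s by simp
  then show "sum_list (lam h e) div 2 = tw h e" by linarith
qed

section \<open>The field of Laurent fractions\<close>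

lemma to_fract_prod_one: "to_fract x * to_fract y = 1 \<longleftrightarrow> x * y = 1"
  by (metis to_fract_1 to_fract_eq_iff to_fract_mult)

lemma laurent_fract_char_0:
  fixes c :: int
  assumes "of_int c = (0 :: laurent fract)"
  shows "c = 0"
proof -
  have nat: "to_fract (of_nat n :: laurent) = of_nat n" for n by (induction n) simp_all
  have "to_fract (of_int c :: laurent) = of_int c" by (cases c) (simp_all add: nat)
  then have "of_int c = (0 :: laurent)" using assms by (metis to_fract_0 to_fract_eq_iff)
  then have "Poly_Mapping.lookup (of_int c :: laurent) 0 = 0" by simp
  then show ?thesis by (simp add: lookup_of_int)
qed

lemma xvar_nonzero: "xvar i \<noteq> 0"
proof -
  have "Poly_Mapping.single (Poly_Mapping.single i 1) 1 \<noteq> (0 :: laurent)"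
    by (metis lookup_single_eq lookup_zero zero_neq_one)
  then show ?thesis unfolding xvar_def by simp
qed

lemma xvar_inj:
  assumes "xvar i = xvar j"
  shows "i = j"
proof -
  let ?s = "\<lambda>i. Poly_Mapping.single i (1 :: int)"
  have "Poly_Mapping.single (?s i) (1 :: int) = Poly_Mapping.single (?s j) 1"
    using assms unfolding xvar_def by (simp only: to_fract_eq_iff)
  then have "?s i = ?s j" by (metis lookup_single_eq lookup_single_not_eq zero_neq_one)
  then show ?thesis by (metis lookup_single_eq lookup_single_not_eq zero_neq_one)
qed

lemma xvar_mult_neq_1:
  assumes "i \<noteq> j"
  shows "xvar i * xvar j \<noteq> 1"
proof
  let ?s = "\<lambda>i. Poly_Mapping.single i (1 :: int)"
  assume "xvar i * xvar j = 1"
  then have "Poly_Mapping.single (?s i + ?s j) (1 :: int) = Poly_Mapping.single 0 1"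
    unfolding xvar_def by (simp add: to_fract_prod_one mult_single)
  then have "?s i + ?s j = 0" by (metis lookup_single_eq lookup_single_not_eq zero_neq_one)
  then have "Poly_Mapping.lookup (?s i + ?s j) i = 0" by simp
  then show False using assms by (simp add: lookup_add lookup_single)
qed

text \<open>Each factor is \<open>(b - a) * (a * b - 1) / (a * b)\<close> for two distinct variables
  \<open>a\<close> and \<open>b\<close>, and none of these expressions vanishes.\<close>

lemma wdiff_xvar: "wdiff n (\<lambda>i. xvar (i + 1)) \<noteq> 0"
proof -
  have "(xvar (j + 1) + inverse (xvar (j + 1))) - (xvar (i + 1) + inverse (xvar (i + 1))) \<noteq> 0" if "i < j" for i j
  proof -
    let ?a = "xvar (i + 1)" and ?b = "xvar (j + 1)"
    have "?b - ?a \<noteq> 0" using xvar_inj[of "j + 1" "i + 1"] that by auto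
    moreover have "?a * ?b - 1 \<noteq> 0" using xvar_mult_neq_1[of "i + 1" "j + 1"] that by simp
    moreover have "((?b + inverse ?b) - (?a + inverse ?a)) * (?a * ?b) = (?b - ?a) * (?a * ?b - 1)"
      using xvar_nonzero[of "i + 1"] xvar_nonzero[of "j + 1"] by (simp add: field_simps)
    ultimately show ?thesis by auto
  qed
  then show ?thesis unfolding wdiff_def by auto
qed

lemma K_T_eq: "K_T t = Kprod t (\<lambda>i. xvar (i + 1))"
proof -
  let ?F = "\<lambda>i j. L (xvar i * xvar j) * L (xvar i * inverse (xvar j)) * L (inverse (xvar i) * xvar j) *
                  L (inverse (xvar i) * inverse (xvar j))"
  have "Kprod t (\<lambda>i. xvar (i + 1)) = (\<Prod>(j, i)\<in>(SIGMA j:{..<t}. {..<j}). ?F (i + 1) (j + 1))"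
    unfolding Kprod_def by (simp add: prod.Sigma)
  also have "\<dots> = (\<Prod>(i, j)\<in>{(i, j). 1 \<le> i \<and> i < j \<and> j \<le> t}. ?F i j)"
    by (rule prod.reindex_bij_witness[of _ "\<lambda>(i, j). (j - 1, i - 1)" "\<lambda>(j, i). (i + 1, j + 1)"]) auto
  finally show ?thesis unfolding K_T_def qpoch_inf_eq_iprod by simp
qed

text \<open>A column with exponent 0 has entries 2 where \<open>spow\<close> has 1, so each such
  column contributes a factor 2.\<close>

lemma orth_det_eq:
  assumes "\<And>j. j < n \<Longrightarrow> E (j + 1) = int (f j)"
  shows "orth_det n E = (\<Prod>j<n. if f j = 0 then 2 else 1) * sdet n (\<lambda>i. xvar (i + 1)) f"
proof -
  have "mat n n (\<lambda>(i, j). xvar (i + 1) powi E (j + 1) + xvar (i + 1) powi (- E (j + 1))) =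
      mat n n (\<lambda>(i, j). (if f j = 0 then 2 else 1) * spow (xvar (i + 1)) (f j))"
    by (intro eq_matI) (auto simp: assms[simplified] spow_def)
  then show ?thesis unfolding orth_det_def sdet_def by (simp only: det_scale_cols)
qed

text \<open>The factor 2 from a zero exponent in the numerator cancels against
  \<open>1 + \<delta>\<close>, and the one in the denominator against the 2 in front of the
  quotient. Numerator and denominator are both listed decreasingly; reordering them produces a
  common sign \<open>?k\<close>, and only \<open>sgp\<close> remains.\<close>

lemma o_even_eq:
  assumes h: "h > 0" and e: "e \<in> Tup h"
  shows "o_even (Suc h) (mu (2 * h) (lam h e)) =
    of_int (sgp (Suc h) e) * sdet (Suc h) (\<lambda>i. xvar (i + 1)) e / D0 (Suc h) (\<lambda>i. xvar (i + 1))"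
proof -
  let ?n = "Suc h"
  let ?x = "\<lambda>i. xvar (i + 1)"
  let ?k = "of_int (\<Prod>j<?n. \<Prod>i<j. - 1) :: laurent fract"
  let ?m = "mu (2 * h) (lam h e)"
  note inj = Tup_inj[OF e]
  have two: "(2 :: laurent fract) \<noteq> 0" using laurent_fract_char_0[of 2] by auto
  have V: "?m (j + 1) = int (dsc h e j) + int j - int h" if "j \<le> h" for j
    using V_coding_eq[OF h e lam(2) that] by (simp add: mu_def)
  have num: "orth_det ?n (\<lambda>j. ?m j + int ?n - int j) = (\<Prod>j<?n. if dsc h e j = 0 then 2 else 1) * sdet ?n ?x (dsc h e)"
    by (rule orth_det_eq) (use V in auto)
  \<comment> \<open>The sorted exponents decrease strictly, so only the last can be 0, and it is the
    last part of \<open>mu\<close>.\<close>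
  have "dsc h e j \<noteq> 0" if "j < h" for j using dsc_strict[OF inj that order_refl] by simp
  then have "(\<Prod>j<?n. if dsc h e j = 0 then 2 else 1) = (if dsc h e h = 0 then 2 else (1 :: laurent fract))"
  proof -
    assume nz: "\<And>j. j < h \<Longrightarrow> dsc h e j \<noteq> 0"
    have "(\<Prod>j<h. if dsc h e j = 0 then 2 else (1 :: laurent fract)) = 1"
    proof (intro prod.neutral ballI)
      fix j assume "j \<in> {..<h}"
      then show "(if dsc h e j = 0 then 2 else (1 :: laurent fract)) = 1" using nz[of j] by simp
    qed
    then show ?thesis by (subst prod.lessThan_Suc) simp
  qed
  moreover have "?m ?n = int (dsc h e h)" using V[of h] by simp
  ultimately have "2 * orth_det ?n (\<lambda>j. ?m j + int ?n - int j) / (1 + (if ?m ?n = 0 then 1 else 0)) = 2 * sdet ?n ?x (dsc h e)"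
    unfolding num by (simp only: of_nat_eq_0_iff) (use two in simp)
  moreover have "orth_det ?n (\<lambda>j. int ?n - int j) = 2 * sdet ?n ?x (\<lambda>j. h - j)"
  proof -
    have "orth_det ?n (\<lambda>j. int ?n - int j) = (\<Prod>j<?n. if h - j = 0 then 2 else 1) * sdet ?n ?x (\<lambda>j. h - j)"
      by (rule orth_det_eq) (auto simp: of_nat_diff)
    also have "(\<Prod>j<?n. if h - j = 0 then 2 else 1) = (2 :: laurent fract)"
    proof -
      have "(\<Prod>j<h. if h - j = 0 then 2 else (1 :: laurent fract)) = 1"
        by (intro prod.neutral ballI) auto
      then show ?thesis by (subst prod.lessThan_Suc) simp
    qed
    finally show ?thesis .
  qed
  moreover have "o_even ?n ?m = 2 * orth_det ?n (\<lambda>j. ?m j + int ?n - int j) / (1 + (if ?m ?n = 0 then 1 else 0)) /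
      orth_det ?n (\<lambda>j. int ?n - int j)"
    unfolding o_even_def by (rule divide_divide_eq_left[symmetric])
  ultimately have "o_even ?n ?m = (2 * sdet ?n ?x (dsc h e)) / (2 * sdet ?n ?x (\<lambda>j. h - j))"
    by (simp only:)
  then have o: "o_even ?n ?m = sdet ?n ?x (dsc h e) / sdet ?n ?x (\<lambda>j. h - j)"
    using two by simp
  have 1: "sdet ?n ?x (dsc h e) = ?k * of_int (sgp ?n e) * sdet ?n ?x e"
    unfolding sdet_def using det_sorted[OF inj, of "\<lambda>i m. spow (?x i) m"] by simp
  \<comment> \<open>The exponents \<open>h - j\<close> are the identity tuple sorted decreasingly,
    so \<open>det_sorted\<close> applies to the denominator as well and yields the same sign
    \<open>?k\<close>.\<close>
  have "sdet ?n ?x (\<lambda>j. h - j) = sdet ?n ?x (dsc h (\<lambda>j. j))"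
  proof -
    have "dsc h (\<lambda>j. j) j = h - j" if "j < ?n" for j
    proof -
      have "sorted_list_of_set ((\<lambda>j. j) ` {..h}) = [0..<?n]"
        by (rule sorted_distinct_set_unique) (auto simp del: upt_Suc)
      then show ?thesis using that by (simp add: dsc_def rev_nth del: upt_Suc)
    qed
    then show ?thesis unfolding sdet_def by (intro arg_cong[of _ _ Determinant.det] eq_matI) auto
  qed
  also have "\<dots> = ?k * of_int (sgp ?n (\<lambda>j. j)) * sdet ?n ?x (\<lambda>j. j)"
    unfolding sdet_def using det_sorted[of "\<lambda>j. j" h "\<lambda>i m. spow (?x i) m"] by simp
  also have "sgp ?n (\<lambda>j. j) = 1"
    unfolding sgp_def by (intro prod.neutral ballI) auto
  finally have 2: "sdet ?n ?x (\<lambda>j. h - j) = ?k * D0 ?n ?x"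
    using det_Dmat_gf(3)[OF h, of ?x] by simp
  have "?k \<noteq> 0"
  proof
    assume "?k = 0"
    then have "(\<Prod>j<?n. \<Prod>i<j. - 1) = (0 :: int)" by (rule laurent_fract_char_0)
    then show False by auto
  qed
  then show ?thesis unfolding o 1 2 by simp
qed

theorem theorem5p12:
  fixes t g :: nat
  assumes "t \<ge> 4" and "g = 2 * t - 2"
  shows "((\<lambda>l. fps_const ((- 1) ^ (diag_length l + card (H_lt_plus g l)) * o_even t (mu g l))
             * fps_X ^ (sum_list l div 2))
           has_sum (qpoch_inf fps_X ^ t * K_T t)) (DD2' t)"
proof -
  define h where "h = t - 1"
  have h: "h > 0" "t = Suc h" "g = 2 * h" "t \<ge> 2" using assms by (auto simp: h_def)
  define x where "x i = xvar (i + 1)" for i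
  let ?D = "D0 t x"
  have x_eq: "x = (\<lambda>i. xvar (i + 1))" by (simp add: x_def fun_eq_iff)
  have D: "?D \<noteq> 0"
  proof
    assume "?D = 0"
    then have "wdiff t x = 0"
      by (rule macdonald_D(2)[OF h(4), rotated 2]) (simp_all add: x_def xvar_nonzero laurent_fract_char_0)
    then show False using wdiff_xvar[of t] by (simp add: x_eq)
  qed
  have mac: "fps_const ?D * (L 1 ^ t * Kprod t x) = Determinant.det (Dmat t x)"
    by (rule macdonald_D(1)[OF h(4)]) (use xvar_nonzero laurent_fract_char_0 in \<open>auto simp: x_def\<close>)
  have "qpoch_inf fps_X = (L 1 :: laurent fract fps)"
    using qpoch_inf_eq_iprod[of "1 :: laurent fract"] by simp
  then have "qpoch_inf fps_X ^ t * K_T t = L 1 ^ t * Kprod t x"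
    by (simp only: K_T_eq x_eq)
  also have "\<dots> = (fps_const (inverse ?D) * fps_const ?D) * (L 1 ^ t * Kprod t x)"
    using D by simp
  also have "\<dots> = fps_const (inverse ?D) * Determinant.det (Dmat t x)"
    unfolding mac[symmetric] by (simp only: mult.assoc)
  \<comment> \<open>The product side is now a series over exponent tuples with unsorted
    determinants; what remains is a comparison term by term with the partitions.\<close>
  also have "\<dots> = gf (Tup h) (tw h) (\<lambda>e. inverse ?D * sdet t x e)"
    unfolding h(2) det_Dmat_gf(1)[OF h(1)] gf_cmult ..
  finally have rhs: "qpoch_inf fps_X ^ t * K_T t = gf (Tup h) (tw h) (\<lambda>e. inverse ?D * sdet t x e)" .
  have term_eq: "fps_const ((- 1) ^ (diag_length (lam h e) + card (H_lt_plus g (lam h e))) * o_even t (mu g (lam h e)))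
             * fps_X ^ (sum_list (lam h e) div 2) = fps_const (inverse ?D * sdet t x e) * fps_X ^ tw h e"
    if e: "e \<in> Tup h" for e
  proof -
    note s = lam_sign_size[OF h(1) e]
    \<comment> \<open>The sign attached to the partition and the sign from sorting its exponents are
      both \<open>sgp t e\<close>, so together they disappear.\<close>
    have sq: "sgp t e * sgp t e = 1"
      unfolding h(2) s(1)[symmetric] by (simp flip: power_mult_distrib)
    have "(- 1 :: laurent fract) ^ (diag_length (lam h e) + card (H_lt_plus g (lam h e))) = of_int (sgp t e)"
      unfolding h(2,3) s(1)[symmetric] by simp
    then have "(- 1) ^ (diag_length (lam h e) + card (H_lt_plus g (lam h e))) * o_even t (mu g (lam h e)) =
        of_int (sgp t e * sgp t e) * (sdet t x e / ?D)"
      using o_even_eq[OF h(1) e] unfolding h(2,3) x_eq by simp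
    then have "(- 1) ^ (diag_length (lam h e) + card (H_lt_plus g (lam h e))) * o_even t (mu g (lam h e)) =
        inverse ?D * sdet t x e"
      unfolding sq by (simp add: divide_inverse)
    then show ?thesis by (simp only: s(2))
  qed
  have "((\<lambda>e. fps_const (inverse ?D * sdet t x e) * fps_X ^ tw h e) has_sum
      gf (Tup h) (tw h) (\<lambda>e. inverse ?D * sdet t x e)) (Tup h)"
    by (rule gf_has_sum[OF det_Dmat_gf(2)[OF h(1)]])
  also have "?this \<longleftrightarrow> ((\<lambda>e. fps_const ((- 1) ^ (diag_length (lam h e) + card (H_lt_plus g (lam h e))) * o_even t (mu g (lam h e)))
             * fps_X ^ (sum_list (lam h e) div 2)) has_sum (qpoch_inf fps_X ^ t * K_T t)) (Tup h)"
    unfolding rhs by (rule has_sum_cong) (rule term_eq[symmetric])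
  finally show ?thesis
    unfolding has_sum_reindex_bij_betw[OF lam_bij[OF h(1,2)],
      of "\<lambda>l. fps_const ((- 1) ^ (diag_length l + card (H_lt_plus g l)) * o_even t (mu g l)) * fps_X ^ (sum_list l div 2)"] .
qed

end
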